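(* Let $R$ be a noetherian ring, let $\tau_1,\tau_2$ be automorphisms of $R$, let $\delta_1$ be a left $\tau_1$-derivation of $R$ and $\delta_2$ a left $\tau_2$-derivation of $R$, and let $S=R[x;\tau_1,\delta_1]*_R R[y;\tau_2,\delta_2]$. If $I$ is a prime $(\tau_1,\tau_2,\delta_1,\delta_2)$-ideal of $R$, then $IS=SI$ is a prime ideal of $S$ and $$S/IS\cong (R/I)[x;\tau_1,\delta_1]*_{R/I}(R/I)[y;\tau_2,\delta_2],$$ where on the right-hand side $\tau_1,\tau_2,\delta_1,\delta_2$ denote the induced maps on $R/I$.
   Context: Rings are associative and unital; noetherian means left and right noetherian. For a ring endomorphism $\tau$ of $R$, a left $\tau$-derivation is a $\mathbb{Z}$-linear map $\delta:R\to R$ with $\delta(rs)=\tau(r)\delta(s)+\delta(r)s$ for all $r,s\in R$. The Ore extension $R[x;\tau,\delta]$ is the ring containing $R$ as a subring that is a free left $R$-module with basis $\{1,x,x^2,\dots\}$ and satisfies $xr=\tau(r)x+\delta(r)$ for all $r\in R$. The amalgamated product $S_1*_RS_2$ of two rings $S_1,S_2$ containing $R$ as a subring is the pushout, in the category of rings, of the inclusions $R\hookrightarrow S_1$ and $R\hookrightarrow S_2$. A $(\tau_1,\tau_2,\delta_1,\delta_2)$-ideal of $R$ is a two-sided ideal $I$ with $f(I)\subseteq I$ for each $f\in\{\tau_1,\tau_2,\delta_1,\delta_2\}$. A prime $(\tau_1,\tau_2,\delta_1,\delta_2)$-ideal is such an ideal that is also a prime ideal of $R$. *)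

theory Defs
  imports "HOL-Algebra.QuotRing" "HOL-Algebra.Ideal_Product"
begin

section \<open>Noetherian rings and prime ideals in the noncommutative setting\<close>

definition left_ideal :: "'a set \<Rightarrow> ('a, 'm) ring_scheme \<Rightarrow> bool" where
  "left_ideal I R \<longleftrightarrow> additive_subgroup I R \<and> (\<forall>r\<in>carrier R. \<forall>a\<in>I. r \<otimes>\<^bsub>R\<^esub> a \<in> I)"

definition right_ideal :: "'a set \<Rightarrow> ('a, 'm) ring_scheme \<Rightarrow> bool" where
  "right_ideal I R \<longleftrightarrow> additive_subgroup I R \<and> (\<forall>r\<in>carrier R. \<forall>a\<in>I. a \<otimes>\<^bsub>R\<^esub> r \<in> I)"

text \<open>The library locale \<open>noetherian_ring\<close> of \<open>HOL-Algebra.Ring_Divisibility\<close> only concerns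
  two-sided ideals; here both one-sided ascending chain conditions are required.\<close>

definition noetherian :: "('a, 'm) ring_scheme \<Rightarrow> bool" where
  "noetherian R \<longleftrightarrow> ring R \<and>
     (\<forall>C :: nat \<Rightarrow> 'a set. (\<forall>n. left_ideal (C n) R) \<and> (\<forall>n. C n \<subseteq> C (Suc n))
        \<longrightarrow> (\<exists>N. \<forall>n\<ge>N. C n = C N)) \<and>
     (\<forall>C :: nat \<Rightarrow> 'a set. (\<forall>n. right_ideal (C n) R) \<and> (\<forall>n. C n \<subseteq> C (Suc n))
        \<longrightarrow> (\<exists>N. \<forall>n\<ge>N. C n = C N))"

text \<open>Primeness in terms of products of two-sided ideals; the library locale \<^locale>\<open>primeideal\<close>
  is elementwise and restricted to commutative rings.\<close>

definition prime_ideal :: "'a set \<Rightarrow> ('a, 'm) ring_scheme \<Rightarrow> bool" where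
  "prime_ideal P R \<longleftrightarrow> ideal P R \<and> P \<noteq> carrier R \<and>
     (\<forall>A B. ideal A R \<and> ideal B R \<and> A \<cdot>\<^bsub>R\<^esub> B \<subseteq> P \<longrightarrow> A \<subseteq> P \<or> B \<subseteq> P)"


section \<open>Skew derivations and Ore extensions\<close>

definition left_skew_derivation ::
  "('a, 'm) ring_scheme \<Rightarrow> ('a \<Rightarrow> 'a) \<Rightarrow> ('a \<Rightarrow> 'a) \<Rightarrow> bool" where
  "left_skew_derivation R \<tau> \<delta> \<longleftrightarrow> \<delta> \<in> carrier R \<rightarrow> carrier R \<and>
     (\<forall>r\<in>carrier R. \<forall>s\<in>carrier R. \<delta> (r \<oplus>\<^bsub>R\<^esub> s) = \<delta> r \<oplus>\<^bsub>R\<^esub> \<delta> s) \<and>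
     (\<forall>r\<in>carrier R. \<forall>s\<in>carrier R.
        \<delta> (r \<otimes>\<^bsub>R\<^esub> s) = (\<tau> r \<otimes>\<^bsub>R\<^esub> \<delta> s) \<oplus>\<^bsub>R\<^esub> (\<delta> r \<otimes>\<^bsub>R\<^esub> s))"

text \<open>\<open>T\<close> is an Ore extension \<open>R[x; \<tau>, \<delta>]\<close>, where the inclusion of \<open>R\<close> as a subring is an
  injective homomorphism \<open>\<iota>\<close>.  The last clause says that the powers of \<open>x\<close> form a basis of \<open>T\<close> as a
  left \<open>R\<close>-module: every element has a unique finitely supported family of coordinates.\<close>

definition ore_extension ::
  "('a, 'm) ring_scheme \<Rightarrow> ('a \<Rightarrow> 'a) \<Rightarrow> ('a \<Rightarrow> 'a) \<Rightarrow>
   ('b, 'n) ring_scheme \<Rightarrow> ('a \<Rightarrow> 'b) \<Rightarrow> 'b \<Rightarrow> bool" where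
  "ore_extension R \<tau> \<delta> T \<iota> x \<longleftrightarrow>
     ring T \<and> \<iota> \<in> ring_hom R T \<and> inj_on \<iota> (carrier R) \<and> x \<in> carrier T \<and>
     (\<forall>r\<in>carrier R. x \<otimes>\<^bsub>T\<^esub> \<iota> r = (\<iota> (\<tau> r) \<otimes>\<^bsub>T\<^esub> x) \<oplus>\<^bsub>T\<^esub> \<iota> (\<delta> r)) \<and>
     (\<forall>t\<in>carrier T. \<exists>!c :: nat \<Rightarrow> 'a.
        (\<forall>n. c n \<in> carrier R) \<and> finite {n. c n \<noteq> \<zero>\<^bsub>R\<^esub>} \<and>
        t = (\<Oplus>\<^bsub>T\<^esub>n\<in>{n. c n \<noteq> \<zero>\<^bsub>R\<^esub>}. \<iota> (c n) \<otimes>\<^bsub>T\<^esub> x [^]\<^bsub>T\<^esub> n))"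


section \<open>Induced maps on quotient rings\<close>

text \<open>The map \<open>I + r \<mapsto> I + f r\<close>; it is well defined if \<open>f\<close> is additive with \<open>f ` I \<subseteq> I\<close>, see
  \<open>quot_map_coset\<close> below.\<close>

definition quot_map :: "('a, 'm) ring_scheme \<Rightarrow> 'a set \<Rightarrow> ('a \<Rightarrow> 'a) \<Rightarrow> 'a set \<Rightarrow> 'a set" where
  "quot_map R I f = (\<lambda>X. the_elem ((\<lambda>r. I +>\<^bsub>R\<^esub> f r) ` X))"

lemma quot_map_coset:
  assumes I: "ideal I R" and f: "f \<in> carrier R \<rightarrow> carrier R" "f ` I \<subseteq> I"
    and add: "\<And>r s. r \<in> carrier R \<Longrightarrow> s \<in> carrier R \<Longrightarrow> f (r \<oplus>\<^bsub>R\<^esub> s) = f r \<oplus>\<^bsub>R\<^esub> f s"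
    and r: "r \<in> carrier R"
  shows "quot_map R I f (I +>\<^bsub>R\<^esub> r) = I +>\<^bsub>R\<^esub> f r"
proof -
  interpret ideal I R by fact
  have *: "I +>\<^bsub>R\<^esub> f s = I +>\<^bsub>R\<^esub> f r" if "s \<in> I +>\<^bsub>R\<^esub> r" for s
  proof -
    obtain a where a: "a \<in> I" "s = a \<oplus>\<^bsub>R\<^esub> r"
      using \<open>s \<in> I +>\<^bsub>R\<^esub> r\<close> by (auto simp: a_r_coset_def r_coset_def)
    have fa: "f a \<in> I" and fr: "f r \<in> carrier R" using f a r by auto
    have "f s = f a \<oplus>\<^bsub>R\<^esub> f r" using a add r by (simp add: Icarr)
    hence "f s \<in> I +>\<^bsub>R\<^esub> f r" using fa by (auto simp: a_r_coset_def r_coset_def)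
    thus ?thesis by (rule a_repr_independence'[OF _ fr, symmetric])
  qed
  have "(\<lambda>r. I +>\<^bsub>R\<^esub> f r) ` (I +>\<^bsub>R\<^esub> r) = (\<lambda>_. I +>\<^bsub>R\<^esub> f r) ` (I +>\<^bsub>R\<^esub> r)"
    by (rule image_cong[OF refl *])
  also have "\<dots> = {I +>\<^bsub>R\<^esub> f r}"
    by (rule image_constant[OF a_rcos_self[OF r]])
  finally have "(\<lambda>r. I +>\<^bsub>R\<^esub> f r) ` (I +>\<^bsub>R\<^esub> r) = {I +>\<^bsub>R\<^esub> f r}" .
  thus ?thesis by (simp add: quot_map_def)
qed


section \<open>Free rings\<close>

text \<open>The free unital ring on the set \<open>G\<close>: finitely supported integer combinations of words over
  \<open>G\<close>, with the concatenation product.\<close>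

definition free_ring :: "'g set \<Rightarrow> ('g list \<Rightarrow> int) ring" where
  "free_ring G =
     \<lparr>carrier = {p. finite {w. p w \<noteq> 0} \<and> (\<forall>w. p w \<noteq> 0 \<longrightarrow> set w \<subseteq> G)},
      mult = (\<lambda>p q w. \<Sum>(u, v)\<in>{(u, v). u @ v = w}. p u * q v),
      one = (\<lambda>w. if w = [] then 1 else 0),
      zero = (\<lambda>w. 0),
      add = (\<lambda>p q w. p w + q w)\<rparr>"

definition word_elem :: "'g list \<Rightarrow> 'g list \<Rightarrow> int" where
  "word_elem u = (\<lambda>w. if w = u then 1 else 0)"


section \<open>Amalgamated products\<close>

text \<open>The pushout of ring homomorphisms \<open>\<iota>\<^sub>1 : R \<rightarrow> S\<^sub>1\<close> and \<open>\<iota>\<^sub>2 : R \<rightarrow> S\<^sub>2\<close>, presented by generators and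
  relations.  Since the universal property quantifies over rings of all types, it is not part of
  the definition; it is proved below as \<open>amalg_universal\<close>, polymorphically in the target.\<close>

definition amalg_free ::
  "('b, 'n) ring_scheme \<Rightarrow> ('c, 'k) ring_scheme \<Rightarrow> (('b + 'c) list \<Rightarrow> int) ring" where
  "amalg_free S1 S2 = free_ring (Inl ` carrier S1 \<union> Inr ` carrier S2)"

definition amalg_rels ::
  "('a, 'm) ring_scheme \<Rightarrow> ('b, 'n) ring_scheme \<Rightarrow> ('a \<Rightarrow> 'b) \<Rightarrow>
   ('c, 'k) ring_scheme \<Rightarrow> ('a \<Rightarrow> 'c) \<Rightarrow> (('b + 'c) list \<Rightarrow> int) set" where
  "amalg_rels R S1 \<iota>1 S2 \<iota>2 =
     (let F = amalg_free S1 S2;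
          l = (\<lambda>a. word_elem [Inl a]); r = (\<lambda>b. word_elem [Inr b])
      in {l (a \<oplus>\<^bsub>S1\<^esub> a') \<ominus>\<^bsub>F\<^esub> (l a \<oplus>\<^bsub>F\<^esub> l a') | a a'. a \<in> carrier S1 \<and> a' \<in> carrier S1}
       \<union> {l (a \<otimes>\<^bsub>S1\<^esub> a') \<ominus>\<^bsub>F\<^esub> (l a \<otimes>\<^bsub>F\<^esub> l a') | a a'. a \<in> carrier S1 \<and> a' \<in> carrier S1}
       \<union> {l \<one>\<^bsub>S1\<^esub> \<ominus>\<^bsub>F\<^esub> \<one>\<^bsub>F\<^esub>}
       \<union> {r (b \<oplus>\<^bsub>S2\<^esub> b') \<ominus>\<^bsub>F\<^esub> (r b \<oplus>\<^bsub>F\<^esub> r b') | b b'. b \<in> carrier S2 \<and> b' \<in> carrier S2}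
       \<union> {r (b \<otimes>\<^bsub>S2\<^esub> b') \<ominus>\<^bsub>F\<^esub> (r b \<otimes>\<^bsub>F\<^esub> r b') | b b'. b \<in> carrier S2 \<and> b' \<in> carrier S2}
       \<union> {r \<one>\<^bsub>S2\<^esub> \<ominus>\<^bsub>F\<^esub> \<one>\<^bsub>F\<^esub>}
       \<union> {l (\<iota>1 c) \<ominus>\<^bsub>F\<^esub> r (\<iota>2 c) | c. c \<in> carrier R})"

definition amalg_ideal ::
  "('a, 'm) ring_scheme \<Rightarrow> ('b, 'n) ring_scheme \<Rightarrow> ('a \<Rightarrow> 'b) \<Rightarrow>
   ('c, 'k) ring_scheme \<Rightarrow> ('a \<Rightarrow> 'c) \<Rightarrow> (('b + 'c) list \<Rightarrow> int) set" where
  "amalg_ideal R S1 \<iota>1 S2 \<iota>2 =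
     genideal (amalg_free S1 S2) (amalg_rels R S1 \<iota>1 S2 \<iota>2)"

definition amalg ::
  "('a, 'm) ring_scheme \<Rightarrow> ('b, 'n) ring_scheme \<Rightarrow> ('a \<Rightarrow> 'b) \<Rightarrow>
   ('c, 'k) ring_scheme \<Rightarrow> ('a \<Rightarrow> 'c) \<Rightarrow> (('b + 'c) list \<Rightarrow> int) set ring" where
  "amalg R S1 \<iota>1 S2 \<iota>2 =
     amalg_free S1 S2 Quot amalg_ideal R S1 \<iota>1 S2 \<iota>2"

definition amalg_inl ::
  "('a, 'm) ring_scheme \<Rightarrow> ('b, 'n) ring_scheme \<Rightarrow> ('a \<Rightarrow> 'b) \<Rightarrow>
   ('c, 'k) ring_scheme \<Rightarrow> ('a \<Rightarrow> 'c) \<Rightarrow> 'b \<Rightarrow> (('b + 'c) list \<Rightarrow> int) set" where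
  "amalg_inl R S1 \<iota>1 S2 \<iota>2 a =
     amalg_ideal R S1 \<iota>1 S2 \<iota>2 +>\<^bsub>amalg_free S1 S2\<^esub> word_elem [Inl a]"

definition amalg_inr ::
  "('a, 'm) ring_scheme \<Rightarrow> ('b, 'n) ring_scheme \<Rightarrow> ('a \<Rightarrow> 'b) \<Rightarrow>
   ('c, 'k) ring_scheme \<Rightarrow> ('a \<Rightarrow> 'c) \<Rightarrow> 'c \<Rightarrow> (('b + 'c) list \<Rightarrow> int) set" where
  "amalg_inr R S1 \<iota>1 S2 \<iota>2 b =
     amalg_ideal R S1 \<iota>1 S2 \<iota>2 +>\<^bsub>amalg_free S1 S2\<^esub> word_elem [Inr b]"

text \<open>The common composite \<open>R \<rightarrow> S\<^sub>1 \<rightarrow> S\<^sub>1 *\<^sub>R S\<^sub>2\<close>, \<open>R \<rightarrow> S\<^sub>2 \<rightarrow> S\<^sub>1 *\<^sub>R S\<^sub>2\<close>.\<close>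

definition amalg_base ::
  "('a, 'm) ring_scheme \<Rightarrow> ('b, 'n) ring_scheme \<Rightarrow> ('a \<Rightarrow> 'b) \<Rightarrow>
   ('c, 'k) ring_scheme \<Rightarrow> ('a \<Rightarrow> 'c) \<Rightarrow> 'a \<Rightarrow> (('b + 'c) list \<Rightarrow> int) set" where
  "amalg_base R S1 \<iota>1 S2 \<iota>2 c = amalg_inl R S1 \<iota>1 S2 \<iota>2 (\<iota>1 c)"

section \<open>Free rings and amalgamated products: basic facts and the universal property\<close>

lemma free_ring_simps:
  "carrier (free_ring G) = {p. finite {w. p w \<noteq> 0} \<and> (\<forall>w. p w \<noteq> 0 \<longrightarrow> set w \<subseteq> G)}"
  "mult (free_ring G) p q = (\<lambda>w. \<Sum>(u, v)\<in>{(u, v). u @ v = w}. p u * q v)"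
  "one (free_ring G) = word_elem []"
  "zero (free_ring G) = (\<lambda>w. 0)"
  "add (free_ring G) p q = (\<lambda>w. p w + q w)"
  by (simp_all add: free_ring_def word_elem_def)

lemma finite_splits: "finite {(u, v). u @ v = w}"
proof -
  have "{(u, v). u @ v = w} \<subseteq> (\<lambda>k. (take k w, drop k w)) ` {..length w}"
  proof
    fix x assume "x \<in> {(u, v). u @ v = w}"
    then obtain u v where "x = (u, v)" "u @ v = w" by auto
    hence "x = (take (length u) w, drop (length u) w)" "length u \<le> length w" by auto
    thus "x \<in> (\<lambda>k. (take k w, drop k w)) ` {..length w}" by blast
  qed
  thus ?thesis by (rule finite_subset) simp
qed

lemma free_ring_add_closed:
  "p \<in> carrier (free_ring G) \<Longrightarrow> q \<in> carrier (free_ring G) \<Longrightarrow>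
   (\<lambda>w. p w + q w) \<in> carrier (free_ring G)"
proof -
  assume pq: "p \<in> carrier (free_ring G)" "q \<in> carrier (free_ring G)"
  have "{w. p w + q w \<noteq> 0} \<subseteq> {w. p w \<noteq> 0} \<union> {w. q w \<noteq> 0}" by auto
  moreover have "finite ({w. p w \<noteq> 0} \<union> {w. q w \<noteq> 0})" using pq by (simp add: free_ring_simps)
  ultimately have "finite {w. p w + q w \<noteq> 0}" by (rule finite_subset)
  moreover have "set w \<subseteq> G" if "p w + q w \<noteq> 0" for w
  proof -
    have "p w \<noteq> 0 \<or> q w \<noteq> 0" using that by auto
    thus ?thesis using pq by (auto simp: free_ring_simps)
  qed
  ultimately show ?thesis by (simp add: free_ring_simps)
qed

lemma free_ring_mult_closed:
  assumes pq: "p \<in> carrier (free_ring G)" "q \<in> carrier (free_ring G)"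
  shows "mult (free_ring G) p q \<in> carrier (free_ring G)"
proof -
  let ?r = "mult (free_ring G) p q"
  have *: "\<exists>u v. w = u @ v \<and> p u \<noteq> 0 \<and> q v \<noteq> 0" if "?r w \<noteq> 0" for w
  proof -
    have "\<exists>x\<in>{(u, v). u @ v = w}. (case x of (u, v) \<Rightarrow> p u * q v) \<noteq> 0"
      using that unfolding free_ring_simps by (meson sum.neutral)
    thus ?thesis by auto
  qed
  have "{w. ?r w \<noteq> 0} \<subseteq> (\<lambda>(u, v). u @ v) ` ({w. p w \<noteq> 0} \<times> {w. q w \<noteq> 0})"
    using * by fastforce
  moreover have "finite ((\<lambda>(u, v). u @ v) ` ({w. p w \<noteq> 0} \<times> {w. q w \<noteq> 0}))"
    using pq by (simp add: free_ring_simps)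
  ultimately have "finite {w. ?r w \<noteq> 0}" by (rule finite_subset)
  moreover have "set w \<subseteq> G" if r: "?r w \<noteq> 0" for w
  proof -
    obtain u v where "w = u @ v" "p u \<noteq> 0" "q v \<noteq> 0" using *[OF r] by blast
    thus ?thesis using pq by (auto simp: free_ring_simps)
  qed
  ultimately show ?thesis unfolding free_ring_simps(1) by blast
qed

lemma word_elem_carrier: "set u \<subseteq> G \<Longrightarrow> word_elem u \<in> carrier (free_ring G)"
  by (auto simp: free_ring_simps word_elem_def)

lemma conv_single:
  fixes c d :: int
  shows "mult (free_ring G) (\<lambda>w. if w = u then c else 0) (\<lambda>w. if w = v then d else 0)
       = (\<lambda>w. if w = u @ v then c * d else 0)"
proof
  fix w
  have "(\<Sum>(u', v')\<in>{(u', v'). u' @ v' = w}. (if u' = u then c else 0) * (if v' = v then d else 0))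
      = (\<Sum>x\<in>{(u', v'). u' @ v' = w}. if x = (u, v) then c * d else 0)"
    by (rule sum.cong) (auto split: if_splits)
  also have "\<dots> = (if w = u @ v then c * d else 0)"
    by (subst sum.delta[OF finite_splits]) auto
  finally show "mult (free_ring G) (\<lambda>w. if w = u then c else 0) (\<lambda>w. if w = v then d else 0) w
       = (if w = u @ v then c * d else 0)" by (simp add: free_ring_simps)
qed

lemma conv_one: "mult (free_ring G) (word_elem []) p = p" "mult (free_ring G) p (word_elem []) = p"
proof -
  have "(\<Sum>(u, v)\<in>{(u, v). u @ v = w}. word_elem [] u * p v)
      = (\<Sum>x\<in>{(u, v). u @ v = w}. if x = ([], w) then p w else 0)" for w
    by (rule sum.cong) (auto simp: word_elem_def split: if_splits)
  thus "mult (free_ring G) (word_elem []) p = p"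
    by (simp add: free_ring_simps sum.delta[OF finite_splits])
  have "(\<Sum>(u, v)\<in>{(u, v). u @ v = w}. p u * word_elem [] v)
      = (\<Sum>x\<in>{(u, v). u @ v = w}. if x = (w, []) then p w else 0)" for w
    by (rule sum.cong) (auto simp: word_elem_def split: if_splits)
  thus "mult (free_ring G) p (word_elem []) = p"
    by (simp add: free_ring_simps sum.delta[OF finite_splits])
qed

lemma conv_assoc:
  "mult (free_ring G) (mult (free_ring G) p q) r = mult (free_ring G) p (mult (free_ring G) q r)"
proof
  fix w
  have "mult (free_ring G) (mult (free_ring G) p q) r w =
     (\<Sum>x\<in>{(t, c). t @ c = w}. \<Sum>y\<in>{(a, b). a @ b = fst x}. p (fst y) * q (snd y) * r (snd x))"
    by (simp add: free_ring_simps case_prod_beta sum_distrib_right)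
  also have "\<dots> = (\<Sum>z\<in>Sigma {(t, c). t @ c = w} (\<lambda>x. {(a, b). a @ b = fst x}).
       p (fst (snd z)) * q (snd (snd z)) * r (snd (fst z)))"
    by (subst sum.Sigma) (auto simp: finite_splits case_prod_beta)
  also have "\<dots> = (\<Sum>z\<in>Sigma {(a, t). a @ t = w} (\<lambda>x. {(b, c). b @ c = snd x}).
       p (fst (fst z)) * (q (fst (snd z)) * r (snd (snd z))))"
    by (rule sum.reindex_bij_witness
        [where i = "\<lambda>((a, t), (b, c)). ((a @ b, c), (a, b))"
           and j = "\<lambda>((t, c), (a, b)). ((a, b @ c), (b, c))"]) (auto simp: mult.assoc)
  also have "\<dots> = (\<Sum>x\<in>{(a, t). a @ t = w}. \<Sum>y\<in>{(b, c). b @ c = snd x}.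
       p (fst x) * (q (fst y) * r (snd y)))"
    by (subst sum.Sigma) (auto simp: finite_splits case_prod_beta)
  also have "\<dots> = mult (free_ring G) p (mult (free_ring G) q r) w"
    by (simp add: free_ring_simps case_prod_beta sum_distrib_left)
  finally show "mult (free_ring G) (mult (free_ring G) p q) r w =
    mult (free_ring G) p (mult (free_ring G) q r) w" .
qed

lemma free_ring_is_ring: "ring (free_ring G)"
proof (rule ringI)
  show "abelian_group (free_ring G)"
  proof (rule abelian_groupI)
    fix p assume p: "p \<in> carrier (free_ring G)"
    show "\<exists>q\<in>carrier (free_ring G). q \<oplus>\<^bsub>free_ring G\<^esub> p = \<zero>\<^bsub>free_ring G\<^esub>"
      using p by (intro bexI[where x = "\<lambda>w. - p w"]) (auto simp: free_ring_simps)
  next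
    fix p q assume "p \<in> carrier (free_ring G)" "q \<in> carrier (free_ring G)"
    thus "p \<oplus>\<^bsub>free_ring G\<^esub> q \<in> carrier (free_ring G)"
      unfolding free_ring_simps(5) by (rule free_ring_add_closed)
  qed (auto simp: free_ring_simps)
  show "Group.monoid (free_ring G)"
  proof (rule monoidI)
    show "\<one>\<^bsub>free_ring G\<^esub> \<in> carrier (free_ring G)"
      unfolding free_ring_simps(3) by (rule word_elem_carrier) simp
  qed (simp_all add: free_ring_mult_closed conv_assoc conv_one free_ring_simps(3))
qed (auto simp: free_ring_simps fun_eq_iff case_prod_beta algebra_simps sum.distrib)

lemma free_ring_induct [consumes 1, case_names zero add]:
  assumes "p \<in> carrier (free_ring G)"
    and "P (\<lambda>w. 0)"
    and step: "\<And>p u c. p \<in> carrier (free_ring G) \<Longrightarrow> P p \<Longrightarrow> set u \<subseteq> G \<Longrightarrow>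
       P ((\<lambda>w. if w = u then c else 0) \<oplus>\<^bsub>free_ring G\<^esub> p)"
  shows "P p"
proof -
  have "\<forall>p. p \<in> carrier (free_ring G) \<longrightarrow> {w. p w \<noteq> 0} \<subseteq> A \<longrightarrow> P p" if "finite A" for A
    using that
  proof (induction A)
    case empty
    show ?case
    proof (intro allI impI)
      fix p :: "'a list \<Rightarrow> int" assume "{w. p w \<noteq> 0} \<subseteq> {}"
      hence "p = (\<lambda>w. 0)" by auto
      thus "P p" using assms(2) by simp
    qed
  next
    case (insert u A)
    show ?case
    proof (intro allI impI)
      fix p assume p: "p \<in> carrier (free_ring G)" and s: "{w. p w \<noteq> 0} \<subseteq> insert u A"
      show "P p"
      proof (cases "p u = 0")
        case True
        hence "{w. p w \<noteq> 0} \<subseteq> A" using s by auto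
        thus ?thesis using insert.IH p by blast
      next
        case False
        define q where "q = (\<lambda>w. if w = u then 0 else p w)"
        have "{w. q w \<noteq> 0} \<subseteq> {w. p w \<noteq> 0}" by (auto simp: q_def)
        hence "finite {w. q w \<noteq> 0}" using p finite_subset by (auto simp: free_ring_simps)
        hence q: "q \<in> carrier (free_ring G)" using p by (auto simp: free_ring_simps q_def)
        moreover have "{w. q w \<noteq> 0} \<subseteq> A" using s by (auto simp: q_def)
        ultimately have "P q" using insert.IH by blast
        moreover have "set u \<subseteq> G" using p False by (auto simp: free_ring_simps)
        ultimately have "P ((\<lambda>w. if w = u then p u else 0) \<oplus>\<^bsub>free_ring G\<^esub> q)" using step q by blast
        moreover have "(\<lambda>w. if w = u then p u else 0) \<oplus>\<^bsub>free_ring G\<^esub> q = p"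
          by (auto simp: free_ring_simps q_def)
        ultimately show ?thesis by simp
      qed
    qed
  qed
  thus ?thesis using assms(1) by (auto simp: free_ring_simps)
qed

lemma single_carrier: "set u \<subseteq> G \<Longrightarrow> (\<lambda>w. if w = u then c else 0) \<in> carrier (free_ring G)"
  by (auto simp: free_ring_simps)

text \<open>Evaluation of the free ring at a family \<open>f\<close> of elements of \<open>T\<close>.\<close>

definition free_eval :: "('t, 'm) ring_scheme \<Rightarrow> ('g \<Rightarrow> 't) \<Rightarrow> ('g list \<Rightarrow> int) \<Rightarrow> 't" where
  "free_eval T f p = (\<Oplus>\<^bsub>T\<^esub>w\<in>{w. p w \<noteq> 0}. [p w] \<cdot>\<^bsub>T\<^esub> foldr (\<lambda>g t. f g \<otimes>\<^bsub>T\<^esub> t) w \<one>\<^bsub>T\<^esub>)"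

context
  fixes T :: "('t, 'm) ring_scheme" (structure) and f :: "'g \<Rightarrow> 't" and G :: "'g set"
  assumes T: "ring T" and f: "f \<in> G \<rightarrow> carrier T"
begin

interpretation ring T by (rule T)

private abbreviation (input) wrd :: "'g list \<Rightarrow> 't" where "wrd w \<equiv> foldr (\<lambda>g t. f g \<otimes> t) w \<one>"

lemma wrd_closed: "set w \<subseteq> G \<Longrightarrow> wrd w \<in> carrier T"
  using f by (induction w) auto

lemma wrd_append: "set u \<subseteq> G \<Longrightarrow> set v \<subseteq> G \<Longrightarrow> wrd (u @ v) = wrd u \<otimes> wrd v"
proof (induction u)
  case Nil thus ?case using wrd_closed[of v] by simp
next
  case (Cons a u)
  have "f a \<in> carrier T" using f Cons.prems by auto
  thus ?case using Cons wrd_closed[of v] wrd_closed[of u] by (simp add: m_assoc)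
qed

lemma free_eval_superset:
  assumes "finite A" "{w. p w \<noteq> 0} \<subseteq> A" "\<And>w. w \<in> A \<Longrightarrow> set w \<subseteq> G"
  shows "free_eval T f p = (\<Oplus>w\<in>A. add_pow T (p w) (wrd w))"
  unfolding free_eval_def
  using assms wrd_closed
  by (intro add.finprod_mono_neutral_cong_left) (auto simp: add_pow_int_ge)

lemma free_eval_closed: "p \<in> carrier (free_ring G) \<Longrightarrow> free_eval T f p \<in> carrier T"
  unfolding free_eval_def using wrd_closed by (intro finsum_closed) (auto simp: free_ring_simps)

lemma free_eval_add:
  assumes "p \<in> carrier (free_ring G)" "q \<in> carrier (free_ring G)"
  shows "free_eval T f (p \<oplus>\<^bsub>free_ring G\<^esub> q) = free_eval T f p \<oplus> free_eval T f q"
proof -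
  let ?A = "{w. p w \<noteq> 0} \<union> {w. q w \<noteq> 0}"
  have A: "finite ?A" "\<And>w. w \<in> ?A \<Longrightarrow> set w \<subseteq> G" using assms by (auto simp: free_ring_simps)
  have "free_eval T f (p \<oplus>\<^bsub>free_ring G\<^esub> q) = (\<Oplus>w\<in>?A. add_pow T (p w + q w) (wrd w))"
    by (subst free_eval_superset[OF A(1) _ A(2)]) (auto simp: free_ring_simps)
  also have "\<dots> = (\<Oplus>w\<in>?A. add_pow T (p w) (wrd w) \<oplus> add_pow T (q w) (wrd w))"
    using A wrd_closed by (intro finsum_cong') (auto simp: add.int_pow_mult)
  also have "\<dots> = (\<Oplus>w\<in>?A. add_pow T (p w) (wrd w)) \<oplus> (\<Oplus>w\<in>?A. add_pow T (q w) (wrd w))"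
    using A wrd_closed by (intro finsum_addf) auto
  also have "\<dots> = free_eval T f p \<oplus> free_eval T f q"
    by (subst (1 2) free_eval_superset[OF A(1) _ A(2)]) auto
  finally show ?thesis .
qed

lemma free_eval_single:
  assumes "set u \<subseteq> G"
  shows "free_eval T f (\<lambda>w. if w = u then c else 0) = add_pow T (c) (wrd u)"
proof -
  have "{w. (if w = u then c else 0) \<noteq> 0} \<subseteq> {u}" by auto
  thus ?thesis
    using free_eval_superset[of "{u}" "\<lambda>w. if w = u then c else 0"] assms wrd_closed[OF assms] by simp
qed

lemma free_eval_zero: "free_eval T f (\<lambda>w. 0) = \<zero>"
  by (simp add: free_eval_def)

lemma free_eval_mult_single:
  assumes "q \<in> carrier (free_ring G)" "set u \<subseteq> G"
  shows "free_eval T f ((\<lambda>w. if w = u then c else 0) \<otimes>\<^bsub>free_ring G\<^esub> q)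
       = (add_pow T (c) (wrd u)) \<otimes> free_eval T f q"
  using assms(1)
proof (induction rule: free_ring_induct)
  case zero
  have "(\<lambda>w. if w = u then c else 0) \<otimes>\<^bsub>free_ring G\<^esub> (\<lambda>w. 0) = (\<lambda>w. 0)"
    by (simp add: free_ring_simps)
  thus ?case using wrd_closed[OF assms(2)] by (simp add: free_eval_zero)
next
  case (add q v d)
  interpret F: ring "free_ring G" by (rule free_ring_is_ring)
  have "set (u @ v) \<subseteq> G" using assms add by simp
  note cl = wrd_closed[OF assms(2)] wrd_closed[OF add.hyps(2)]
  have "free_eval T f ((\<lambda>w. if w = u then c else 0) \<otimes>\<^bsub>free_ring G\<^esub>
      ((\<lambda>w. if w = v then d else 0) \<oplus>\<^bsub>free_ring G\<^esub> q)) =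
    free_eval T f (((\<lambda>w. if w = u then c else 0) \<otimes>\<^bsub>free_ring G\<^esub> (\<lambda>w. if w = v then d else 0))
      \<oplus>\<^bsub>free_ring G\<^esub> ((\<lambda>w. if w = u then c else 0) \<otimes>\<^bsub>free_ring G\<^esub> q))"
    by (subst F.r_distr) (use add assms single_carrier[of _ G] in auto)
  also have "\<dots> = free_eval T f (\<lambda>w. if w = u @ v then c * d else 0)
      \<oplus> (add_pow T (c) (wrd u)) \<otimes> free_eval T f q"
    unfolding conv_single using \<open>set (u @ v) \<subseteq> G\<close>
    by (subst free_eval_add) (use add assms single_carrier[of _ G] in auto)
  also have "free_eval T f (\<lambda>w. if w = u @ v then c * d else 0) = add_pow T (c * d) (wrd u \<otimes> wrd v)"
    using free_eval_single[OF \<open>set (u @ v) \<subseteq> G\<close>] wrd_append[OF assms(2) add.hyps(2)] by simp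
  also have "\<dots> = (add_pow T (c) (wrd u)) \<otimes> (add_pow T (d) (wrd v))"
    using cl by (simp add: add_pow_ldistr_int add_pow_rdistr_int add.int_pow_pow mult.commute)
  finally show ?case
    using cl add free_eval_closed
    by (subst free_eval_add) (auto simp: single_carrier free_eval_single r_distr)
qed

lemma free_eval_mult:
  assumes "p \<in> carrier (free_ring G)" "q \<in> carrier (free_ring G)"
  shows "free_eval T f (p \<otimes>\<^bsub>free_ring G\<^esub> q) = free_eval T f p \<otimes> free_eval T f q"
  using assms(1)
proof (induction rule: free_ring_induct)
  case zero
  have "(\<lambda>w. 0) \<otimes>\<^bsub>free_ring G\<^esub> q = (\<lambda>w. 0)" by (simp add: free_ring_simps)
  thus ?case using free_eval_closed[OF assms(2)] by (simp add: free_eval_zero)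
next
  case (add p u c)
  interpret F: ring "free_ring G" by (rule free_ring_is_ring)
  note s = single_carrier[OF add.hyps(2), of c]
  have "free_eval T f (((\<lambda>w. if w = u then c else 0) \<oplus>\<^bsub>free_ring G\<^esub> p) \<otimes>\<^bsub>free_ring G\<^esub> q)
      = free_eval T f ((\<lambda>w. if w = u then c else 0) \<otimes>\<^bsub>free_ring G\<^esub> q)
        \<oplus> free_eval T f (p \<otimes>\<^bsub>free_ring G\<^esub> q)"
    using s add assms by (simp add: F.l_distr free_eval_add)
  also have "\<dots> = (add_pow T (c) (wrd u)) \<otimes> free_eval T f q \<oplus> free_eval T f p \<otimes> free_eval T f q"
    using add assms by (simp add: free_eval_mult_single)
  also have "\<dots> = free_eval T f ((\<lambda>w. if w = u then c else 0) \<oplus>\<^bsub>free_ring G\<^esub> p) \<otimes> free_eval T f q"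
    using s add assms free_eval_closed wrd_closed[OF add.hyps(2)]
    by (simp add: free_eval_add free_eval_single l_distr)
  finally show ?case .
qed

lemma free_eval_word: "set u \<subseteq> G \<Longrightarrow> free_eval T f (word_elem u) = wrd u"
  unfolding word_elem_def using free_eval_single[of u 1] wrd_closed[of u] by simp

lemma free_eval_hom: "free_eval T f \<in> ring_hom (free_ring G) T"
  using free_eval_word[of "[]"]
  by (intro ring_hom_memI) (auto simp: free_eval_closed free_eval_mult free_eval_add free_ring_simps(3))

end

lemma free_ring_hom_eqI:
  assumes T: "ring T" and h: "h \<in> ring_hom (free_ring G) T" and k: "k \<in> ring_hom (free_ring G) T"
    and eq: "\<And>g. g \<in> G \<Longrightarrow> h (word_elem [g]) = k (word_elem [g])"
    and p: "p \<in> carrier (free_ring G)"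
  shows "h p = k p"
proof -
  interpret T: ring T by (rule T)
  interpret F: ring "free_ring G" by (rule free_ring_is_ring)
  interpret h: ring_hom_ring "free_ring G" T h
    using F.ring_axioms T h by (rule ring_hom_ringI2)
  interpret k: ring_hom_ring "free_ring G" T k
    using F.ring_axioms T k by (rule ring_hom_ringI2)
  have w: "h (word_elem u) = k (word_elem u)" if "set u \<subseteq> G" for u
    using that
  proof (induction u)
    case Nil
    show ?case using h.hom_one k.hom_one by (simp add: free_ring_simps(3))
  next
    case (Cons g u)
    have "word_elem (g # u) = word_elem [g] \<otimes>\<^bsub>free_ring G\<^esub> word_elem u"
      using conv_single[of G "[g]" 1 u 1] unfolding word_elem_def mult_1 by simp
    moreover have "word_elem [g] \<in> carrier (free_ring G)" "word_elem u \<in> carrier (free_ring G)"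
      using Cons.prems by (auto intro!: word_elem_carrier)
    ultimately show ?case using Cons eq by simp
  qed
  have nat: "h (\<lambda>w. if w = u then int n else 0) = k (\<lambda>w. if w = u then int n else 0)"
    if u: "set u \<subseteq> G" for u n
  proof (induction n)
    case 0
    have "(\<lambda>w. if w = u then int 0 else 0) = \<zero>\<^bsub>free_ring G\<^esub>" by (auto simp: free_ring_simps)
    thus ?case using h.hom_zero k.hom_zero by simp
  next
    case (Suc n)
    have "(\<lambda>w. if w = u then int (Suc n) else 0)
        = word_elem u \<oplus>\<^bsub>free_ring G\<^esub> (\<lambda>w. if w = u then int n else 0)"
      by (auto simp: free_ring_simps word_elem_def)
    thus ?case using Suc w[OF u] word_elem_carrier[OF u] single_carrier[OF u] by simp
  qed
  have neg: "\<ominus>\<^bsub>free_ring G\<^esub> (\<lambda>w. if w = u then c else 0) = (\<lambda>w. if w = u then - c else 0)"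
    if u: "set u \<subseteq> G" for u c
    by (rule F.minus_equality)
      (simp_all add: single_carrier[OF u], simp add: free_ring_simps fun_eq_iff)
  have s: "h (\<lambda>w. if w = u then c else 0) = k (\<lambda>w. if w = u then c else 0)"
    if u: "set u \<subseteq> G" for u c
  proof (cases "c \<ge> 0")
    case True
    hence "int (nat c) = c" by simp
    thus ?thesis using nat[OF u, of "nat c"] by (simp only:)
  next
    case False
    hence "(\<lambda>w. if w = u then c else 0) = \<ominus>\<^bsub>free_ring G\<^esub> (\<lambda>w. if w = u then int (nat (- c)) else 0)"
      by (auto simp: neg[OF u])
    thus ?thesis using nat[OF u, of "nat (- c)"] single_carrier[OF u] by simp
  qed
  show ?thesis using p
  proof (induction rule: free_ring_induct)
    case zero
    show ?case using h.hom_zero k.hom_zero by (simp add: free_ring_simps(4))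
  next
    case (add p u c)
    thus ?case using s[OF add.hyps(2)] single_carrier[OF add.hyps(2)] by simp
  qed
qed


lemma amalg_free_ring: "ring (amalg_free S1 S2)"
  by (simp add: amalg_free_def free_ring_is_ring)

lemma amalg_word_carrier:
  "a \<in> carrier S1 \<Longrightarrow> word_elem [Inl a] \<in> carrier (amalg_free S1 S2)"
  "b \<in> carrier S2 \<Longrightarrow> word_elem [Inr b] \<in> carrier (amalg_free S1 S2)"
  unfolding amalg_free_def by (auto intro!: word_elem_carrier)

context
  fixes R :: "('a, 'm) ring_scheme" and S1 :: "('b, 'n) ring_scheme" and S2 :: "('c, 'k) ring_scheme"
    and \<iota>1 :: "'a \<Rightarrow> 'b" and \<iota>2 :: "'a \<Rightarrow> 'c"
  assumes R: "ring R" and S1: "ring S1" and S2: "ring S2"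
    and \<iota>1: "\<iota>1 \<in> ring_hom R S1" and \<iota>2: "\<iota>2 \<in> ring_hom R S2"
begin

interpretation R: ring R by (rule R)
interpretation S1: ring S1 by (rule S1)
interpretation S2: ring S2 by (rule S2)
interpretation F: ring "amalg_free S1 S2" by (rule amalg_free_ring)

private abbreviation (input) "AI \<equiv> amalg_ideal R S1 \<iota>1 S2 \<iota>2"

lemma amalg_rels_carrier: "amalg_rels R S1 \<iota>1 S2 \<iota>2 \<subseteq> carrier (amalg_free S1 S2)"
  unfolding amalg_rels_def Let_def
  using ring_hom_closed[OF \<iota>1] ring_hom_closed[OF \<iota>2]
  by (auto intro!: F.minus_closed F.add.m_closed F.m_closed amalg_word_carrier)

lemma amalg_ideal_ideal: "ideal AI (amalg_free S1 S2)"
  unfolding amalg_ideal_def by (rule F.genideal_ideal[OF amalg_rels_carrier])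

interpretation AI: ideal AI "amalg_free S1 S2" by (rule amalg_ideal_ideal)

lemma amalg_is_ring: "ring (amalg R S1 \<iota>1 S2 \<iota>2)"
  unfolding amalg_def by (rule AI.quotient_is_ring)

lemma amalg_rel_coset:
  assumes "p \<ominus>\<^bsub>amalg_free S1 S2\<^esub> q \<in> amalg_rels R S1 \<iota>1 S2 \<iota>2"
    and pq: "p \<in> carrier (amalg_free S1 S2)" "q \<in> carrier (amalg_free S1 S2)"
  shows "AI +>\<^bsub>amalg_free S1 S2\<^esub> p = AI +>\<^bsub>amalg_free S1 S2\<^esub> q"
proof -
  have "p \<ominus>\<^bsub>amalg_free S1 S2\<^esub> q \<in> AI"
    using assms(1) F.genideal_self[OF amalg_rels_carrier] unfolding amalg_ideal_def by blast
  thus ?thesis using pq F.quotient_eq_iff_same_a_r_cos[OF amalg_ideal_ideal] by blast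
qed

lemma amalg_relsI:
  "\<And>a a'. a \<in> carrier S1 \<Longrightarrow> a' \<in> carrier S1 \<Longrightarrow>
    word_elem [Inl (a \<oplus>\<^bsub>S1\<^esub> a')] \<ominus>\<^bsub>amalg_free S1 S2\<^esub>
      (word_elem [Inl a] \<oplus>\<^bsub>amalg_free S1 S2\<^esub> word_elem [Inl a']) \<in> amalg_rels R S1 \<iota>1 S2 \<iota>2"
  "\<And>a a'. a \<in> carrier S1 \<Longrightarrow> a' \<in> carrier S1 \<Longrightarrow>
    word_elem [Inl (a \<otimes>\<^bsub>S1\<^esub> a')] \<ominus>\<^bsub>amalg_free S1 S2\<^esub>
      (word_elem [Inl a] \<otimes>\<^bsub>amalg_free S1 S2\<^esub> word_elem [Inl a']) \<in> amalg_rels R S1 \<iota>1 S2 \<iota>2"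
  "word_elem [Inl \<one>\<^bsub>S1\<^esub>] \<ominus>\<^bsub>amalg_free S1 S2\<^esub> \<one>\<^bsub>amalg_free S1 S2\<^esub> \<in> amalg_rels R S1 \<iota>1 S2 \<iota>2"
  "\<And>b b'. b \<in> carrier S2 \<Longrightarrow> b' \<in> carrier S2 \<Longrightarrow>
    word_elem [Inr (b \<oplus>\<^bsub>S2\<^esub> b')] \<ominus>\<^bsub>amalg_free S1 S2\<^esub>
      (word_elem [Inr b] \<oplus>\<^bsub>amalg_free S1 S2\<^esub> word_elem [Inr b']) \<in> amalg_rels R S1 \<iota>1 S2 \<iota>2"
  "\<And>b b'. b \<in> carrier S2 \<Longrightarrow> b' \<in> carrier S2 \<Longrightarrow>
    word_elem [Inr (b \<otimes>\<^bsub>S2\<^esub> b')] \<ominus>\<^bsub>amalg_free S1 S2\<^esub>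
      (word_elem [Inr b] \<otimes>\<^bsub>amalg_free S1 S2\<^esub> word_elem [Inr b']) \<in> amalg_rels R S1 \<iota>1 S2 \<iota>2"
  "word_elem [Inr \<one>\<^bsub>S2\<^esub>] \<ominus>\<^bsub>amalg_free S1 S2\<^esub> \<one>\<^bsub>amalg_free S1 S2\<^esub> \<in> amalg_rels R S1 \<iota>1 S2 \<iota>2"
  "\<And>c. c \<in> carrier R \<Longrightarrow>
    word_elem [Inl (\<iota>1 c)] \<ominus>\<^bsub>amalg_free S1 S2\<^esub> word_elem [Inr (\<iota>2 c)] \<in> amalg_rels R S1 \<iota>1 S2 \<iota>2"
  unfolding amalg_rels_def Let_def by blast+

lemma amalg_inl_hom: "amalg_inl R S1 \<iota>1 S2 \<iota>2 \<in> ring_hom S1 (amalg R S1 \<iota>1 S2 \<iota>2)"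
proof (rule ring_hom_memI)
  let ?c = "\<lambda>p. AI +>\<^bsub>amalg_free S1 S2\<^esub> p"
  note h = AI.rcos_ring_hom[folded amalg_def]
  note c = amalg_word_carrier(1)[where ?S1.0 = S1 and ?S2.0 = S2]
  show "amalg_inl R S1 \<iota>1 S2 \<iota>2 a \<in> carrier (amalg R S1 \<iota>1 S2 \<iota>2)" if "a \<in> carrier S1" for a
    unfolding amalg_inl_def by (rule ring_hom_closed[OF h c[OF that]])
  fix a b assume ab: "a \<in> carrier S1" "b \<in> carrier S1"
  have "?c (word_elem [Inl (a \<otimes>\<^bsub>S1\<^esub> b)])
      = ?c (word_elem [Inl a] \<otimes>\<^bsub>amalg_free S1 S2\<^esub> word_elem [Inl b])"
    by (rule amalg_rel_coset) (use ab in \<open>simp_all add: amalg_relsI c\<close>)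
  thus "amalg_inl R S1 \<iota>1 S2 \<iota>2 (a \<otimes>\<^bsub>S1\<^esub> b) =
      amalg_inl R S1 \<iota>1 S2 \<iota>2 a \<otimes>\<^bsub>amalg R S1 \<iota>1 S2 \<iota>2\<^esub> amalg_inl R S1 \<iota>1 S2 \<iota>2 b"
    unfolding amalg_inl_def by (simp add: ring_hom_mult[OF h c[OF ab(1)] c[OF ab(2)]])
  have "?c (word_elem [Inl (a \<oplus>\<^bsub>S1\<^esub> b)])
      = ?c (word_elem [Inl a] \<oplus>\<^bsub>amalg_free S1 S2\<^esub> word_elem [Inl b])"
    by (rule amalg_rel_coset) (use ab in \<open>simp_all add: amalg_relsI c\<close>)
  thus "amalg_inl R S1 \<iota>1 S2 \<iota>2 (a \<oplus>\<^bsub>S1\<^esub> b) =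
      amalg_inl R S1 \<iota>1 S2 \<iota>2 a \<oplus>\<^bsub>amalg R S1 \<iota>1 S2 \<iota>2\<^esub> amalg_inl R S1 \<iota>1 S2 \<iota>2 b"
    unfolding amalg_inl_def by (simp add: ring_hom_add[OF h c[OF ab(1)] c[OF ab(2)]])
next
  note h = AI.rcos_ring_hom[folded amalg_def]
  have "AI +>\<^bsub>amalg_free S1 S2\<^esub> word_elem [Inl \<one>\<^bsub>S1\<^esub>]
      = AI +>\<^bsub>amalg_free S1 S2\<^esub> \<one>\<^bsub>amalg_free S1 S2\<^esub>"
    by (rule amalg_rel_coset) (simp_all add: amalg_relsI amalg_word_carrier)
  thus "amalg_inl R S1 \<iota>1 S2 \<iota>2 \<one>\<^bsub>S1\<^esub> = \<one>\<^bsub>amalg R S1 \<iota>1 S2 \<iota>2\<^esub>"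
    unfolding amalg_inl_def by (simp add: ring_hom_one[OF h])
qed

lemma amalg_inr_hom: "amalg_inr R S1 \<iota>1 S2 \<iota>2 \<in> ring_hom S2 (amalg R S1 \<iota>1 S2 \<iota>2)"
proof (rule ring_hom_memI)
  let ?c = "\<lambda>p. AI +>\<^bsub>amalg_free S1 S2\<^esub> p"
  note h = AI.rcos_ring_hom[folded amalg_def]
  note c = amalg_word_carrier(2)[where ?S1.0 = S1 and ?S2.0 = S2]
  show "amalg_inr R S1 \<iota>1 S2 \<iota>2 a \<in> carrier (amalg R S1 \<iota>1 S2 \<iota>2)" if "a \<in> carrier S2" for a
    unfolding amalg_inr_def by (rule ring_hom_closed[OF h c[OF that]])
  fix a b assume ab: "a \<in> carrier S2" "b \<in> carrier S2"
  have "?c (word_elem [Inr (a \<otimes>\<^bsub>S2\<^esub> b)])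
      = ?c (word_elem [Inr a] \<otimes>\<^bsub>amalg_free S1 S2\<^esub> word_elem [Inr b])"
    by (rule amalg_rel_coset) (use ab in \<open>simp_all add: amalg_relsI c\<close>)
  thus "amalg_inr R S1 \<iota>1 S2 \<iota>2 (a \<otimes>\<^bsub>S2\<^esub> b) =
      amalg_inr R S1 \<iota>1 S2 \<iota>2 a \<otimes>\<^bsub>amalg R S1 \<iota>1 S2 \<iota>2\<^esub> amalg_inr R S1 \<iota>1 S2 \<iota>2 b"
    unfolding amalg_inr_def by (simp add: ring_hom_mult[OF h c[OF ab(1)] c[OF ab(2)]])
  have "?c (word_elem [Inr (a \<oplus>\<^bsub>S2\<^esub> b)])
      = ?c (word_elem [Inr a] \<oplus>\<^bsub>amalg_free S1 S2\<^esub> word_elem [Inr b])"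
    by (rule amalg_rel_coset) (use ab in \<open>simp_all add: amalg_relsI c\<close>)
  thus "amalg_inr R S1 \<iota>1 S2 \<iota>2 (a \<oplus>\<^bsub>S2\<^esub> b) =
      amalg_inr R S1 \<iota>1 S2 \<iota>2 a \<oplus>\<^bsub>amalg R S1 \<iota>1 S2 \<iota>2\<^esub> amalg_inr R S1 \<iota>1 S2 \<iota>2 b"
    unfolding amalg_inr_def by (simp add: ring_hom_add[OF h c[OF ab(1)] c[OF ab(2)]])
next
  note h = AI.rcos_ring_hom[folded amalg_def]
  have "AI +>\<^bsub>amalg_free S1 S2\<^esub> word_elem [Inr \<one>\<^bsub>S2\<^esub>]
      = AI +>\<^bsub>amalg_free S1 S2\<^esub> \<one>\<^bsub>amalg_free S1 S2\<^esub>"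
    by (rule amalg_rel_coset) (simp_all add: amalg_relsI amalg_word_carrier)
  thus "amalg_inr R S1 \<iota>1 S2 \<iota>2 \<one>\<^bsub>S2\<^esub> = \<one>\<^bsub>amalg R S1 \<iota>1 S2 \<iota>2\<^esub>"
    unfolding amalg_inr_def by (simp add: ring_hom_one[OF h])
qed

lemma amalg_inl_inr:
  assumes "c \<in> carrier R"
  shows "amalg_inl R S1 \<iota>1 S2 \<iota>2 (\<iota>1 c) = amalg_inr R S1 \<iota>1 S2 \<iota>2 (\<iota>2 c)"
  unfolding amalg_inl_def amalg_inr_def
  using assms ring_hom_closed[OF \<iota>1 assms] ring_hom_closed[OF \<iota>2 assms]
  by (intro amalg_rel_coset) (simp_all add: amalg_relsI amalg_word_carrier)

theorem amalg_universal:
  fixes T :: "('t, 'q) ring_scheme"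
  assumes T: "ring T" and f1: "f1 \<in> ring_hom S1 T" and f2: "f2 \<in> ring_hom S2 T"
    and f12: "\<And>c. c \<in> carrier R \<Longrightarrow> f1 (\<iota>1 c) = f2 (\<iota>2 c)"
  shows "\<exists>h\<in>ring_hom (amalg R S1 \<iota>1 S2 \<iota>2) T.
    ((\<forall>a\<in>carrier S1. h (amalg_inl R S1 \<iota>1 S2 \<iota>2 a) = f1 a) \<and>
     (\<forall>b\<in>carrier S2. h (amalg_inr R S1 \<iota>1 S2 \<iota>2 b) = f2 b)) \<and>
    (\<forall>k\<in>ring_hom (amalg R S1 \<iota>1 S2 \<iota>2) T.
     (\<forall>a\<in>carrier S1. k (amalg_inl R S1 \<iota>1 S2 \<iota>2 a) = f1 a) \<and>
     (\<forall>b\<in>carrier S2. k (amalg_inr R S1 \<iota>1 S2 \<iota>2 b) = f2 b) \<longrightarrow>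
     (\<forall>s\<in>carrier (amalg R S1 \<iota>1 S2 \<iota>2). k s = h s))"
proof -
  interpret T: ring T by (rule T)
  define f where "f = case_sum f1 f2"
  define e where "e = free_eval T f"
  let ?F = "amalg_free S1 S2" and ?G = "Inl ` carrier S1 \<union> Inr ` carrier S2"
  have f: "f \<in> ?G \<rightarrow> carrier T"
    using ring_hom_closed[OF f1] ring_hom_closed[OF f2] by (auto simp: f_def)
  have e: "e \<in> ring_hom ?F T" unfolding e_def amalg_free_def by (rule free_eval_hom[OF T f])
  interpret e: ring_hom_ring ?F T e using F.ring_axioms T e by (rule ring_hom_ringI2)
  have el: "e (word_elem [Inl a]) = f1 a" if "a \<in> carrier S1" for a
    using free_eval_word[OF T f, of "[Inl a]"] that ring_hom_closed[OF f1 that]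
    by (simp add: e_def f_def)
  have er: "e (word_elem [Inr b]) = f2 b" if "b \<in> carrier S2" for b
    using free_eval_word[OF T f, of "[Inr b]"] that ring_hom_closed[OF f2 that]
    by (simp add: e_def f_def)
  have diff: "e (p \<ominus>\<^bsub>?F\<^esub> q) = \<zero>\<^bsub>T\<^esub>" if "p \<in> carrier ?F" "q \<in> carrier ?F" "e p = e q" for p q
    using that by (simp add: F.minus_eq T.r_neg)
  have "amalg_rels R S1 \<iota>1 S2 \<iota>2 \<subseteq> a_kernel ?F T e"
  proof
    fix z assume z: "z \<in> amalg_rels R S1 \<iota>1 S2 \<iota>2"
    have "e z = \<zero>\<^bsub>T\<^esub>"
      using z unfolding amalg_rels_def Let_def
      by (elim UnE CollectE exE conjE singletonE; hypsubst; intro diff;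
          simp add: el er ring_hom_closed[OF \<iota>1] ring_hom_closed[OF \<iota>2] f12
            amalg_word_carrier ring_hom_add[OF f1] ring_hom_add[OF f2]
            ring_hom_mult[OF f1] ring_hom_mult[OF f2] ring_hom_one[OF f1] ring_hom_one[OF f2])
    thus "z \<in> a_kernel ?F T e"
      using subsetD[OF amalg_rels_carrier z] unfolding a_kernel_def' by blast
  qed
  hence "AI \<subseteq> a_kernel ?F T e"
    unfolding amalg_ideal_def by (rule F.genideal_minimal[OF e.kernel_is_ideal])
  hence ker: "e z = \<zero>\<^bsub>T\<^esub>" if "z \<in> AI" for z using that unfolding a_kernel_def' by blast
  define h where "h = (\<lambda>X. the_elem (e ` X))"
  have h: "h (AI +>\<^bsub>?F\<^esub> p) = e p" if p: "p \<in> carrier ?F" for p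
  proof -
    have *: "e s = e p" if s: "s \<in> AI +>\<^bsub>?F\<^esub> p" for s
    proof -
      obtain z where z: "z \<in> AI" "s = z \<oplus>\<^bsub>?F\<^esub> p"
        using s by (auto simp: a_r_coset_def r_coset_def)
      thus ?thesis using p ker[OF z(1)] AI.Icarr[OF z(1)] by simp
    qed
    have "e ` (AI +>\<^bsub>?F\<^esub> p) = (\<lambda>_. e p) ` (AI +>\<^bsub>?F\<^esub> p)" by (rule image_cong[OF refl *])
    also have "\<dots> = {e p}" by (rule image_constant[OF AI.a_rcos_self[OF p]])
    finally show ?thesis by (simp add: h_def)
  qed
  note q = AI.rcos_ring_hom[folded amalg_def]
  have ex: "\<exists>p\<in>carrier ?F. X = AI +>\<^bsub>?F\<^esub> p" if "X \<in> carrier (amalg R S1 \<iota>1 S2 \<iota>2)" for X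
    using that by (auto simp: amalg_def FactRing_def A_RCOSETS_def' a_r_coset_def RCOSETS_def A_RCOSETS_def)
  have hh: "h \<in> ring_hom (amalg R S1 \<iota>1 S2 \<iota>2) T"
  proof (rule ring_hom_memI)
    show "h X \<in> carrier T" if "X \<in> carrier (amalg R S1 \<iota>1 S2 \<iota>2)" for X
      using ex[OF that] h by auto
    fix X Y assume "X \<in> carrier (amalg R S1 \<iota>1 S2 \<iota>2)" "Y \<in> carrier (amalg R S1 \<iota>1 S2 \<iota>2)"
    then obtain p r where p: "p \<in> carrier ?F" "X = AI +>\<^bsub>?F\<^esub> p" and r: "r \<in> carrier ?F" "Y = AI +>\<^bsub>?F\<^esub> r"
      using ex by blast
    show "h (X \<otimes>\<^bsub>amalg R S1 \<iota>1 S2 \<iota>2\<^esub> Y) = h X \<otimes>\<^bsub>T\<^esub> h Y"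
      using p r by (simp add: h ring_hom_mult[OF q, symmetric])
    show "h (X \<oplus>\<^bsub>amalg R S1 \<iota>1 S2 \<iota>2\<^esub> Y) = h X \<oplus>\<^bsub>T\<^esub> h Y"
      using p r by (simp add: h ring_hom_add[OF q, symmetric])
  next
    show "h \<one>\<^bsub>amalg R S1 \<iota>1 S2 \<iota>2\<^esub> = \<one>\<^bsub>T\<^esub>"
      using h[OF F.one_closed] ring_hom_one[OF q] by simp
  qed
  have uniq: "k s = h s"
    if k: "k \<in> ring_hom (amalg R S1 \<iota>1 S2 \<iota>2) T"
      and kl: "\<forall>a\<in>carrier S1. k (amalg_inl R S1 \<iota>1 S2 \<iota>2 a) = f1 a"
      and kr: "\<forall>b\<in>carrier S2. k (amalg_inr R S1 \<iota>1 S2 \<iota>2 b) = f2 b"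
      and s: "s \<in> carrier (amalg R S1 \<iota>1 S2 \<iota>2)" for k s
  proof -
    obtain p where p: "p \<in> carrier ?F" "s = AI +>\<^bsub>?F\<^esub> p" using ex[OF s] by blast
    have kq: "k \<circ> (\<lambda>p. AI +>\<^bsub>?F\<^esub> p) \<in> ring_hom ?F T" by (rule ring_hom_trans[OF q k])
    have "(k \<circ> (\<lambda>p. AI +>\<^bsub>?F\<^esub> p)) p = e p"
    proof (rule free_ring_hom_eqI[OF T, where G = ?G])
      show "k \<circ> (\<lambda>p. AI +>\<^bsub>?F\<^esub> p) \<in> ring_hom (free_ring ?G) T"
        using kq by (simp only: amalg_free_def[symmetric])
      show "e \<in> ring_hom (free_ring ?G) T" using e by (simp only: amalg_free_def[symmetric])
      show "p \<in> carrier (free_ring ?G)" using p(1) by (simp only: amalg_free_def[symmetric])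
      show "(k \<circ> (\<lambda>p. AI +>\<^bsub>?F\<^esub> p)) (word_elem [g]) = e (word_elem [g])" if "g \<in> ?G" for g
        using that kl kr el er by (auto simp: amalg_inl_def amalg_inr_def)
    qed
    thus ?thesis using h[OF p(1)] p(2) by simp
  qed
  show ?thesis
  proof (intro bexI[OF _ hh] conjI ballI impI)
    show "h (amalg_inl R S1 \<iota>1 S2 \<iota>2 a) = f1 a" if "a \<in> carrier S1" for a
      using h[OF amalg_word_carrier(1)[OF that]] el[OF that] by (simp add: amalg_inl_def)
    show "h (amalg_inr R S1 \<iota>1 S2 \<iota>2 b) = f2 b" if "b \<in> carrier S2" for b
      using h[OF amalg_word_carrier(2)[OF that]] er[OF that] by (simp add: amalg_inr_def)
  qed (use uniq in blast)
qed

end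


section \<open>Existence of Ore extensions\<close>

text \<open>Left multiplication by \<open>x\<close> on coefficient sequences.\<close>

definition ore_shift ::
  "('a, 'm) ring_scheme \<Rightarrow> ('a \<Rightarrow> 'a) \<Rightarrow> ('a \<Rightarrow> 'a) \<Rightarrow> (nat \<Rightarrow> 'a) \<Rightarrow> nat \<Rightarrow> 'a" where
  "ore_shift R \<tau> \<delta> p =
     (\<lambda>n. (case n of 0 \<Rightarrow> \<zero>\<^bsub>R\<^esub> | Suc k \<Rightarrow> \<tau> (p k)) \<oplus>\<^bsub>R\<^esub> \<delta> (p n))"

definition ore_model ::
  "('a, 'm) ring_scheme \<Rightarrow> ('a \<Rightarrow> 'a) \<Rightarrow> ('a \<Rightarrow> 'a) \<Rightarrow> (nat \<Rightarrow> 'a) ring" where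
  "ore_model R \<tau> \<delta> =
     \<lparr>carrier = {p. (\<forall>n. p n \<in> carrier R) \<and> finite {n. p n \<noteq> \<zero>\<^bsub>R\<^esub>}},
      mult = (\<lambda>p q n. \<Oplus>\<^bsub>R\<^esub>i\<in>{i. p i \<noteq> \<zero>\<^bsub>R\<^esub>}. p i \<otimes>\<^bsub>R\<^esub> (ore_shift R \<tau> \<delta> ^^ i) q n),
      one = (\<lambda>n. if n = 0 then \<one>\<^bsub>R\<^esub> else \<zero>\<^bsub>R\<^esub>),
      zero = (\<lambda>n. \<zero>\<^bsub>R\<^esub>),
      add = (\<lambda>p q n. p n \<oplus>\<^bsub>R\<^esub> q n)\<rparr>"

context
  fixes R :: "('a, 'm) ring_scheme" (structure) and \<tau> \<delta> :: "'a \<Rightarrow> 'a"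
  assumes R: "ring R" and \<tau>: "\<tau> \<in> ring_hom R R" and \<delta>: "left_skew_derivation R \<tau> \<delta>"
begin

interpretation ring R by (rule R)
interpretation tau: ring_hom_ring R R \<tau> using R R \<tau> by (rule ring_hom_ringI2)

private abbreviation (input) "C \<equiv> carrier (ore_model R \<tau> \<delta>)"
private abbreviation (input) "X \<equiv> ore_shift R \<tau> \<delta>"
private abbreviation (input) "sing a i \<equiv> (\<lambda>n::nat. if n = i then a else \<zero>)"
private abbreviation (input) "pmult p q \<equiv> p \<otimes>\<^bsub>ore_model R \<tau> \<delta>\<^esub> q"
private abbreviation (input) "scal r p \<equiv> (\<lambda>n::nat. r \<otimes> p n)"
private abbreviation (input) "padd p q \<equiv> (\<lambda>n::nat. p n \<oplus> q n)"

lemma ore_model_simps: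
  "C = {p. (\<forall>n. p n \<in> carrier R) \<and> finite {n. p n \<noteq> \<zero>}}"
  "pmult p q = (\<lambda>n. \<Oplus>i\<in>{i. p i \<noteq> \<zero>}. p i \<otimes> (X ^^ i) q n)"
  "\<one>\<^bsub>ore_model R \<tau> \<delta>\<^esub> = sing \<one> 0"
  "\<zero>\<^bsub>ore_model R \<tau> \<delta>\<^esub> = (\<lambda>n. \<zero>)"
  "p \<oplus>\<^bsub>ore_model R \<tau> \<delta>\<^esub> q = padd p q"
  by (simp_all add: ore_model_def)

lemma delta_closed: "r \<in> carrier R \<Longrightarrow> \<delta> r \<in> carrier R"
  and delta_add: "r \<in> carrier R \<Longrightarrow> s \<in> carrier R \<Longrightarrow> \<delta> (r \<oplus> s) = \<delta> r \<oplus> \<delta> s"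
  and delta_mult: "r \<in> carrier R \<Longrightarrow> s \<in> carrier R \<Longrightarrow> \<delta> (r \<otimes> s) = \<tau> r \<otimes> \<delta> s \<oplus> \<delta> r \<otimes> s"
  using \<delta> by (auto simp: left_skew_derivation_def)

lemma delta_zero: "\<delta> \<zero> = \<zero>"
proof -
  have "\<delta> \<zero> = \<delta> \<zero> \<oplus> \<delta> \<zero>" using delta_add[of \<zero> \<zero>] by simp
  thus ?thesis using delta_closed[of \<zero>] by (metis add.r_cancel_one' zero_closed)
qed

lemma delta_one: "\<delta> \<one> = \<zero>"
proof -
  have "\<delta> \<one> = \<delta> \<one> \<oplus> \<delta> \<one>" using delta_mult[of \<one> \<one>] delta_closed[of \<one>] by simp
  thus ?thesis using delta_closed[of \<one>] by (metis add.r_cancel_one' one_closed)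
qed

lemma C_closed: "p \<in> C \<Longrightarrow> p n \<in> carrier R" by (simp add: ore_model_simps)

lemma C_subsetI:
  assumes "\<And>n. p n \<in> carrier R" "finite A" "\<And>n. p n \<noteq> \<zero> \<Longrightarrow> n \<in> A"
  shows "p \<in> C"
proof -
  have "{n. p n \<noteq> \<zero>} \<subseteq> A" using assms(3) by auto
  thus ?thesis using assms(1) finite_subset[OF _ assms(2)] by (simp add: ore_model_simps)
qed

lemma sing_closed: "a \<in> carrier R \<Longrightarrow> sing a i \<in> C"
  by (rule C_subsetI[where A = "{i}"]) (auto split: if_splits)

lemma zero_C: "(\<lambda>n. \<zero>) \<in> C"
  by (rule C_subsetI[where A = "{}"]) auto

lemma padd_closed:
  assumes "p \<in> C" "q \<in> C" shows "padd p q \<in> C"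
proof (rule C_subsetI)
  show "finite ({n. p n \<noteq> \<zero>} \<union> {n. q n \<noteq> \<zero>})" using assms by (simp add: ore_model_simps)
  show "p n \<oplus> q n \<in> carrier R" for n using assms by (simp add: C_closed)
  show "n \<in> {n. p n \<noteq> \<zero>} \<union> {n. q n \<noteq> \<zero>}" if "p n \<oplus> q n \<noteq> \<zero>" for n using that by auto
qed

lemma scal_closed:
  assumes "r \<in> carrier R" "p \<in> C" shows "scal r p \<in> C"
proof (rule C_subsetI)
  show "finite {n. p n \<noteq> \<zero>}" using assms by (simp add: ore_model_simps)
  show "r \<otimes> p n \<in> carrier R" for n using assms by (simp add: C_closed)
  show "n \<in> {n. p n \<noteq> \<zero>}" if "r \<otimes> p n \<noteq> \<zero>" for n using that assms(1) by auto
qed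

lemma shift_closed:
  assumes "p \<in> C" shows "X p \<in> C"
proof (rule C_subsetI)
  show "finite ({n. p n \<noteq> \<zero>} \<union> Suc ` {n. p n \<noteq> \<zero>})" using assms by (simp add: ore_model_simps)
  show "X p n \<in> carrier R" for n
    using assms by (auto simp: ore_shift_def C_closed delta_closed split: nat.split)
  show "n \<in> {n. p n \<noteq> \<zero>} \<union> Suc ` {n. p n \<noteq> \<zero>}" if "X p n \<noteq> \<zero>" for n
  proof (rule ccontr)
    assume n: "n \<notin> {n. p n \<noteq> \<zero>} \<union> Suc ` {n. p n \<noteq> \<zero>}"
    hence "p n = \<zero>" "\<And>k. n = Suc k \<Longrightarrow> p k = \<zero>" by auto
    hence "X p n = \<zero>" by (cases n) (simp_all add: ore_shift_def delta_zero)
    thus False using that by simp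
  qed
qed

lemma shift_pow_closed: "p \<in> C \<Longrightarrow> (X ^^ i) p \<in> C"
  by (induction i) (auto intro: shift_closed)

lemma shift_add: "p \<in> C \<Longrightarrow> q \<in> C \<Longrightarrow> X (padd p q) = padd (X p) (X q)"
  by (rule ext) (auto simp: ore_shift_def C_closed delta_closed delta_add a_ac split: nat.split)

lemma shift_pow_add: "p \<in> C \<Longrightarrow> q \<in> C \<Longrightarrow> (X ^^ i) (padd p q) = padd ((X ^^ i) p) ((X ^^ i) q)"
  by (induction i) (simp_all add: shift_add shift_pow_closed)

lemma shift_scal:
  "r \<in> carrier R \<Longrightarrow> p \<in> C \<Longrightarrow> X (scal r p) = padd (scal (\<tau> r) (X p)) (scal (\<delta> r) p)"
  by (rule ext)
    (auto simp: ore_shift_def C_closed delta_closed delta_mult r_distr a_ac split: nat.split)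

lemma shift_sing:
  "a \<in> carrier R \<Longrightarrow> X (sing a i) = padd (sing (\<tau> a) (Suc i)) (sing (\<delta> a) i)"
  by (rule ext) (auto simp: ore_shift_def delta_closed delta_zero split: nat.split)

lemma pmult_superset:
  assumes "p \<in> C" "q \<in> C" "finite A" "{i. p i \<noteq> \<zero>} \<subseteq> A"
  shows "pmult p q = (\<lambda>n. \<Oplus>i\<in>A. p i \<otimes> (X ^^ i) q n)"
proof
  fix n
  show "pmult p q n = (\<Oplus>i\<in>A. p i \<otimes> (X ^^ i) q n)"
    unfolding ore_model_simps
    using assms(3,4) C_closed[OF assms(1)] C_closed[OF shift_pow_closed[OF assms(2)]]
    by (intro add.finprod_mono_neutral_cong_left) auto
qed

lemma pmult_closed:
  assumes "p \<in> C" "q \<in> C" shows "pmult p q \<in> C"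
proof (rule C_subsetI)
  note cl = C_closed[OF assms(1)] C_closed[OF shift_pow_closed[OF assms(2)]]
  show "finite (\<Union>i\<in>{i. p i \<noteq> \<zero>}. {n. (X ^^ i) q n \<noteq> \<zero>})"
    using assms(1) shift_pow_closed[OF assms(2)] by (simp add: ore_model_simps)
  show "pmult p q n \<in> carrier R" for n
    unfolding ore_model_simps using cl by (intro finsum_closed) auto
  show "n \<in> (\<Union>i\<in>{i. p i \<noteq> \<zero>}. {n. (X ^^ i) q n \<noteq> \<zero>})" if n: "pmult p q n \<noteq> \<zero>" for n
  proof (rule ccontr)
    assume "\<not> ?thesis"
    hence "\<And>i. p i \<noteq> \<zero> \<Longrightarrow> (X ^^ i) q n = \<zero>" by auto
    hence "\<And>i. p i \<otimes> (X ^^ i) q n = \<zero>" using cl by (metis l_null r_null)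
    hence "pmult p q n = \<zero>" unfolding ore_model_simps by simp
    thus False using n by simp
  qed
qed

lemma pmult_add_left:
  assumes "p \<in> C" "q \<in> C" "r \<in> C"
  shows "pmult (padd p q) r = padd (pmult p r) (pmult q r)"
proof -
  let ?A = "{n. p n \<noteq> \<zero>} \<union> {n. q n \<noteq> \<zero>}"
  have A: "finite ?A" using assms by (simp add: ore_model_simps)
  note cl = C_closed[OF assms(1)] C_closed[OF assms(2)] C_closed[OF shift_pow_closed[OF assms(3)]]
  have "pmult (padd p q) r = (\<lambda>n. \<Oplus>i\<in>?A. (p i \<oplus> q i) \<otimes> (X ^^ i) r n)"
    by (rule pmult_superset[OF padd_closed[OF assms(1,2)] assms(3) A]) auto
  also have "\<dots> = (\<lambda>n. \<Oplus>i\<in>?A. p i \<otimes> (X ^^ i) r n \<oplus> q i \<otimes> (X ^^ i) r n)"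
    using cl by (simp add: l_distr)
  also have "\<dots> = (\<lambda>n. (\<Oplus>i\<in>?A. p i \<otimes> (X ^^ i) r n) \<oplus> (\<Oplus>i\<in>?A. q i \<otimes> (X ^^ i) r n))"
    using cl by (intro ext finsum_addf) auto
  also have "\<dots> = padd (pmult p r) (pmult q r)"
    using pmult_superset[OF assms(1,3) A] pmult_superset[OF assms(2,3) A] by simp
  finally show ?thesis .
qed

lemma pmult_add_right:
  assumes "p \<in> C" "q \<in> C" "r \<in> C"
  shows "pmult p (padd q r) = padd (pmult p q) (pmult p r)"
proof -
  note cl = C_closed[OF assms(1)] C_closed[OF shift_pow_closed[OF assms(2)]]
    C_closed[OF shift_pow_closed[OF assms(3)]]
  have "pmult p (padd q r)
      = (\<lambda>n. \<Oplus>i\<in>{i. p i \<noteq> \<zero>}. p i \<otimes> (X ^^ i) q n \<oplus> p i \<otimes> (X ^^ i) r n)"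
    unfolding ore_model_simps using assms cl by (simp add: shift_pow_add r_distr)
  also have "\<dots> = padd (pmult p q) (pmult p r)"
    unfolding ore_model_simps using cl by (intro ext finsum_addf) auto
  finally show ?thesis .
qed

lemma pmult_sing:
  assumes "a \<in> carrier R" "q \<in> C"
  shows "pmult (sing a i) q = scal a ((X ^^ i) q)"
proof -
  have "pmult (sing a i) q = (\<lambda>n. \<Oplus>j\<in>{i}. sing a i j \<otimes> (X ^^ j) q n)"
    by (rule pmult_superset[OF sing_closed[OF assms(1)] assms(2)]) auto
  also have "\<dots> = scal a ((X ^^ i) q)"
    using assms C_closed[OF shift_pow_closed[OF assms(2)]] by simp
  finally show ?thesis .
qed

lemma pmult_zero_left: "pmult (\<lambda>n. \<zero>) q = (\<lambda>n. \<zero>)"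
  by (simp add: ore_model_simps)

lemma C_induct [consumes 1, case_names zero add]:
  assumes "p \<in> C"
    and zero: "P (\<lambda>n. \<zero>)"
    and step: "\<And>p a i. p \<in> C \<Longrightarrow> P p \<Longrightarrow> a \<in> carrier R \<Longrightarrow> P (padd (sing a i) p)"
  shows "P p"
proof -
  have "\<forall>p. p \<in> C \<longrightarrow> {n. p n \<noteq> \<zero>} \<subseteq> A \<longrightarrow> P p" if "finite A" for A
    using that
  proof (induction A)
    case empty
    show ?case
    proof (intro allI impI)
      fix p :: "nat \<Rightarrow> 'a" assume "{n. p n \<noteq> \<zero>} \<subseteq> {}"
      hence "p = (\<lambda>n. \<zero>)" by auto
      thus "P p" using zero by simp
    qed
  next
    case (insert i A)
    show ?case
    proof (intro allI impI)
      fix p assume p: "p \<in> C" and s: "{n. p n \<noteq> \<zero>} \<subseteq> insert i A"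
      define q where "q = (\<lambda>n. if n = i then \<zero> else p n)"
      have "q \<in> C"
        by (rule C_subsetI[OF _ insert.hyps(1)]) (use s C_closed[OF p] in \<open>auto simp: q_def split: if_splits\<close>)
      moreover have "{n. q n \<noteq> \<zero>} \<subseteq> A" using s by (auto simp: q_def)
      ultimately have "P (padd (sing (p i) i) q)" using insert.IH step C_closed[OF p] by blast
      moreover have "padd (sing (p i) i) q = p" using C_closed[OF p] by (auto simp: q_def)
      ultimately show "P p" by simp
    qed
  qed
  thus ?thesis using assms(1) by (auto simp: ore_model_simps)
qed

lemma scal_pmult:
  assumes "a \<in> carrier R" "p \<in> C" "q \<in> C"
  shows "pmult (scal a p) q = scal a (pmult p q)"
proof -
  have A: "finite {i. p i \<noteq> \<zero>}" using assms by (simp add: ore_model_simps)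
  note cl = C_closed[OF assms(2)] C_closed[OF shift_pow_closed[OF assms(3)]]
  have "pmult (scal a p) q = (\<lambda>n. \<Oplus>i\<in>{i. p i \<noteq> \<zero>}. a \<otimes> p i \<otimes> (X ^^ i) q n)"
    by (rule pmult_superset[OF scal_closed[OF assms(1,2)] assms(3) A]) (use assms(1) in auto)
  also have "\<dots> = (\<lambda>n. a \<otimes> (\<Oplus>i\<in>{i. p i \<noteq> \<zero>}. p i \<otimes> (X ^^ i) q n))"
    using assms(1) cl A by (subst finsum_rdistr) (auto simp: m_assoc)
  also have "\<dots> = scal a (pmult p q)" by (simp add: ore_model_simps)
  finally show ?thesis .
qed

lemma shift_pmult:
  assumes "p \<in> C" "q \<in> C"
  shows "X (pmult p q) = pmult (X p) q"
  using assms(1)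
proof (induction rule: C_induct)
  case zero
  have "X (\<lambda>n. \<zero>) = (\<lambda>n. \<zero>)"
    by (rule ext) (simp add: ore_shift_def delta_zero split: nat.split)
  thus ?case by (simp add: pmult_zero_left)
next
  case (add p a i)
  note a = \<open>a \<in> carrier R\<close> and p = \<open>p \<in> C\<close> and q = assms(2)
  note Xq = shift_pow_closed[OF q]
  have "X (pmult (padd (sing a i) p) q) = X (padd (scal a ((X ^^ i) q)) (pmult p q))"
    using pmult_add_left[OF sing_closed[OF a] p q] pmult_sing[OF a q] by simp
  also have "\<dots> = padd (X (scal a ((X ^^ i) q))) (X (pmult p q))"
    by (rule shift_add[OF scal_closed[OF a Xq] pmult_closed[OF p q]])
  also have "\<dots> = padd (padd (scal (\<tau> a) ((X ^^ Suc i) q)) (scal (\<delta> a) ((X ^^ i) q))) (pmult (X p) q)"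
    using shift_scal[OF a Xq] add.IH by simp
  also have "\<dots> = padd (pmult (padd (sing (\<tau> a) (Suc i)) (sing (\<delta> a) i)) q) (pmult (X p) q)"
    using pmult_add_left[OF sing_closed sing_closed q, of "\<tau> a" "\<delta> a" "Suc i" i] a delta_closed[OF a]
      pmult_sing[OF _ q, of "\<tau> a" "Suc i"] pmult_sing[OF _ q, of "\<delta> a" i]
    by simp
  also have "\<dots> = pmult (padd (X (sing a i)) (X p)) q"
    using pmult_add_left[OF shift_closed[OF sing_closed[OF a]] shift_closed[OF p] q]
    by (simp only: shift_sing[OF a])
  also have "\<dots> = pmult (X (padd (sing a i) p)) q"
    using shift_add[OF sing_closed[OF a] p] by simp
  finally show ?case .
qed

lemma shift_pow_pmult: "p \<in> C \<Longrightarrow> q \<in> C \<Longrightarrow> (X ^^ i) (pmult p q) = pmult ((X ^^ i) p) q"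
  by (induction i) (simp_all add: shift_pmult shift_pow_closed)

lemma pmult_assoc:
  assumes "p \<in> C" "q \<in> C" "r \<in> C"
  shows "pmult (pmult p q) r = pmult p (pmult q r)"
  using assms(1)
proof (induction rule: C_induct)
  case zero
  show ?case by (simp add: pmult_zero_left)
next
  case (add p a i)
  note a = \<open>a \<in> carrier R\<close> and p = \<open>p \<in> C\<close> and q = assms(2) and r = assms(3)
  note Xq = shift_pow_closed[OF q]
  have "pmult (pmult (padd (sing a i) p) q) r = pmult (padd (scal a ((X ^^ i) q)) (pmult p q)) r"
    using pmult_add_left[OF sing_closed[OF a] p q] pmult_sing[OF a q] by simp
  also have "\<dots> = padd (pmult (scal a ((X ^^ i) q)) r) (pmult (pmult p q) r)"
    by (rule pmult_add_left[OF scal_closed[OF a Xq] pmult_closed[OF p q] r])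
  also have "\<dots> = padd (scal a ((X ^^ i) (pmult q r))) (pmult p (pmult q r))"
    using add.IH scal_pmult[OF a Xq r] shift_pow_pmult[OF q r] by simp
  also have "\<dots> = pmult (padd (sing a i) p) (pmult q r)"
    using pmult_add_left[OF sing_closed[OF a] p pmult_closed[OF q r]]
      pmult_sing[OF a pmult_closed[OF q r]] by simp
  finally show ?case .
qed

lemma shift_sing_one: "X (sing \<one> i) = sing \<one> (Suc i)"
  by (rule ext) (simp add: shift_sing delta_one)

lemma shift_pow_sing_one: "(X ^^ n) (sing \<one> i) = sing \<one> (n + i)"
  by (induction n) (simp_all add: shift_sing_one)

lemma pmult_one_right:
  assumes "p \<in> C" shows "pmult p (sing \<one> 0) = p"
  using assms
proof (induction rule: C_induct)
  case zero
  show ?case by (rule pmult_zero_left)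
next
  case (add p a i)
  have "pmult (sing a i) (sing \<one> 0) = sing a i"
    unfolding pmult_sing[OF \<open>a \<in> carrier R\<close> sing_closed[OF one_closed]] shift_pow_sing_one
    using \<open>a \<in> carrier R\<close> by auto
  thus ?case using pmult_add_left[OF sing_closed add.hyps(1) sing_closed, of a \<one> i 0] add by simp
qed

lemma pmult_one_left:
  assumes "p \<in> C" shows "pmult (sing \<one> 0) p = p"
  using pmult_sing[OF one_closed assms, of 0] C_closed[OF assms] by simp

lemma ore_model_is_ring: "ring (ore_model R \<tau> \<delta>)"
proof (rule ringI)
  show "abelian_group (ore_model R \<tau> \<delta>)"
  proof (rule abelian_groupI)
    fix p assume p: "p \<in> C"
    have "(\<lambda>n. \<ominus> p n) \<in> C"
      by (rule C_subsetI[where A = "{n. p n \<noteq> \<zero>}"]) (use p in \<open>auto simp: ore_model_simps\<close>)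
    thus "\<exists>q\<in>C. q \<oplus>\<^bsub>ore_model R \<tau> \<delta>\<^esub> p = \<zero>\<^bsub>ore_model R \<tau> \<delta>\<^esub>"
      using C_closed[OF p] by (intro bexI) (auto simp: ore_model_simps(4,5) l_neg)
  qed (auto simp: ore_model_simps(4,5) padd_closed zero_C C_closed a_ac)
  show "Group.monoid (ore_model R \<tau> \<delta>)"
    by (rule monoidI)
      (simp_all add: pmult_closed pmult_assoc pmult_one_left pmult_one_right sing_closed ore_model_simps(3))
qed (simp_all add: ore_model_simps(5) pmult_add_left pmult_add_right)

interpretation O: ring "ore_model R \<tau> \<delta>" by (rule ore_model_is_ring)

lemma ore_finsum_apply:
  assumes "finite A" "\<And>i. i \<in> A \<Longrightarrow> g i \<in> C"
  shows "(\<Oplus>\<^bsub>ore_model R \<tau> \<delta>\<^esub>i\<in>A. g i) n = (\<Oplus>i\<in>A. g i n)"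
  using assms
proof (induction A)
  case empty
  thus ?case by (simp add: ore_model_simps(4))
next
  case (insert i A)
  have g: "g \<in> A \<rightarrow> C" "(\<lambda>i. g i n) \<in> A \<rightarrow> carrier R" using insert.prems C_closed by auto
  have gi: "g i \<in> C" "g i n \<in> carrier R" using insert.prems C_closed by auto
  show ?case
    using insert g gi by (simp add: ore_model_simps(5))
qed

theorem ore_extension_exists:
  "ore_extension R \<tau> \<delta> (ore_model R \<tau> \<delta>) (\<lambda>r. sing r 0) (sing \<one> 1)"
proof -
  let ?T = "ore_model R \<tau> \<delta>" and ?x = "sing \<one> 1"
  have hom: "(\<lambda>r. sing r 0) \<in> ring_hom R ?T"
  proof (rule ring_hom_memI)
    fix r s assume rs: "r \<in> carrier R" "s \<in> carrier R"
    show "sing (r \<otimes> s) 0 = pmult (sing r 0) (sing s 0)"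
      using rs by (simp add: pmult_sing[OF rs(1) sing_closed[OF rs(2)]] fun_eq_iff)
    show "sing (r \<oplus> s) 0 = sing r 0 \<oplus>\<^bsub>?T\<^esub> sing s 0"
      using rs by (auto simp: ore_model_simps(5))
  qed (simp_all add: sing_closed ore_model_simps(3))
  have inj: "inj_on (\<lambda>r. sing r 0) (carrier R)"
    by (rule inj_onI) (metis (full_types))
  have comm: "pmult ?x (sing r 0) = pmult (sing (\<tau> r) 0) ?x \<oplus>\<^bsub>?T\<^esub> sing (\<delta> r) 0"
    if r: "r \<in> carrier R" for r
    using r delta_closed[OF r]
    by (auto simp: pmult_sing sing_closed shift_sing[OF r] ore_model_simps(5) fun_eq_iff)
  have pow: "?x [^]\<^bsub>?T\<^esub> n = sing \<one> n" for n :: nat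
  proof (induction n)
    case 0
    show ?case by (simp add: ore_model_simps(3))
  next
    case (Suc n)
    have "?x [^]\<^bsub>?T\<^esub> Suc n = pmult (sing \<one> n) ?x" using Suc by simp
    also have "\<dots> = sing \<one> (Suc n)"
      unfolding pmult_sing[OF one_closed sing_closed[OF one_closed]] shift_pow_sing_one by auto
    finally show ?case .
  qed
  have mono: "pmult (sing a 0) (?x [^]\<^bsub>?T\<^esub> n) = sing a n" if "a \<in> carrier R" for a n
    unfolding pow using that
    by (simp add: pmult_sing[OF that sing_closed[OF one_closed]] fun_eq_iff)
  have expand: "(\<Oplus>\<^bsub>?T\<^esub>n\<in>{n. c n \<noteq> \<zero>}. pmult (sing (c n) 0) (?x [^]\<^bsub>?T\<^esub> n)) = c"
    if c: "\<forall>n. c n \<in> carrier R" "finite {n. c n \<noteq> \<zero>}" for c :: "nat \<Rightarrow> 'a"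
  proof
    fix m
    have "(\<Oplus>\<^bsub>?T\<^esub>n\<in>{n. c n \<noteq> \<zero>}. pmult (sing (c n) 0) (?x [^]\<^bsub>?T\<^esub> n)) m
        = (\<Oplus>\<^bsub>?T\<^esub>n\<in>{n. c n \<noteq> \<zero>}. sing (c n) n) m"
      using c mono by simp
    also have "\<dots> = (\<Oplus>n\<in>{n. c n \<noteq> \<zero>}. sing (c n) n m)"
      using c by (intro ore_finsum_apply) (auto intro: sing_closed)
    also have "\<dots> = c m"
    proof (cases "c m = \<zero>")
      case True
      hence "(\<Oplus>n\<in>{n. c n \<noteq> \<zero>}. if m = n then c n else \<zero>) = (\<Oplus>n\<in>{n. c n \<noteq> \<zero>}. \<zero>)"
        using c by (intro finsum_cong') auto
      thus ?thesis using True by simp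
    next
      case False
      thus ?thesis using c by (intro finsum_singleton) auto
    qed
    finally show "(\<Oplus>\<^bsub>?T\<^esub>n\<in>{n. c n \<noteq> \<zero>}. pmult (sing (c n) 0) (?x [^]\<^bsub>?T\<^esub> n)) m = c m" .
  qed
  have basis: "\<exists>!c :: nat \<Rightarrow> 'a. (\<forall>n. c n \<in> carrier R) \<and> finite {n. c n \<noteq> \<zero>} \<and>
      t = (\<Oplus>\<^bsub>?T\<^esub>n\<in>{n. c n \<noteq> \<zero>}. pmult (sing (c n) 0) (?x [^]\<^bsub>?T\<^esub> n))" if t: "t \<in> C" for t
  proof (rule ex1I[where a = t])
    have c: "\<forall>n. t n \<in> carrier R" "finite {n. t n \<noteq> \<zero>}" using t by (auto simp: ore_model_simps(1))
    show "(\<forall>n. t n \<in> carrier R) \<and> finite {n. t n \<noteq> \<zero>} \<and>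
      t = (\<Oplus>\<^bsub>?T\<^esub>n\<in>{n. t n \<noteq> \<zero>}. pmult (sing (t n) 0) (?x [^]\<^bsub>?T\<^esub> n))"
      using c expand[OF c] by simp
  next
    fix c :: "nat \<Rightarrow> 'a"
    assume c: "(\<forall>n. c n \<in> carrier R) \<and> finite {n. c n \<noteq> \<zero>} \<and>
      t = (\<Oplus>\<^bsub>?T\<^esub>n\<in>{n. c n \<noteq> \<zero>}. pmult (sing (c n) 0) (?x [^]\<^bsub>?T\<^esub> n))"
    thus "c = t" using expand[of c] by simp
  qed
  show ?thesis
    unfolding ore_extension_def
    using ore_model_is_ring hom inj sing_closed[OF one_closed] comm basis by blast
qed

end


end

theory Submission
  imports Defs "HOL-Algebra.Generated_Groups"
begin

text \<open>The ring \<open>S\<close> consists of noncommutative skew polynomials in \<open>x\<close> and \<open>y\<close> over \<open>R\<close>: it is a free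
  left \<open>R\<close>-module on the words in \<open>x\<close> and \<open>y\<close> (\<open>amalg_ore_free\<close>).  The words span because scalars can
  be moved to the left.  They are independent because the universal properties of the Ore extensions
  and of the amalgamated product provide an action of \<open>S\<close> on the \<open>R\<close>-valued functions of words, in
  which an element is determined by its effect on a single function
  (\<open>word_representation\<close>, \<open>free_criterion\<close>).

  The same holds for the amalgamated product \<open>A\<close> over \<open>R/I\<close>, and the universal properties give a
  homomorphism \<open>S \<rightarrow> A\<close> that reduces coefficients modulo \<open>I\<close>.  Comparing coordinates, it is onto and
  its kernel consists of the elements with all coordinates in \<open>I\<close>, which is \<open>IS\<close>.  That the kernel
  is also \<open>SI\<close> rests on \<open>\<tau>\<^sub>i(I) = I\<close>: then \<open>\<tau>\<^sub>i(a) x\<^sub>i = x\<^sub>i a - \<delta>\<^sub>i(a)\<close> moves coefficients in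
  \<open>I\<close> to the right (\<open>free_skew_reduction\<close>).  This is where the chain condition enters: in a noetherian
  ring an automorphism that maps \<open>I\<close> into itself maps it onto itself
  (\<open>noetherian_invariant_ideal_image\<close>).  In particular \<open>\<tau>\<^sub>i\<close> induces an automorphism of \<open>R/I\<close>.

  It remains to see that \<open>A\<close> is prime, for then so is the kernel.  Let \<open>f\<close> and \<open>g\<close> be nonzero
  and let \<open>a u\<close> and \<open>b v\<close> be terms of maximal length in them.  Moving a scalar through a word
  produces only shorter words in addition to the twisted scalar, and no other pair of words of these
  lengths or less has the concatenation \<open>u v\<close>.  Hence the coefficient of \<open>u v\<close> in \<open>f r g\<close> is
  \<open>a \<tau>\<^sub>u(r b)\<close>, where \<open>\<tau>\<^sub>u\<close> is the composite of the automorphisms along \<open>u\<close>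
  (\<open>top_coordinate\<close>), and as \<open>R/I\<close> is prime this is nonzero for some \<open>r\<close>
  (\<open>prime_skew_extension\<close>).\<close>

section \<open>Left linear combinations and left bases\<close>

definition fin_supp :: "('a, 'm) ring_scheme \<Rightarrow> ('k \<Rightarrow> 'a) set" where
  "fin_supp R = {c. (\<forall>k. c k \<in> carrier R) \<and> finite {k. c k \<noteq> \<zero>\<^bsub>R\<^esub>}}"

definition lincomb ::
  "('a, 'm) ring_scheme \<Rightarrow> ('b, 'n) ring_scheme \<Rightarrow> ('a \<Rightarrow> 'b) \<Rightarrow> ('k \<Rightarrow> 'b) \<Rightarrow> ('k \<Rightarrow> 'a) \<Rightarrow> 'b" where
  "lincomb R A \<phi> b c = (\<Oplus>\<^bsub>A\<^esub>k\<in>{k. c k \<noteq> \<zero>\<^bsub>R\<^esub>}. \<phi> (c k) \<otimes>\<^bsub>A\<^esub> b k)"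

lemma fin_suppI:
  assumes "\<And>k. c k \<in> carrier R" "finite K" "\<And>k. k \<notin> K \<Longrightarrow> c k = \<zero>\<^bsub>R\<^esub>"
  shows "c \<in> fin_supp R"
proof -
  have "{k. c k \<noteq> \<zero>\<^bsub>R\<^esub>} \<subseteq> K" using assms(3) by auto
  thus ?thesis using assms(1,2) finite_subset by (auto simp: fin_supp_def)
qed

lemma fin_supp_closed: "c \<in> fin_supp R \<Longrightarrow> c k \<in> carrier R"
  by (simp add: fin_supp_def)

lemma fin_supp_finite: "c \<in> fin_supp R \<Longrightarrow> finite {k. c k \<noteq> \<zero>\<^bsub>R\<^esub>}"
  by (simp add: fin_supp_def)

locale combinations = ring_hom_ring R A \<phi>
  for R :: "('a, 'm) ring_scheme" and A :: "('b, 'n) ring_scheme" and \<phi> :: "'a \<Rightarrow> 'b" +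
  fixes b :: "'k \<Rightarrow> 'b"
  assumes b_closed: "b k \<in> carrier A"
begin

abbreviation comb :: "('k \<Rightarrow> 'a) \<Rightarrow> 'b" where "comb \<equiv> lincomb R A \<phi> b"

definition span :: "'k set \<Rightarrow> 'b set" where
  "span K = comb ` {c \<in> fin_supp R. \<forall>k. c k \<noteq> \<zero>\<^bsub>R\<^esub> \<longrightarrow> k \<in> K}"

lemma term_closed: "a \<in> carrier R \<Longrightarrow> \<phi> a \<otimes>\<^bsub>A\<^esub> b k \<in> carrier A"
  using b_closed by simp

lemma comb_superset:
  assumes "c \<in> fin_supp R" "finite K" "\<And>k. k \<notin> K \<Longrightarrow> c k = \<zero>\<^bsub>R\<^esub>"
  shows "comb c = (\<Oplus>\<^bsub>A\<^esub>k\<in>K. \<phi> (c k) \<otimes>\<^bsub>A\<^esub> b k)"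
  unfolding lincomb_def
  using assms fin_supp_closed[OF assms(1)] b_closed
  by (intro S.add.finprod_mono_neutral_cong_left) auto

text \<open>An additively closed set that contains the terms of a linear combination contains its value.
  This serves as the induction principle for linear combinations.\<close>

lemma comb_mem:
  assumes c: "c \<in> fin_supp R" and zero: "\<zero>\<^bsub>A\<^esub> \<in> Z"
    and add: "\<And>s t. s \<in> carrier A \<Longrightarrow> t \<in> carrier A \<Longrightarrow> s \<in> Z \<Longrightarrow> t \<in> Z \<Longrightarrow> s \<oplus>\<^bsub>A\<^esub> t \<in> Z"
    and mono: "\<And>k. c k \<noteq> \<zero>\<^bsub>R\<^esub> \<Longrightarrow> \<phi> (c k) \<otimes>\<^bsub>A\<^esub> b k \<in> Z"
  shows "comb c \<in> Z"
proof -
  have "K \<subseteq> {k. c k \<noteq> \<zero>\<^bsub>R\<^esub>} \<Longrightarrow> (\<Oplus>\<^bsub>A\<^esub>k\<in>K. \<phi> (c k) \<otimes>\<^bsub>A\<^esub> b k) \<in> carrier A \<inter> Z" if "finite K" for K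
    using that
  proof (induction K)
    case empty
    show ?case using zero by simp
  next
    case (insert k K)
    thus ?case using fin_supp_closed[OF c] b_closed mono add by (subst S.finsum_insert) auto
  qed
  thus ?thesis unfolding lincomb_def using fin_supp_finite[OF c] by blast
qed

lemma comb_closed: "c \<in> fin_supp R \<Longrightarrow> comb c \<in> carrier A"
  by (rule comb_mem) (auto simp: term_closed fin_supp_closed)

lemma fin_supp_add:
  assumes "c \<in> fin_supp R" "d \<in> fin_supp R"
  shows "(\<lambda>k. c k \<oplus>\<^bsub>R\<^esub> d k) \<in> fin_supp R"
  by (rule fin_suppI[where K = "{k. c k \<noteq> \<zero>\<^bsub>R\<^esub>} \<union> {k. d k \<noteq> \<zero>\<^bsub>R\<^esub>}"])
    (use assms in \<open>auto simp: fin_supp_closed fin_supp_finite\<close>)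

lemma fin_supp_single: "a \<in> carrier R \<Longrightarrow> (\<lambda>j. if j = k then a else \<zero>\<^bsub>R\<^esub>) \<in> fin_supp R"
  by (rule fin_suppI[where K = "{k}"]) auto

lemma fin_supp_upd: "c \<in> fin_supp R \<Longrightarrow> a \<in> carrier R \<Longrightarrow> c(k := a) \<in> fin_supp R"
  by (rule fin_suppI[where K = "insert k {k. c k \<noteq> \<zero>\<^bsub>R\<^esub>}"]) (auto simp: fin_supp_closed fin_supp_finite)

lemma fin_supp_scal:
  assumes "a \<in> carrier R" "c \<in> fin_supp R"
  shows "(\<lambda>k. a \<otimes>\<^bsub>R\<^esub> c k) \<in> fin_supp R"
  by (rule fin_suppI[where K = "{k. c k \<noteq> \<zero>\<^bsub>R\<^esub>}"])
    (use assms in \<open>auto simp: fin_supp_closed fin_supp_finite\<close>)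

lemma comb_add:
  assumes "c \<in> fin_supp R" "d \<in> fin_supp R"
  shows "comb (\<lambda>k. c k \<oplus>\<^bsub>R\<^esub> d k) = comb c \<oplus>\<^bsub>A\<^esub> comb d"
proof -
  let ?K = "{k. c k \<noteq> \<zero>\<^bsub>R\<^esub>} \<union> {k. d k \<noteq> \<zero>\<^bsub>R\<^esub>}"
  have K: "finite ?K" using assms fin_supp_finite by auto
  note cl = fin_supp_closed[OF assms(1)] fin_supp_closed[OF assms(2)] b_closed
  have "comb (\<lambda>k. c k \<oplus>\<^bsub>R\<^esub> d k) = (\<Oplus>\<^bsub>A\<^esub>k\<in>?K. \<phi> (c k \<oplus>\<^bsub>R\<^esub> d k) \<otimes>\<^bsub>A\<^esub> b k)"
    using K by (intro comb_superset fin_supp_add assms) auto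
  also have "\<dots> = (\<Oplus>\<^bsub>A\<^esub>k\<in>?K. \<phi> (c k) \<otimes>\<^bsub>A\<^esub> b k \<oplus>\<^bsub>A\<^esub> \<phi> (d k) \<otimes>\<^bsub>A\<^esub> b k)"
    using cl by (intro S.finsum_cong') (auto simp: S.l_distr)
  also have "\<dots> = (\<Oplus>\<^bsub>A\<^esub>k\<in>?K. \<phi> (c k) \<otimes>\<^bsub>A\<^esub> b k) \<oplus>\<^bsub>A\<^esub> (\<Oplus>\<^bsub>A\<^esub>k\<in>?K. \<phi> (d k) \<otimes>\<^bsub>A\<^esub> b k)"
    using cl by (intro S.finsum_addf) auto
  also have "\<dots> = comb c \<oplus>\<^bsub>A\<^esub> comb d"
    using comb_superset[OF assms(1) K] comb_superset[OF assms(2) K] by auto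
  finally show ?thesis .
qed

lemma comb_single:
  assumes "a \<in> carrier R"
  shows "comb (\<lambda>j. if j = k then a else \<zero>\<^bsub>R\<^esub>) = \<phi> a \<otimes>\<^bsub>A\<^esub> b k"
  using comb_superset[OF fin_supp_single[OF assms], of "{k}" k] term_closed[OF assms] by simp

lemma comb_split:
  assumes "c \<in> fin_supp R"
  shows "comb c = \<phi> (c k) \<otimes>\<^bsub>A\<^esub> b k \<oplus>\<^bsub>A\<^esub> comb (c(k := \<zero>\<^bsub>R\<^esub>))"
proof -
  have "c = (\<lambda>j. (if j = k then c k else \<zero>\<^bsub>R\<^esub>) \<oplus>\<^bsub>R\<^esub> (c(k := \<zero>\<^bsub>R\<^esub>)) j)"
    using fin_supp_closed[OF assms] by auto
  hence "comb c = comb (\<lambda>j. (if j = k then c k else \<zero>\<^bsub>R\<^esub>) \<oplus>\<^bsub>R\<^esub> (c(k := \<zero>\<^bsub>R\<^esub>)) j)" by simp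
  also have "\<dots> = comb (\<lambda>j. if j = k then c k else \<zero>\<^bsub>R\<^esub>) \<oplus>\<^bsub>A\<^esub> comb (c(k := \<zero>\<^bsub>R\<^esub>))"
    by (intro comb_add fin_supp_single fin_supp_upd assms fin_supp_closed[OF assms]) simp
  also have "\<dots> = \<phi> (c k) \<otimes>\<^bsub>A\<^esub> b k \<oplus>\<^bsub>A\<^esub> comb (c(k := \<zero>\<^bsub>R\<^esub>))"
    using comb_single[OF fin_supp_closed[OF assms]] by simp
  finally show ?thesis .
qed

lemma comb_scal:
  assumes "a \<in> carrier R" "c \<in> fin_supp R"
  shows "comb (\<lambda>k. a \<otimes>\<^bsub>R\<^esub> c k) = \<phi> a \<otimes>\<^bsub>A\<^esub> comb c"
proof -
  let ?K = "{k. c k \<noteq> \<zero>\<^bsub>R\<^esub>}"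
  note cl = fin_supp_closed[OF assms(2)] b_closed
  have "comb (\<lambda>k. a \<otimes>\<^bsub>R\<^esub> c k) = (\<Oplus>\<^bsub>A\<^esub>k\<in>?K. \<phi> (a \<otimes>\<^bsub>R\<^esub> c k) \<otimes>\<^bsub>A\<^esub> b k)"
    using assms by (intro comb_superset fin_supp_scal fin_supp_finite) auto
  also have "\<dots> = (\<Oplus>\<^bsub>A\<^esub>k\<in>?K. \<phi> a \<otimes>\<^bsub>A\<^esub> (\<phi> (c k) \<otimes>\<^bsub>A\<^esub> b k))"
    using cl assms by (intro S.finsum_cong') (auto simp: S.m_assoc)
  also have "\<dots> = \<phi> a \<otimes>\<^bsub>A\<^esub> comb c"
    unfolding lincomb_def
    using cl assms fin_supp_finite by (intro S.finsum_rdistr[symmetric]) auto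
  finally show ?thesis .
qed

text \<open>The criterion for linear independence: if additive functionals read off the coefficients of
  monomials, then they read off those of all linear combinations, which are therefore unique.\<close>

lemma coefficient_functional:
  assumes c: "c \<in> fin_supp R"
    and add: "\<And>s t. s \<in> carrier A \<Longrightarrow> t \<in> carrier A \<Longrightarrow> g (s \<oplus>\<^bsub>A\<^esub> t) = g s \<oplus>\<^bsub>R\<^esub> g t"
    and zero: "g \<zero>\<^bsub>A\<^esub> = \<zero>\<^bsub>R\<^esub>"
    and mono: "\<And>a j. a \<in> carrier R \<Longrightarrow> g (\<phi> a \<otimes>\<^bsub>A\<^esub> b j) = (if j = k then a else \<zero>\<^bsub>R\<^esub>)"
  shows "g (comb c) = c k"
proof -
  note ck = fin_supp_closed[OF c]
  have "comb (c(k := \<zero>\<^bsub>R\<^esub>)) \<in> {s. g s = \<zero>\<^bsub>R\<^esub>}"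
    by (rule comb_mem) (use ck c in \<open>auto simp: add zero mono fin_supp_upd split: if_splits\<close>)
  thus ?thesis
    using ck[of k] by (simp add: comb_split[OF c, of k] add term_closed comb_closed fin_supp_upd c mono)
qed

lemma span_closed: "s \<in> span K \<Longrightarrow> s \<in> carrier A"
  by (auto simp: span_def comb_closed)

lemma span_zero: "\<zero>\<^bsub>A\<^esub> \<in> span K"
proof -
  have "comb (\<lambda>_. \<zero>\<^bsub>R\<^esub>) = \<zero>\<^bsub>A\<^esub>" by (simp add: lincomb_def)
  moreover have "(\<lambda>_. \<zero>\<^bsub>R\<^esub>) \<in> fin_supp R" by (rule fin_suppI[where K = "{}"]) auto
  ultimately show ?thesis unfolding span_def by (intro image_eqI[where x = "\<lambda>_. \<zero>\<^bsub>R\<^esub>"]) auto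
qed

lemma span_add:
  assumes "s \<in> span K" "t \<in> span K" shows "s \<oplus>\<^bsub>A\<^esub> t \<in> span K"
proof -
  obtain c d where c: "c \<in> fin_supp R" "\<forall>k. c k \<noteq> \<zero>\<^bsub>R\<^esub> \<longrightarrow> k \<in> K" "s = comb c"
    and d: "d \<in> fin_supp R" "\<forall>k. d k \<noteq> \<zero>\<^bsub>R\<^esub> \<longrightarrow> k \<in> K" "t = comb d"
    using assms unfolding span_def by blast
  have "k \<in> K" if "c k \<oplus>\<^bsub>R\<^esub> d k \<noteq> \<zero>\<^bsub>R\<^esub>" for k
    using that c(2) d(2) fin_supp_closed[OF d(1)] by (cases "c k = \<zero>\<^bsub>R\<^esub>") auto
  thus ?thesis unfolding span_def using c d comb_add fin_supp_add
    by (intro image_eqI[where x = "\<lambda>k. c k \<oplus>\<^bsub>R\<^esub> d k"]) auto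
qed

lemma span_single:
  assumes "a \<in> carrier R" "k \<in> K" shows "\<phi> a \<otimes>\<^bsub>A\<^esub> b k \<in> span K"
  unfolding span_def using assms fin_supp_single comb_single
  by (intro image_eqI[where x = "\<lambda>j. if j = k then a else \<zero>\<^bsub>R\<^esub>"]) auto

lemma span_induct [consumes 1, case_names zero add monomial]:
  assumes "s \<in> span K" "P \<zero>\<^bsub>A\<^esub>"
    and "\<And>s t. s \<in> carrier A \<Longrightarrow> t \<in> carrier A \<Longrightarrow> P s \<Longrightarrow> P t \<Longrightarrow> P (s \<oplus>\<^bsub>A\<^esub> t)"
    and "\<And>a k. a \<in> carrier R \<Longrightarrow> k \<in> K \<Longrightarrow> P (\<phi> a \<otimes>\<^bsub>A\<^esub> b k)"
  shows "P s"
proof -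
  obtain c where c: "c \<in> fin_supp R" "\<forall>k. c k \<noteq> \<zero>\<^bsub>R\<^esub> \<longrightarrow> k \<in> K" "s = comb c"
    using assms(1) unfolding span_def by blast
  have "comb c \<in> Collect P"
    by (rule comb_mem) (use c assms(2-) fin_supp_closed[OF c(1)] in auto)
  thus ?thesis using c by simp
qed

lemma span_scal:
  assumes "a \<in> carrier R" "s \<in> span K" shows "\<phi> a \<otimes>\<^bsub>A\<^esub> s \<in> span K"
  using assms(2)
proof (induction rule: span_induct)
  case (monomial a' k)
  have "\<phi> a \<otimes>\<^bsub>A\<^esub> (\<phi> a' \<otimes>\<^bsub>A\<^esub> b k) = \<phi> (a \<otimes>\<^bsub>R\<^esub> a') \<otimes>\<^bsub>A\<^esub> b k"
    using assms(1) monomial b_closed by (simp add: S.m_assoc)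
  thus ?case using span_single[of "a \<otimes>\<^bsub>R\<^esub> a'" k] assms(1) monomial by simp
qed (use assms in \<open>auto simp: span_zero S.r_distr span_add\<close>)

lemma span_minus:
  assumes "s \<in> span K" shows "\<ominus>\<^bsub>A\<^esub> s \<in> span K"
proof -
  have "\<ominus>\<^bsub>A\<^esub> s = \<phi> (\<ominus>\<^bsub>R\<^esub> \<one>\<^bsub>R\<^esub>) \<otimes>\<^bsub>A\<^esub> s"
    using span_closed[OF assms] by (simp add: S.l_minus)
  thus ?thesis using span_scal[OF R.a_inv_closed[OF R.one_closed] assms] by (simp only:)
qed

lemma span_additive_subgroup: "additive_subgroup (span K) A"
proof (intro additive_subgroup.intro S.add.subgroupI)
  show "span K \<noteq> {}" using span_zero by blast
qed (auto simp: span_closed span_add span_minus)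

end

text \<open>The family \<open>b\<close> is a basis of \<open>A\<close> as a left \<open>R\<close>-module.  The index type is left open since the
  powers of one variable and the words in several variables both occur.\<close>

locale left_basis = combinations R A \<phi> b
  for R :: "('a, 'm) ring_scheme" and A :: "('b, 'n) ring_scheme" and \<phi> :: "'a \<Rightarrow> 'b" and b :: "'k \<Rightarrow> 'b" +
  assumes basis: "s \<in> carrier A \<Longrightarrow> \<exists>!c. c \<in> fin_supp R \<and> s = comb c"
begin

definition coord :: "'b \<Rightarrow> 'k \<Rightarrow> 'a" where
  "coord s = (THE c. c \<in> fin_supp R \<and> s = comb c)"

lemma coord_fin_supp: "s \<in> carrier A \<Longrightarrow> coord s \<in> fin_supp R"
  and comb_coord: "s \<in> carrier A \<Longrightarrow> comb (coord s) = s"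
  using theI'[OF basis] unfolding coord_def by auto

lemma coord_closed: "s \<in> carrier A \<Longrightarrow> coord s k \<in> carrier R"
  by (rule fin_supp_closed[OF coord_fin_supp])

lemma coord_comb: "c \<in> fin_supp R \<Longrightarrow> coord (comb c) = c"
  using basis[OF comb_closed[of c]] coord_fin_supp[OF comb_closed[of c]] comb_coord[OF comb_closed[of c]]
  by metis

lemma span_UNIV: "span UNIV = carrier A"
proof
  show "carrier A \<subseteq> span UNIV"
  proof
    fix s assume "s \<in> carrier A"
    thus "s \<in> span UNIV" unfolding span_def
      by (intro image_eqI[where x = "coord s"]) (auto simp: comb_coord coord_fin_supp)
  qed
qed (auto simp: span_closed)

lemma coord_add:
  assumes "s \<in> carrier A" "t \<in> carrier A"
  shows "coord (s \<oplus>\<^bsub>A\<^esub> t) = (\<lambda>k. coord s k \<oplus>\<^bsub>R\<^esub> coord t k)"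
proof -
  have "comb (\<lambda>k. coord s k \<oplus>\<^bsub>R\<^esub> coord t k) = s \<oplus>\<^bsub>A\<^esub> t"
    using assms by (simp add: comb_add coord_fin_supp comb_coord)
  thus ?thesis
    using coord_comb[OF fin_supp_add[OF coord_fin_supp[OF assms(1)] coord_fin_supp[OF assms(2)]]] by simp
qed

lemma coord_scal:
  assumes "a \<in> carrier R" "s \<in> carrier A"
  shows "coord (\<phi> a \<otimes>\<^bsub>A\<^esub> s) = (\<lambda>k. a \<otimes>\<^bsub>R\<^esub> coord s k)"
  using coord_comb[OF fin_supp_scal[OF assms(1) coord_fin_supp[OF assms(2)]]]
    comb_scal[OF assms(1) coord_fin_supp[OF assms(2)]] comb_coord[OF assms(2)] by simp

lemma coord_monomial:
  "a \<in> carrier R \<Longrightarrow> coord (\<phi> a \<otimes>\<^bsub>A\<^esub> b k) = (\<lambda>j. if j = k then a else \<zero>\<^bsub>R\<^esub>)"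
  using coord_comb[OF fin_supp_single] comb_single by metis

lemma coord_span:
  assumes "s \<in> span K" "k \<notin> K" shows "coord s k = \<zero>\<^bsub>R\<^esub>"
  using assms by (auto simp: span_def coord_comb)

lemma coord_zero: "coord \<zero>\<^bsub>A\<^esub> = (\<lambda>_. \<zero>\<^bsub>R\<^esub>)"
  using coord_span[OF span_zero[of "{}"]] by auto

end

section \<open>The universal property of Ore extensions\<close>

lemma ore_extension_left_basis:
  fixes T :: "('b, 'n) ring_scheme"
  assumes R: "ring R" and T: "ore_extension R \<tau> \<delta> T \<iota> x"
  shows "left_basis R T \<iota> (\<lambda>n::nat. x [^]\<^bsub>T\<^esub> n)"
proof -
  have rT: "ring T" and \<iota>: "\<iota> \<in> ring_hom R T" and x: "x \<in> carrier T"
    using T by (auto simp: ore_extension_def)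
  interpret \<iota>: ring_hom_ring R T \<iota> using R rT \<iota> by (rule ring_hom_ringI2)
  show ?thesis
  proof unfold_locales
    show "\<exists>!c. c \<in> fin_supp R \<and> s = lincomb R T \<iota> ((([^]\<^bsub>T\<^esub>) :: 'b \<Rightarrow> nat \<Rightarrow> 'b) x) c"
      if "s \<in> carrier T" for s
      using T that unfolding ore_extension_def fin_supp_def lincomb_def by simp
  qed (use x in auto)
qed

text \<open>The homomorphism can only be \<open>\<Sum> c\<^sub>n x\<^sup>n \<mapsto> \<Sum> \<phi>(c\<^sub>n) z\<^sup>n\<close>, which is well defined and additive as
  the powers of \<open>x\<close> form a basis.  It commutes with left multiplication by scalars, and by \<open>x\<close> because
  \<open>x\<close> and \<open>z\<close> satisfy the same commutation rule; as scalars and \<open>x\<close> generate the Ore extension, it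
  is multiplicative.\<close>

theorem ore_extension_universal:
  fixes R :: "('a, 'm) ring_scheme" and T :: "('b, 'n) ring_scheme" and A :: "('c, 'k) ring_scheme"
  assumes R: "ring R" and \<tau>: "\<tau> \<in> ring_hom R R" and \<delta>: "left_skew_derivation R \<tau> \<delta>"
    and T: "ore_extension R \<tau> \<delta> T \<iota> x"
    and A: "ring A" and \<phi>: "\<phi> \<in> ring_hom R A" and z: "z \<in> carrier A"
    and comm: "\<And>r. r \<in> carrier R \<Longrightarrow>
      z \<otimes>\<^bsub>A\<^esub> \<phi> r = \<phi> (\<tau> r) \<otimes>\<^bsub>A\<^esub> z \<oplus>\<^bsub>A\<^esub> \<phi> (\<delta> r)"
  obtains h where "h \<in> ring_hom T A" "\<And>r. r \<in> carrier R \<Longrightarrow> h (\<iota> r) = \<phi> r" "h x = z"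
proof -
  have rT: "ring T" and \<iota>: "\<iota> \<in> ring_hom R T" and x: "x \<in> carrier T"
    and xcomm: "\<And>r. r \<in> carrier R \<Longrightarrow>
      x \<otimes>\<^bsub>T\<^esub> \<iota> r = \<iota> (\<tau> r) \<otimes>\<^bsub>T\<^esub> x \<oplus>\<^bsub>T\<^esub> \<iota> (\<delta> r)"
    using T by (auto simp: ore_extension_def)
  interpret \<phi>: ring_hom_ring R A \<phi> using R A \<phi> by (rule ring_hom_ringI2)
  interpret \<iota>: ring_hom_ring R T \<iota> using R rT \<iota> by (rule ring_hom_ringI2)
  interpret \<tau>: ring_hom_ring R R \<tau> using R R \<tau> by (rule ring_hom_ringI2)
  note \<delta>c = delta_closed[OF R \<tau> \<delta>]
  interpret B: combinations R A \<phi> "\<lambda>n::nat. z [^]\<^bsub>A\<^esub> n"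
    by unfold_locales (use z in auto)
  interpret T: left_basis R T \<iota> "\<lambda>n::nat. x [^]\<^bsub>T\<^esub> n"
    by (rule ore_extension_left_basis[OF R T])
  define h where "h s = B.comb (T.coord s)" for s
  have hc: "h s \<in> carrier A" if "s \<in> carrier T" for s
    using that by (simp add: h_def B.comb_closed T.coord_fin_supp)
  have h_add: "h (s \<oplus>\<^bsub>T\<^esub> t) = h s \<oplus>\<^bsub>A\<^esub> h t" if "s \<in> carrier T" "t \<in> carrier T" for s t
    using that by (simp add: h_def T.coord_add B.comb_add T.coord_fin_supp)
  have h_scal: "h (\<iota> a \<otimes>\<^bsub>T\<^esub> s) = \<phi> a \<otimes>\<^bsub>A\<^esub> h s" if "a \<in> carrier R" "s \<in> carrier T" for a s
    using that by (simp add: h_def T.coord_scal B.comb_scal T.coord_fin_supp)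
  have h_pow: "h (x [^]\<^bsub>T\<^esub> n) = z [^]\<^bsub>A\<^esub> n" for n :: nat
    using T.coord_monomial[OF \<phi>.R.one_closed, of n] B.comb_single[OF \<phi>.R.one_closed, of n] x z
    by (simp add: h_def)
  have h_zero: "h \<zero>\<^bsub>T\<^esub> = \<zero>\<^bsub>A\<^esub>"
    using h_add[of "\<zero>\<^bsub>T\<^esub>" "\<zero>\<^bsub>T\<^esub>"] hc[of "\<zero>\<^bsub>T\<^esub>"] by (metis \<iota>.S.zero_closed \<iota>.S.l_zero \<phi>.S.add.r_cancel_one)
  have h_x: "h (x \<otimes>\<^bsub>T\<^esub> s) = z \<otimes>\<^bsub>A\<^esub> h s" if "s \<in> carrier T" for s
    using that unfolding T.span_UNIV[symmetric]
  proof (induction rule: T.span_induct)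
    case (monomial a n)
    note cl = \<open>a \<in> carrier R\<close> x z \<delta>c[OF \<open>a \<in> carrier R\<close>]
    have "x \<otimes>\<^bsub>T\<^esub> (\<iota> a \<otimes>\<^bsub>T\<^esub> x [^]\<^bsub>T\<^esub> n)
        = \<iota> (\<tau> a) \<otimes>\<^bsub>T\<^esub> x [^]\<^bsub>T\<^esub> Suc n \<oplus>\<^bsub>T\<^esub> \<iota> (\<delta> a) \<otimes>\<^bsub>T\<^esub> x [^]\<^bsub>T\<^esub> n"
      unfolding \<iota>.S.nat_pow_Suc2[OF x]
      using cl by (simp add: \<iota>.S.m_assoc[symmetric] xcomm \<iota>.S.l_distr)
    hence "h (x \<otimes>\<^bsub>T\<^esub> (\<iota> a \<otimes>\<^bsub>T\<^esub> x [^]\<^bsub>T\<^esub> n))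
        = \<phi> (\<tau> a) \<otimes>\<^bsub>A\<^esub> z [^]\<^bsub>A\<^esub> Suc n \<oplus>\<^bsub>A\<^esub> \<phi> (\<delta> a) \<otimes>\<^bsub>A\<^esub> z [^]\<^bsub>A\<^esub> n"
      using cl by (simp add: h_add h_scal h_pow del: nat_pow_Suc \<iota>.S.nat_pow_Suc \<phi>.S.nat_pow_Suc)
    also have "\<dots> = z \<otimes>\<^bsub>A\<^esub> (\<phi> a \<otimes>\<^bsub>A\<^esub> z [^]\<^bsub>A\<^esub> n)"
      unfolding \<phi>.S.nat_pow_Suc2[OF z]
      using cl by (simp add: \<phi>.S.m_assoc[symmetric] comm \<phi>.S.l_distr)
    finally show ?case using cl by (simp add: h_scal h_pow)
  qed (use x z in \<open>auto simp: h_zero h_add hc \<iota>.S.r_distr \<phi>.S.r_distr\<close>)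
  have h_xn: "h (x [^]\<^bsub>T\<^esub> n \<otimes>\<^bsub>T\<^esub> s) = z [^]\<^bsub>A\<^esub> n \<otimes>\<^bsub>A\<^esub> h s" if "s \<in> carrier T" for s and n :: nat
  proof (induction n)
    case 0
    show ?case using that hc by simp
  next
    case (Suc n)
    thus ?case
      unfolding \<iota>.S.nat_pow_Suc2[OF x] \<phi>.S.nat_pow_Suc2[OF z]
      using that x z hc by (simp add: \<iota>.S.m_assoc \<phi>.S.m_assoc h_x)
  qed
  have h_mult: "h (p \<otimes>\<^bsub>T\<^esub> s) = h p \<otimes>\<^bsub>A\<^esub> h s" if "p \<in> carrier T" "s \<in> carrier T" for p s
    using that(1) unfolding T.span_UNIV[symmetric]
  proof (induction rule: T.span_induct)
    case (monomial a n)
    thus ?case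
      using that(2) x z hc by (simp add: \<iota>.S.m_assoc \<phi>.S.m_assoc h_scal h_xn h_pow)
  qed (use that(2) x z in \<open>auto simp: h_zero h_add hc \<iota>.S.l_distr \<phi>.S.l_distr\<close>)
  have h_base: "h (\<iota> r) = \<phi> r" if "r \<in> carrier R" for r
    using h_scal[OF that \<iota>.S.one_closed] h_pow[of 0] that by simp
  show thesis
  proof (rule that)
    show "h \<in> ring_hom T A"
      using h_pow[of 0] by (intro ring_hom_memI) (simp_all add: hc h_add h_mult)
    show "h x = z" using h_pow[of 1] x z by simp
  qed (rule h_base)
qed

text \<open>In order to stay in \<open>K\<close> under the image of an Ore extension it suffices to stay in \<open>K\<close> under
  the images of the scalars and of the variable.\<close>

lemma ore_extension_stable:
  assumes R: "ring R" and T: "ore_extension R \<tau> \<delta> T \<iota> x"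
    and A: "ring A" and f: "f \<in> ring_hom T A"
    and K: "K \<subseteq> carrier A" "\<zero>\<^bsub>A\<^esub> \<in> K"
    and add: "\<And>s t. s \<in> K \<Longrightarrow> t \<in> K \<Longrightarrow> s \<oplus>\<^bsub>A\<^esub> t \<in> K"
    and scal: "\<And>r s. r \<in> carrier R \<Longrightarrow> s \<in> K \<Longrightarrow> f (\<iota> r) \<otimes>\<^bsub>A\<^esub> s \<in> K"
    and var: "\<And>s. s \<in> K \<Longrightarrow> f x \<otimes>\<^bsub>A\<^esub> s \<in> K"
    and t: "t \<in> carrier T" and s: "s \<in> K"
  shows "f t \<otimes>\<^bsub>A\<^esub> s \<in> K"
proof -
  interpret T: left_basis R T \<iota> "\<lambda>n::nat. x [^]\<^bsub>T\<^esub> n"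
    by (rule ore_extension_left_basis[OF R T])
  interpret f: ring_hom_ring T A f using T.S.ring_axioms A f by (rule ring_hom_ringI2)
  have x: "x \<in> carrier T" using T by (simp add: ore_extension_def)
  have sK: "s \<in> carrier A" using s K(1) by blast
  have pow: "f (x [^]\<^bsub>T\<^esub> n) \<otimes>\<^bsub>A\<^esub> s \<in> K" for n :: nat
  proof (induction n)
    case 0
    show ?case using s sK by simp
  next
    case (Suc n)
    have "f (x [^]\<^bsub>T\<^esub> Suc n) \<otimes>\<^bsub>A\<^esub> s = f x \<otimes>\<^bsub>A\<^esub> (f (x [^]\<^bsub>T\<^esub> n) \<otimes>\<^bsub>A\<^esub> s)"
      unfolding T.S.nat_pow_Suc2[OF x] using x sK by (simp add: f.S.m_assoc)
    thus ?case using var[OF Suc] by simp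
  qed
  show ?thesis
    using t unfolding T.span_UNIV[symmetric]
  proof (induction rule: T.span_induct)
    case (monomial a n)
    thus ?case using scal[OF _ pow[of n], of a] x sK by (simp add: f.S.m_assoc)
  qed (use K(2) add sK in \<open>auto simp: f.S.l_distr\<close>)
qed

section \<open>Words in several skew variables\<close>

text \<open>The commutation rules of Ore extensions, for a family of variables at once.  They suffice to
  write every product of scalars and variables as a left linear combination of words.\<close>

locale skew_variables = ring_hom_ring R A \<phi>
  for R :: "('a, 'm) ring_scheme" and A :: "('b, 'n) ring_scheme" and \<phi> :: "'a \<Rightarrow> 'b" +
  fixes \<tau> \<delta> :: "'i \<Rightarrow> 'a \<Rightarrow> 'a" and z :: "'i \<Rightarrow> 'b"
  assumes tau_hom: "\<tau> i \<in> ring_hom R R"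
    and delta_skew: "left_skew_derivation R (\<tau> i) (\<delta> i)"
    and z_closed: "z i \<in> carrier A"
    and z_comm: "r \<in> carrier R \<Longrightarrow>
      z i \<otimes>\<^bsub>A\<^esub> \<phi> r = \<phi> (\<tau> i r) \<otimes>\<^bsub>A\<^esub> z i \<oplus>\<^bsub>A\<^esub> \<phi> (\<delta> i r)"
begin

definition word :: "'i list \<Rightarrow> 'b" where
  "word w = foldr (\<lambda>i t. z i \<otimes>\<^bsub>A\<^esub> t) w \<one>\<^bsub>A\<^esub>"

lemma word_Nil: "word [] = \<one>\<^bsub>A\<^esub>" and word_Cons: "word (i # w) = z i \<otimes>\<^bsub>A\<^esub> word w"
  by (simp_all add: word_def)

lemma word_closed: "word w \<in> carrier A"
  by (induction w) (simp_all add: word_Nil word_Cons z_closed)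

sublocale combinations R A \<phi> word
  by unfold_locales (rule word_closed)

lemma word_append: "word (u @ v) = word u \<otimes>\<^bsub>A\<^esub> word v"
  by (induction u) (simp_all add: word_Nil word_Cons word_closed z_closed S.m_assoc)

lemma tau_closed: "r \<in> carrier R \<Longrightarrow> \<tau> i r \<in> carrier R"
  by (rule ring_hom_closed[OF tau_hom])

lemma delta_closed: "r \<in> carrier R \<Longrightarrow> \<delta> i r \<in> carrier R"
  by (rule Defs.delta_closed[OF R.ring_axioms tau_hom delta_skew])

lemma z_monomial:
  assumes "a \<in> carrier R"
  shows "z i \<otimes>\<^bsub>A\<^esub> (\<phi> a \<otimes>\<^bsub>A\<^esub> word w)
       = \<phi> (\<tau> i a) \<otimes>\<^bsub>A\<^esub> word (i # w) \<oplus>\<^bsub>A\<^esub> \<phi> (\<delta> i a) \<otimes>\<^bsub>A\<^esub> word w"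
  using assms tau_closed[OF assms] delta_closed[OF assms] z_closed word_closed
  by (simp add: S.m_assoc[symmetric] z_comm S.l_distr word_Cons)

lemma z_span:
  assumes "s \<in> span W" "W \<subseteq> V" "\<And>w. w \<in> W \<Longrightarrow> i # w \<in> V"
  shows "z i \<otimes>\<^bsub>A\<^esub> s \<in> span V"
  using assms(1)
proof (induction rule: span_induct)
  case (monomial a w)
  show ?case
    unfolding z_monomial[OF monomial(1)] using assms(2,3) monomial
    by (intro span_add span_single) (auto simp: tau_closed delta_closed)
qed (use z_closed in \<open>auto simp: S.r_distr span_zero span_add\<close>)

abbreviation short :: "nat \<Rightarrow> 'b set" where "short m \<equiv> span {w. length w < m}"

abbreviation twist :: "'i list \<Rightarrow> 'a \<Rightarrow> 'a" where "twist u \<equiv> foldr \<tau> u"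

lemma twist_closed: "r \<in> carrier R \<Longrightarrow> twist u r \<in> carrier R"
  by (induction u) (simp_all add: tau_closed)

text \<open>Each application of a commutation rule either twists the scalar or applies a derivation to it,
  and in the latter case the letter disappears; so all further terms belong to shorter words.\<close>

lemma word_scalar:
  assumes "r \<in> carrier R"
  shows "\<exists>l\<in>short (length u). word u \<otimes>\<^bsub>A\<^esub> \<phi> r = \<phi> (twist u r) \<otimes>\<^bsub>A\<^esub> word u \<oplus>\<^bsub>A\<^esub> l"
proof (induction u)
  case Nil
  show ?case using assms span_zero by (intro bexI[where x = "\<zero>\<^bsub>A\<^esub>"]) (simp_all add: word_Nil)
next
  case (Cons i u)
  then obtain l where l: "l \<in> short (length u)"
    and eq: "word u \<otimes>\<^bsub>A\<^esub> \<phi> r = \<phi> (twist u r) \<otimes>\<^bsub>A\<^esub> word u \<oplus>\<^bsub>A\<^esub> l" by blast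
  note cl = z_closed[of i] word_closed[of u] twist_closed[OF assms, of u] span_closed[OF l]
  let ?l = "\<phi> (\<delta> i (twist u r)) \<otimes>\<^bsub>A\<^esub> word u \<oplus>\<^bsub>A\<^esub> z i \<otimes>\<^bsub>A\<^esub> l"
  have "word (i # u) \<otimes>\<^bsub>A\<^esub> \<phi> r = z i \<otimes>\<^bsub>A\<^esub> (\<phi> (twist u r) \<otimes>\<^bsub>A\<^esub> word u) \<oplus>\<^bsub>A\<^esub> z i \<otimes>\<^bsub>A\<^esub> l"
    using cl assms by (simp add: word_Cons S.m_assoc eq S.r_distr)
  also have "\<dots> = \<phi> (twist (i # u) r) \<otimes>\<^bsub>A\<^esub> word (i # u) \<oplus>\<^bsub>A\<^esub> ?l"
    using cl word_closed tau_closed[OF cl(3)] delta_closed[OF cl(3)]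
    by (simp add: z_monomial S.a_assoc)
  moreover have "?l \<in> short (length (i # u))"
    using delta_closed[OF cl(3)] l by (intro span_add span_single z_span[OF l]) auto
  ultimately show ?case by (intro bexI[where x = ?l]) simp_all
qed

lemma short_word:
  assumes "s \<in> short m" shows "s \<otimes>\<^bsub>A\<^esub> word v \<in> short (m + length v)"
  using assms
proof (induction rule: span_induct)
  case (monomial a w)
  have "\<phi> a \<otimes>\<^bsub>A\<^esub> word w \<otimes>\<^bsub>A\<^esub> word v = \<phi> a \<otimes>\<^bsub>A\<^esub> word (w @ v)"
    using monomial(1) word_closed by (simp add: word_append S.m_assoc)
  moreover have "\<phi> a \<otimes>\<^bsub>A\<^esub> word (w @ v) \<in> short (m + length v)"
    using monomial by (intro span_single) auto
  ultimately show ?case by simp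
qed (use word_closed in \<open>auto simp: S.l_distr span_zero span_add\<close>)

lemma monomial_mult:
  assumes "a \<in> carrier R" "r \<in> carrier R"
  shows "\<exists>l\<in>short (length u + length v). \<phi> a \<otimes>\<^bsub>A\<^esub> word u \<otimes>\<^bsub>A\<^esub> (\<phi> r \<otimes>\<^bsub>A\<^esub> word v)
    = \<phi> (a \<otimes>\<^bsub>R\<^esub> twist u r) \<otimes>\<^bsub>A\<^esub> word (u @ v) \<oplus>\<^bsub>A\<^esub> l"
proof -
  obtain l where l: "l \<in> short (length u)"
    and eq: "word u \<otimes>\<^bsub>A\<^esub> \<phi> r = \<phi> (twist u r) \<otimes>\<^bsub>A\<^esub> word u \<oplus>\<^bsub>A\<^esub> l"
    using word_scalar[OF assms(2)] by blast
  note cl = word_closed[of u] word_closed[of v] twist_closed[OF assms(2), of u] span_closed[OF l]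
  have "\<phi> a \<otimes>\<^bsub>A\<^esub> word u \<otimes>\<^bsub>A\<^esub> (\<phi> r \<otimes>\<^bsub>A\<^esub> word v) = \<phi> a \<otimes>\<^bsub>A\<^esub> ((word u \<otimes>\<^bsub>A\<^esub> \<phi> r) \<otimes>\<^bsub>A\<^esub> word v)"
    using cl assms by (simp add: S.m_assoc)
  also have "\<dots> = \<phi> (a \<otimes>\<^bsub>R\<^esub> twist u r) \<otimes>\<^bsub>A\<^esub> word (u @ v) \<oplus>\<^bsub>A\<^esub> \<phi> a \<otimes>\<^bsub>A\<^esub> (l \<otimes>\<^bsub>A\<^esub> word v)"
    unfolding eq using cl assms by (simp add: S.m_assoc S.l_distr S.r_distr word_append)
  finally show ?thesis using span_scal[OF assms(1) short_word[OF l]] by blast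
qed

end

locale free_skew_variables = skew_variables +
  assumes word_basis: "s \<in> carrier A \<Longrightarrow> \<exists>!c. c \<in> fin_supp R \<and> s = comb c"
begin

sublocale left_basis R A \<phi> word
  by unfold_locales (rule word_basis)

text \<open>For words of at most the given lengths, \<open>u' @ v' = u @ v\<close> forces \<open>u' = u\<close> and \<open>v' = v\<close>; hence
  a product of monomials that are not longer than \<open>u\<close> and \<open>v\<close> involves \<open>u @ v\<close> only if the words
  are \<open>u\<close> and \<open>v\<close> themselves.\<close>

lemma coord_monomial_mult:
  assumes "a \<in> carrier R" "r \<in> carrier R" "length u' \<le> length u" "length v' \<le> length v"
  shows "coord (\<phi> a \<otimes>\<^bsub>A\<^esub> word u' \<otimes>\<^bsub>A\<^esub> (\<phi> r \<otimes>\<^bsub>A\<^esub> word v')) (u @ v)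
    = (if u' = u \<and> v' = v then a \<otimes>\<^bsub>R\<^esub> twist u r else \<zero>\<^bsub>R\<^esub>)"
proof -
  obtain l where l: "l \<in> short (length u' + length v')"
    and eq: "\<phi> a \<otimes>\<^bsub>A\<^esub> word u' \<otimes>\<^bsub>A\<^esub> (\<phi> r \<otimes>\<^bsub>A\<^esub> word v')
      = \<phi> (a \<otimes>\<^bsub>R\<^esub> twist u' r) \<otimes>\<^bsub>A\<^esub> word (u' @ v') \<oplus>\<^bsub>A\<^esub> l"
    using monomial_mult[OF assms(1,2)] by blast
  have 1: "coord l (u @ v) = \<zero>\<^bsub>R\<^esub>" by (rule coord_span[OF l]) (use assms in auto)
  have 2: "u @ v = u' @ v' \<longleftrightarrow> u' = u \<and> v' = v"
  proof
    assume e: "u @ v = u' @ v'"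
    hence "length u + length v = length u' + length v'" by (metis length_append)
    hence "length u = length u'" using assms by simp
    thus "u' = u \<and> v' = v" using e by auto
  qed auto
  have m: "a \<otimes>\<^bsub>R\<^esub> twist u' r \<in> carrier R" using assms twist_closed by simp
  show ?thesis
    unfolding eq coord_add[OF term_closed[OF m] span_closed[OF l]] coord_monomial[OF m] 1 2
    using m by (cases "u' = u \<and> v' = v") auto
qed

text \<open>By bilinearity only the product of the terms at \<open>u\<close> and \<open>v\<close> contributes to the coordinate at
  \<open>u @ v\<close>; the proof removes all other terms, first from \<open>f\<close> and then from \<open>g\<close>.\<close>

lemma top_coordinate:
  assumes f: "f \<in> carrier A" "\<And>w. coord f w \<noteq> \<zero>\<^bsub>R\<^esub> \<Longrightarrow> length w \<le> length u"
    and g: "g \<in> carrier A" "\<And>w. coord g w \<noteq> \<zero>\<^bsub>R\<^esub> \<Longrightarrow> length w \<le> length v"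
    and r: "r \<in> carrier R"
  shows "coord (f \<otimes>\<^bsub>A\<^esub> (\<phi> r \<otimes>\<^bsub>A\<^esub> g)) (u @ v)
    = coord f u \<otimes>\<^bsub>R\<^esub> twist u (r \<otimes>\<^bsub>R\<^esub> coord g v)"
proof -
  let ?P = "\<lambda>s. coord s (u @ v)"
  note cf = coord_closed[OF f(1)] and cg = coord_closed[OF g(1)]
  have P_add: "?P (s \<oplus>\<^bsub>A\<^esub> t) = ?P s \<oplus>\<^bsub>R\<^esub> ?P t" if "s \<in> carrier A" "t \<in> carrier A" for s t
    using coord_add[OF that] by simp
  note upd = fin_supp_upd[OF coord_fin_supp[OF f(1)] R.zero_closed]
    fin_supp_upd[OF coord_fin_supp[OF g(1)] R.zero_closed]
  have rm: "\<phi> r \<otimes>\<^bsub>A\<^esub> (\<phi> d \<otimes>\<^bsub>A\<^esub> word w) = \<phi> (r \<otimes>\<^bsub>R\<^esub> d) \<otimes>\<^bsub>A\<^esub> word w" if "d \<in> carrier R" for d w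
    using that r word_closed by (simp add: S.m_assoc)
  let ?f = "comb ((coord f)(u := \<zero>\<^bsub>R\<^esub>))" and ?g = "comb ((coord g)(v := \<zero>\<^bsub>R\<^esub>))"
  have fg: "?f \<in> carrier A" "?g \<in> carrier A" using upd by (simp_all add: comb_closed)
  have other_left: "?P (\<phi> (coord f u') \<otimes>\<^bsub>A\<^esub> word u' \<otimes>\<^bsub>A\<^esub> (\<phi> r \<otimes>\<^bsub>A\<^esub> g)) = \<zero>\<^bsub>R\<^esub>"
    if u': "coord f u' \<noteq> \<zero>\<^bsub>R\<^esub>" "u' \<noteq> u" for u'
  proof -
    note cl = term_closed[OF cf, of u' u']
    have "comb (coord g) \<in> {s. ?P (\<phi> (coord f u') \<otimes>\<^bsub>A\<^esub> word u' \<otimes>\<^bsub>A\<^esub> (\<phi> r \<otimes>\<^bsub>A\<^esub> s)) = \<zero>\<^bsub>R\<^esub>}"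
      by (rule comb_mem[OF coord_fin_supp[OF g(1)]])
        (use cl r u' f(2) g(2) cf cg in
          \<open>auto simp: P_add S.r_distr coord_zero rm coord_monomial_mult simp del: hom_mult\<close>)
    thus ?thesis using comb_coord[OF g(1)] by simp
  qed
  have left: "?P (?f \<otimes>\<^bsub>A\<^esub> (\<phi> r \<otimes>\<^bsub>A\<^esub> g)) = \<zero>\<^bsub>R\<^esub>"
  proof -
    have "?f \<in> {s. ?P (s \<otimes>\<^bsub>A\<^esub> (\<phi> r \<otimes>\<^bsub>A\<^esub> g)) = \<zero>\<^bsub>R\<^esub>}"
      by (rule comb_mem[OF upd(1)])
        (use r g(1) other_left in \<open>auto simp: P_add S.l_distr coord_zero split: if_splits\<close>)
    thus ?thesis by simp
  qed
  have right: "?P (\<phi> (coord f u) \<otimes>\<^bsub>A\<^esub> word u \<otimes>\<^bsub>A\<^esub> (\<phi> r \<otimes>\<^bsub>A\<^esub> ?g)) = \<zero>\<^bsub>R\<^esub>"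
  proof -
    note cl = term_closed[OF cf, of u u]
    have "?g \<in> {s. ?P (\<phi> (coord f u) \<otimes>\<^bsub>A\<^esub> word u \<otimes>\<^bsub>A\<^esub> (\<phi> r \<otimes>\<^bsub>A\<^esub> s)) = \<zero>\<^bsub>R\<^esub>}"
      by (rule comb_mem[OF upd(2)])
        (use cl r g(2) cf cg in
          \<open>auto simp: P_add S.r_distr coord_zero rm coord_monomial_mult simp del: hom_mult split: if_splits\<close>)
    thus ?thesis by simp
  qed
  have g_split: "g = \<phi> (coord g v) \<otimes>\<^bsub>A\<^esub> word v \<oplus>\<^bsub>A\<^esub> ?g"
    using comb_split[OF coord_fin_supp[OF g(1)], of v] comb_coord[OF g(1)] by simp
  have f_split: "f = \<phi> (coord f u) \<otimes>\<^bsub>A\<^esub> word u \<oplus>\<^bsub>A\<^esub> ?f"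
    using comb_split[OF coord_fin_supp[OF f(1)], of u] comb_coord[OF f(1)] by simp
  note cl = term_closed[OF cf, of u u] term_closed[OF cg, of v v]
  have "?P (f \<otimes>\<^bsub>A\<^esub> (\<phi> r \<otimes>\<^bsub>A\<^esub> g)) = ?P (\<phi> (coord f u) \<otimes>\<^bsub>A\<^esub> word u \<otimes>\<^bsub>A\<^esub> (\<phi> r \<otimes>\<^bsub>A\<^esub> g)
      \<oplus>\<^bsub>A\<^esub> ?f \<otimes>\<^bsub>A\<^esub> (\<phi> r \<otimes>\<^bsub>A\<^esub> g))"
    using cl fg g(1) r by (subst f_split) (simp add: S.l_distr)
  also have "\<dots> = ?P (\<phi> (coord f u) \<otimes>\<^bsub>A\<^esub> word u \<otimes>\<^bsub>A\<^esub> (\<phi> r \<otimes>\<^bsub>A\<^esub> g))"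
    using cl fg g(1) r left by (simp add: P_add coord_closed)
  also have "\<dots> = ?P (\<phi> (coord f u) \<otimes>\<^bsub>A\<^esub> word u \<otimes>\<^bsub>A\<^esub> (\<phi> r \<otimes>\<^bsub>A\<^esub> (\<phi> (coord g v) \<otimes>\<^bsub>A\<^esub> word v))
      \<oplus>\<^bsub>A\<^esub> \<phi> (coord f u) \<otimes>\<^bsub>A\<^esub> word u \<otimes>\<^bsub>A\<^esub> (\<phi> r \<otimes>\<^bsub>A\<^esub> ?g))"
    using cl fg r by (subst g_split) (simp add: S.r_distr)
  also have "\<dots> = coord f u \<otimes>\<^bsub>R\<^esub> twist u (r \<otimes>\<^bsub>R\<^esub> coord g v)"
    using cl fg r right cf cg twist_closed
    by (simp add: P_add coord_closed word_closed rm coord_monomial_mult del: hom_mult)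
  finally show ?thesis .
qed

lemma top_word:
  assumes "f \<in> carrier A" "f \<noteq> \<zero>\<^bsub>A\<^esub>"
  obtains u where "coord f u \<noteq> \<zero>\<^bsub>R\<^esub>" "\<And>w. coord f w \<noteq> \<zero>\<^bsub>R\<^esub> \<Longrightarrow> length w \<le> length u"
proof -
  let ?W = "{w. coord f w \<noteq> \<zero>\<^bsub>R\<^esub>}"
  have fin: "finite ?W" by (rule fin_supp_finite[OF coord_fin_supp[OF assms(1)]])
  have "?W \<noteq> {}"
  proof
    assume "?W = {}"
    hence "comb (coord f) = \<zero>\<^bsub>A\<^esub>" by (simp add: lincomb_def)
    thus False using assms comb_coord by simp
  qed
  hence "Max (length ` ?W) \<in> length ` ?W" using fin by (intro Max_in) auto
  then obtain u where "u \<in> ?W" "length u = Max (length ` ?W)" by auto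
  thus thesis using fin by (intro that[of u]) auto
qed

text \<open>Choose \<open>u\<close> and \<open>v\<close> of maximal length in \<open>f\<close> and \<open>g\<close>.  Because the twist along \<open>u\<close> is bijective, the
  twisted coefficient of \<open>v\<close> is nonzero, and primeness of \<open>R\<close> provides a scalar \<open>s\<close> between the two
  coefficients that is itself a twisted scalar.\<close>

theorem prime_skew_extension:
  assumes surj: "\<And>i. \<tau> i ` carrier R = carrier R" and inj: "\<And>i. inj_on (\<tau> i) (carrier R)"
    and prime: "\<And>a c. a \<in> carrier R \<Longrightarrow> c \<in> carrier R \<Longrightarrow> a \<noteq> \<zero>\<^bsub>R\<^esub> \<Longrightarrow> c \<noteq> \<zero>\<^bsub>R\<^esub> \<Longrightarrow>
      \<exists>r\<in>carrier R. a \<otimes>\<^bsub>R\<^esub> (r \<otimes>\<^bsub>R\<^esub> c) \<noteq> \<zero>\<^bsub>R\<^esub>"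
    and f: "f \<in> carrier A" "f \<noteq> \<zero>\<^bsub>A\<^esub>" and g: "g \<in> carrier A" "g \<noteq> \<zero>\<^bsub>A\<^esub>"
  shows "\<exists>r\<in>carrier R. f \<otimes>\<^bsub>A\<^esub> (\<phi> r \<otimes>\<^bsub>A\<^esub> g) \<noteq> \<zero>\<^bsub>A\<^esub>"
proof -
  obtain u where u: "coord f u \<noteq> \<zero>\<^bsub>R\<^esub>" "\<And>w. coord f w \<noteq> \<zero>\<^bsub>R\<^esub> \<Longrightarrow> length w \<le> length u"
    using top_word[OF f] by blast
  obtain v where v: "coord g v \<noteq> \<zero>\<^bsub>R\<^esub>" "\<And>w. coord g w \<noteq> \<zero>\<^bsub>R\<^esub> \<Longrightarrow> length w \<le> length v"
    using top_word[OF g] by blast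
  have iso: "twist u ` carrier R = carrier R \<and> twist u \<in> ring_hom R R \<and> inj_on (twist u) (carrier R)"
  proof (induction u)
    case Nil
    show ?case by (auto simp: ring_hom_def)
  next
    case (Cons i u)
    have "\<tau> i \<circ> twist u \<in> ring_hom R R" using Cons by (intro ring_hom_trans[OF _ tau_hom]) auto
    moreover have "inj_on (\<tau> i \<circ> twist u) (carrier R)"
      by (rule comp_inj_on) (use Cons inj in auto)
    moreover have "(\<tau> i \<circ> twist u) ` carrier R = carrier R"
      by (subst image_comp[symmetric]) (use Cons surj[of i] in simp)
    ultimately show ?case by (simp only: foldr.simps)
  qed
  interpret tw: ring_hom_ring R R "twist u"
    using R.ring_axioms R.ring_axioms iso by (intro ring_hom_ringI2) auto
  note cf = coord_closed[OF f(1), of u] and cg = coord_closed[OF g(1), of v]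
  have nz: "twist u (coord g v) \<noteq> \<zero>\<^bsub>R\<^esub>"
    using v(1) iso cg tw.hom_zero by (metis R.zero_closed inj_onD)
  then obtain s where s: "s \<in> carrier R" "coord f u \<otimes>\<^bsub>R\<^esub> (s \<otimes>\<^bsub>R\<^esub> twist u (coord g v)) \<noteq> \<zero>\<^bsub>R\<^esub>"
    using prime[OF cf tw.hom_closed[OF cg] u(1) nz] by blast
  then obtain r where r: "r \<in> carrier R" "s = twist u r" using iso by blast
  have "coord (f \<otimes>\<^bsub>A\<^esub> (\<phi> r \<otimes>\<^bsub>A\<^esub> g)) (u @ v) \<noteq> \<zero>\<^bsub>R\<^esub>"
    using top_coordinate[OF f(1) u(2) g(1) v(2) r(1)] s r cg by simp
  thus ?thesis using r coord_zero by metis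
qed

end

section \<open>Independence of words\<close>

text \<open>The endomorphism ring of the additive group of \<open>M\<close>.  Endomorphisms are extensional, so that
  equality is equality on the carrier.\<close>

definition additive_endos :: "('a, 'm) ring_scheme \<Rightarrow> ('a \<Rightarrow> 'a) ring" where
  "additive_endos M =
     \<lparr>carrier = {f \<in> carrier M \<rightarrow>\<^sub>E carrier M.
        \<forall>a\<in>carrier M. \<forall>b\<in>carrier M. f (a \<oplus>\<^bsub>M\<^esub> b) = f a \<oplus>\<^bsub>M\<^esub> f b},
      mult = compose (carrier M),
      one = (\<lambda>a\<in>carrier M. a),
      zero = (\<lambda>a\<in>carrier M. \<zero>\<^bsub>M\<^esub>),
      add = (\<lambda>f g. \<lambda>a\<in>carrier M. f a \<oplus>\<^bsub>M\<^esub> g a)\<rparr>"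

lemma additive_endos_simps:
  "carrier (additive_endos M) = {f \<in> carrier M \<rightarrow>\<^sub>E carrier M.
     \<forall>a\<in>carrier M. \<forall>b\<in>carrier M. f (a \<oplus>\<^bsub>M\<^esub> b) = f a \<oplus>\<^bsub>M\<^esub> f b}"
  "f \<otimes>\<^bsub>additive_endos M\<^esub> g = compose (carrier M) f g"
  "\<one>\<^bsub>additive_endos M\<^esub> = (\<lambda>a\<in>carrier M. a)"
  "\<zero>\<^bsub>additive_endos M\<^esub> = (\<lambda>a\<in>carrier M. \<zero>\<^bsub>M\<^esub>)"
  "f \<oplus>\<^bsub>additive_endos M\<^esub> g = (\<lambda>a\<in>carrier M. f a \<oplus>\<^bsub>M\<^esub> g a)"
  by (simp_all add: additive_endos_def)

lemma additive_endosI: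
  assumes "\<And>a. a \<in> carrier M \<Longrightarrow> f a \<in> carrier M"
    and "\<And>a b. a \<in> carrier M \<Longrightarrow> b \<in> carrier M \<Longrightarrow> f (a \<oplus>\<^bsub>M\<^esub> b) = f a \<oplus>\<^bsub>M\<^esub> f b"
    and "\<And>a b. a \<in> carrier M \<Longrightarrow> b \<in> carrier M \<Longrightarrow> a \<oplus>\<^bsub>M\<^esub> b \<in> carrier M"
  shows "(\<lambda>a\<in>carrier M. f a) \<in> carrier (additive_endos M)"
  using assms by (simp add: additive_endos_simps)

lemma additive_endos_ring:
  assumes M: "abelian_group M"
  shows "ring (additive_endos M)"
proof -
  interpret abelian_group M by (rule M)
  let ?E = "additive_endos M"
  have endo_eq: "f = g" if "f \<in> carrier ?E" "g \<in> carrier ?E" "\<And>a. a \<in> carrier M \<Longrightarrow> f a = g a" for f g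
    using that by (intro extensionalityI[of f "carrier M" g]) (auto simp: additive_endos_simps PiE_def)
  have app: "f a \<in> carrier M" if "f \<in> carrier ?E" "a \<in> carrier M" for f a
    using that by (auto simp: additive_endos_simps)
  have f_add: "f (a \<oplus>\<^bsub>M\<^esub> b) = f a \<oplus>\<^bsub>M\<^esub> f b"
    if "f \<in> carrier ?E" "a \<in> carrier M" "b \<in> carrier M" for f a b
    using that by (auto simp: additive_endos_simps)
  have add: "f \<oplus>\<^bsub>?E\<^esub> g \<in> carrier ?E" if "f \<in> carrier ?E" "g \<in> carrier ?E" for f g
    unfolding additive_endos_simps(5)
    by (rule additive_endosI) (use that in \<open>auto simp: app f_add a_ac\<close>)
  have mult: "f \<otimes>\<^bsub>?E\<^esub> g \<in> carrier ?E" if "f \<in> carrier ?E" "g \<in> carrier ?E" for f g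
    unfolding additive_endos_simps(2) compose_def
    by (rule additive_endosI) (use that in \<open>auto simp: app f_add\<close>)
  have zero: "\<zero>\<^bsub>?E\<^esub> \<in> carrier ?E" and one: "\<one>\<^bsub>?E\<^esub> \<in> carrier ?E"
    unfolding additive_endos_simps(3,4) by (rule additive_endosI; simp)+
  have eval: "(f \<otimes>\<^bsub>?E\<^esub> g) a = f (g a)" "\<one>\<^bsub>?E\<^esub> a = a" "\<zero>\<^bsub>?E\<^esub> a = \<zero>\<^bsub>M\<^esub>"
    "(f \<oplus>\<^bsub>?E\<^esub> g) a = f a \<oplus>\<^bsub>M\<^esub> g a" if "a \<in> carrier M" for f g a
    using that by (simp_all add: additive_endos_simps compose_def)
  show ?thesis
  proof (rule ringI)
    show "abelian_group ?E"
    proof (rule abelian_groupI)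
      fix f assume f: "f \<in> carrier ?E"
      have n: "(\<lambda>a\<in>carrier M. \<ominus>\<^bsub>M\<^esub> f a) \<in> carrier ?E"
        by (rule additive_endosI) (use f in \<open>auto simp: app f_add minus_add\<close>)
      show "\<exists>g\<in>carrier ?E. g \<oplus>\<^bsub>?E\<^esub> f = \<zero>\<^bsub>?E\<^esub>"
      proof (rule bexI[OF _ n])
        show "(\<lambda>a\<in>carrier M. \<ominus>\<^bsub>M\<^esub> f a) \<oplus>\<^bsub>?E\<^esub> f = \<zero>\<^bsub>?E\<^esub>"
          by (rule endo_eq[OF add[OF n f] zero]) (use f app in \<open>auto simp: eval l_neg\<close>)
      qed
    qed (use add zero in \<open>auto intro!: endo_eq simp: app eval a_ac\<close>)
    show "Group.monoid ?E"
      by (rule monoidI) (use mult one in \<open>auto intro!: endo_eq simp: app eval\<close>)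
  qed (use mult add in \<open>auto intro!: endo_eq simp: app eval f_add\<close>)
qed

text \<open>The product ring \<open>R\<^sup>K\<close>, of which the additive group is used as a module.\<close>

definition function_ring :: "('a, 'm) ring_scheme \<Rightarrow> ('k \<Rightarrow> 'a) ring" where
  "function_ring R =
     \<lparr>carrier = {p. \<forall>k. p k \<in> carrier R},
      mult = (\<lambda>p q k. p k \<otimes>\<^bsub>R\<^esub> q k), one = (\<lambda>k. \<one>\<^bsub>R\<^esub>),
      zero = (\<lambda>k. \<zero>\<^bsub>R\<^esub>), add = (\<lambda>p q k. p k \<oplus>\<^bsub>R\<^esub> q k)\<rparr>"

lemma function_ring_simps:
  "p \<in> carrier (function_ring R) \<longleftrightarrow> (\<forall>k. p k \<in> carrier R)"
  "\<zero>\<^bsub>function_ring R\<^esub> = (\<lambda>k. \<zero>\<^bsub>R\<^esub>)"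
  "p \<oplus>\<^bsub>function_ring R\<^esub> q = (\<lambda>k. p k \<oplus>\<^bsub>R\<^esub> q k)"
  by (simp_all add: function_ring_def)

lemma function_ring_abelian_group:
  assumes "ring R" shows "abelian_group (function_ring R)"
proof -
  interpret ring R by (rule assms)
  show ?thesis
  proof (rule abelian_groupI)
    show "\<exists>q\<in>carrier (function_ring R). q \<oplus>\<^bsub>function_ring R\<^esub> p = \<zero>\<^bsub>function_ring R\<^esub>"
      if "p \<in> carrier (function_ring R)" for p
      using that by (intro bexI[where x = "\<lambda>k. \<ominus>\<^bsub>R\<^esub> p k"]) (auto simp: function_ring_simps l_neg)
  qed (auto simp: function_ring_simps a_ac)
qed

text \<open>Left multiplication by the letter \<open>i\<close> on families of coefficients: if \<open>p\<close> stands for the formal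
  sum of the \<open>p(w) w\<close>, the result stands for the sum of the \<open>\<tau>\<^sub>i(p(w)) i w + \<delta>\<^sub>i(p(w)) w\<close>.  It
  makes sense for infinite families too, and so the operators act on all functions of words.\<close>

definition letter_action ::
  "('a, 'm) ring_scheme \<Rightarrow> ('i \<Rightarrow> 'a \<Rightarrow> 'a) \<Rightarrow> ('i \<Rightarrow> 'a \<Rightarrow> 'a) \<Rightarrow> 'i \<Rightarrow> ('i list \<Rightarrow> 'a) \<Rightarrow> 'i list \<Rightarrow> 'a" where
  "letter_action R \<tau> \<delta> i p =
     (\<lambda>w. (case w of [] \<Rightarrow> \<zero>\<^bsub>R\<^esub> | j # v \<Rightarrow> if j = i then \<tau> i (p v) else \<zero>\<^bsub>R\<^esub>) \<oplus>\<^bsub>R\<^esub> \<delta> i (p w))"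

definition scalar_action :: "('a, 'm) ring_scheme \<Rightarrow> 'a \<Rightarrow> ('k \<Rightarrow> 'a) \<Rightarrow> 'k \<Rightarrow> 'a" where
  "scalar_action R r = (\<lambda>p\<in>carrier (function_ring R). \<lambda>k. r \<otimes>\<^bsub>R\<^esub> p k)"

text \<open>The skew Leibniz rule of \<open>\<delta>\<^sub>i\<close> is exactly what makes the letters and scalars satisfy the commutation
  rule as operators.\<close>

lemma word_representation:
  fixes R :: "('a, 'm) ring_scheme" and \<tau> \<delta> :: "'i \<Rightarrow> 'a \<Rightarrow> 'a"
  assumes R: "ring R" and \<tau>: "\<And>i. \<tau> i \<in> ring_hom R R"
    and \<delta>: "\<And>i. left_skew_derivation R (\<tau> i) (\<delta> i)"
  shows "skew_variables R (additive_endos (function_ring R)) (scalar_action R) \<tau> \<delta>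
    (\<lambda>i. restrict (letter_action R \<tau> \<delta> i) (carrier (function_ring R)))"
    (is "skew_variables R ?E ?\<phi> \<tau> \<delta> ?z")
proof -
  let ?M = "function_ring R :: ('i list \<Rightarrow> 'a) ring"
  interpret R: ring R by (rule R)
  interpret M: abelian_group ?M by (rule function_ring_abelian_group[OF R])
  interpret E: ring ?E by (rule additive_endos_ring[OF M.abelian_group_axioms])
  note d = delta_closed[OF R \<tau> \<delta>] delta_add[OF R \<tau> \<delta>] delta_mult[OF R \<tau> \<delta>]
  note t = ring_hom_closed[OF \<tau>] ring_hom_add[OF \<tau>] ring_hom_mult[OF \<tau>]
  note ops = additive_endos_simps(2-5) compose_def function_ring_simps
  have \<phi>c: "?\<phi> r \<in> carrier ?E" if "r \<in> carrier R" for r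
    unfolding scalar_action_def
    by (rule additive_endosI) (use that in \<open>auto simp: function_ring_simps R.r_distr\<close>)
  have zc: "?z i \<in> carrier ?E" for i
    by (rule additive_endosI)
      (auto simp: function_ring_simps letter_action_def d t R.a_ac split: list.splits)
  have \<phi>: "?\<phi> \<in> ring_hom R ?E"
    by (rule ring_hom_memI)
      (simp_all only: \<phi>c,
        auto simp: scalar_action_def ops R.l_distr R.m_assoc fun_eq_iff)
  interpret \<phi>: ring_hom_ring R ?E ?\<phi> using R E.ring_axioms \<phi> by (rule ring_hom_ringI2)
  have comm: "?z i \<otimes>\<^bsub>?E\<^esub> ?\<phi> r = ?\<phi> (\<tau> i r) \<otimes>\<^bsub>?E\<^esub> ?z i \<oplus>\<^bsub>?E\<^esub> ?\<phi> (\<delta> i r)"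
    if r: "r \<in> carrier R" for i r
  proof
    fix p
    show "(?z i \<otimes>\<^bsub>?E\<^esub> ?\<phi> r) p = (?\<phi> (\<tau> i r) \<otimes>\<^bsub>?E\<^esub> ?z i \<oplus>\<^bsub>?E\<^esub> ?\<phi> (\<delta> i r)) p"
    proof (cases "p \<in> carrier ?M")
      case True
      hence p: "p w \<in> carrier R" for w by (simp add: function_ring_simps)
      hence "letter_action R \<tau> \<delta> i p \<in> carrier ?M"
        by (auto simp: function_ring_simps letter_action_def d t split: list.splits)
      thus ?thesis using r p
        by (auto simp: scalar_action_def ops letter_action_def d t R.r_distr R.a_ac R.m_assoc
            fun_eq_iff split: list.splits)
    qed (simp add: additive_endos_simps(2-5) compose_def)
  qed
  show ?thesis by unfold_locales (use \<tau> \<delta> zc comm in auto)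
qed

text \<open>If the words span and the ring acts on the functions of words as above, then the action on
  the indicator function of the empty word recovers the coefficients of an element.\<close>

lemma (in skew_variables) free_criterion:
  assumes span: "carrier A \<subseteq> span UNIV"
    and h: "h \<in> ring_hom A (additive_endos (function_ring R))"
    and h\<phi>: "\<And>r. r \<in> carrier R \<Longrightarrow> h (\<phi> r) = scalar_action R r"
    and hz: "\<And>i. h (z i) = restrict (letter_action R \<tau> \<delta> i) (carrier (function_ring R))"
  shows "free_skew_variables R A \<phi> \<tau> \<delta> z"
proof -
  let ?E = "additive_endos (function_ring R) :: (('i list \<Rightarrow> 'a) \<Rightarrow> ('i list \<Rightarrow> 'a)) ring"
  let ?ind = "\<lambda>w v. if v = w then \<one>\<^bsub>R\<^esub> else \<zero>\<^bsub>R\<^esub>"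
  interpret M: abelian_group "function_ring R :: ('i list \<Rightarrow> 'a) ring"
    by (rule function_ring_abelian_group[OF R.ring_axioms])
  interpret E: ring ?E by (rule additive_endos_ring[OF M.abelian_group_axioms])
  interpret h: ring_hom_ring A ?E h using S.ring_axioms E.ring_axioms h by (rule ring_hom_ringI2)
  note ops = additive_endos_simps(2-5) compose_def function_ring_simps
  have ind: "?ind w \<in> carrier (function_ring R)" for w by (simp add: function_ring_simps)
  have \<delta>01: "\<delta> i \<zero>\<^bsub>R\<^esub> = \<zero>\<^bsub>R\<^esub>" "\<delta> i \<one>\<^bsub>R\<^esub> = \<zero>\<^bsub>R\<^esub>" for i
    using delta_zero[OF R.ring_axioms tau_hom delta_skew] delta_one[OF R.ring_axioms tau_hom delta_skew] .
  have \<tau>01: "\<tau> i \<zero>\<^bsub>R\<^esub> = \<zero>\<^bsub>R\<^esub>" "\<tau> i \<one>\<^bsub>R\<^esub> = \<one>\<^bsub>R\<^esub>" for i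
    using ring_hom_zero[OF tau_hom R.ring_axioms R.ring_axioms] ring_hom_one[OF tau_hom] by auto
  have word: "h (word w) (?ind []) = ?ind w" for w
  proof (induction w)
    case Nil
    show ?case using ind by (simp add: word_Nil ops)
  next
    case (Cons i w)
    have "h (word (i # w)) (?ind []) = letter_action R \<tau> \<delta> i (?ind w)"
      using ind Cons by (simp add: word_Cons z_closed word_closed hz ops)
    also have "\<dots> = ?ind (i # w)"
      by (auto simp: letter_action_def \<delta>01 \<tau>01 fun_eq_iff split: list.splits)
    finally show ?case .
  qed
  have coeff: "h (comb c) (?ind []) k = c k" if "c \<in> fin_supp R" for c k
  proof (rule coefficient_functional[OF that, where g = "\<lambda>s. h s (?ind []) k"])
    show "h (s \<oplus>\<^bsub>A\<^esub> t) (?ind []) k = h s (?ind []) k \<oplus>\<^bsub>R\<^esub> h t (?ind []) k"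
      if "s \<in> carrier A" "t \<in> carrier A" for s t
      using that ind by (simp add: ops)
    show "h \<zero>\<^bsub>A\<^esub> (?ind []) k = \<zero>\<^bsub>R\<^esub>" using ind by (simp add: ops)
    show "h (\<phi> a \<otimes>\<^bsub>A\<^esub> word j) (?ind []) k = (if j = k then a else \<zero>\<^bsub>R\<^esub>)" if "a \<in> carrier R" for a j
      using that ind word_closed by (simp add: ops h\<phi> word scalar_action_def)
  qed
  show ?thesis
  proof unfold_locales
    fix s assume "s \<in> carrier A"
    then obtain c where c: "c \<in> fin_supp R" "s = comb c" using span by (auto simp: span_def)
    show "\<exists>!c. c \<in> fin_supp R \<and> s = comb c"
    proof (rule ex1I[of _ c])
      show "d = c" if "d \<in> fin_supp R \<and> s = comb d" for d
        using that c coeff by (metis ext)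
    qed (use c in blast)
  qed
qed

section \<open>Amalgamated products of Ore extensions\<close>

text \<open>The images of the two rings generate the amalgamated product, so an additive subgroup that
  contains the unit and is stable under left multiplication by these images contains all words in the
  generators and hence everything.\<close>

lemma amalg_generated:
  fixes S1 :: "('b, 'n) ring_scheme" and S2 :: "('c, 'k) ring_scheme"
  assumes R: "ring R" "ring S1" "ring S2" "\<iota>1 \<in> ring_hom R S1" "\<iota>2 \<in> ring_hom R S2"
    and K: "additive_subgroup K (amalg R S1 \<iota>1 S2 \<iota>2)" "\<one>\<^bsub>amalg R S1 \<iota>1 S2 \<iota>2\<^esub> \<in> K"
    and inl: "\<And>a s. a \<in> carrier S1 \<Longrightarrow> s \<in> K \<Longrightarrow>
      amalg_inl R S1 \<iota>1 S2 \<iota>2 a \<otimes>\<^bsub>amalg R S1 \<iota>1 S2 \<iota>2\<^esub> s \<in> K"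
    and inr: "\<And>b s. b \<in> carrier S2 \<Longrightarrow> s \<in> K \<Longrightarrow>
      amalg_inr R S1 \<iota>1 S2 \<iota>2 b \<otimes>\<^bsub>amalg R S1 \<iota>1 S2 \<iota>2\<^esub> s \<in> K"
  shows "carrier (amalg R S1 \<iota>1 S2 \<iota>2) \<subseteq> K"
proof
  let ?S = "amalg R S1 \<iota>1 S2 \<iota>2" and ?F = "amalg_free S1 S2" and ?I = "amalg_ideal R S1 \<iota>1 S2 \<iota>2"
  let ?G = "Inl ` carrier S1 \<union> Inr ` carrier S2"
  define f where "f = case_sum (amalg_inl R S1 \<iota>1 S2 \<iota>2) (amalg_inr R S1 \<iota>1 S2 \<iota>2)"
  have rS: "ring ?S" by (rule amalg_is_ring[OF R])
  interpret S: ring ?S by (rule rS)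
  interpret K: additive_subgroup K ?S by (rule K(1))
  interpret I: ideal ?I ?F by (rule amalg_ideal_ideal[OF R])
  have f: "f \<in> ?G \<rightarrow> carrier ?S"
    using ring_hom_closed[OF amalg_inl_hom[OF R]] ring_hom_closed[OF amalg_inr_hom[OF R]]
    by (auto simp: f_def)
  have wrd: "foldr (\<lambda>g t. f g \<otimes>\<^bsub>?S\<^esub> t) u \<one>\<^bsub>?S\<^esub> \<in> K" if "set u \<subseteq> ?G" for u
    using that K(2) inl inr by (induction u) (auto simp: f_def)
  have eval: "free_eval ?S f p \<in> K" if "p \<in> carrier (free_ring ?G)" for p
    using that
  proof (induction rule: free_ring_induct)
    case zero
    show ?case by (simp add: free_eval_zero[OF rS f] K.zero_closed)
  next
    case (add p u c)
    have "add_pow ?S c (foldr (\<lambda>g t. f g \<otimes>\<^bsub>?S\<^esub> t) u \<one>\<^bsub>?S\<^esub>) \<in> K"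
      using S.add.subgroup_int_pow_closed[OF K.a_subgroup wrd[OF add.hyps(2)]] by blast
    thus ?case
      using add.IH
      by (simp add: free_eval_add[OF rS f single_carrier[OF add.hyps(2)] add.hyps(1)]
          free_eval_single[OF rS f add.hyps(2)] K.a_closed)
  qed
  fix s assume "s \<in> carrier ?S"
  then obtain p where p: "p \<in> carrier ?F" "s = ?I +>\<^bsub>?F\<^esub> p"
    by (auto simp: amalg_def FactRing_def A_RCOSETS_def' a_r_coset_def RCOSETS_def A_RCOSETS_def)
  have "?I +>\<^bsub>?F\<^esub> p = free_eval ?S f p"
  proof (rule free_ring_hom_eqI[OF rS, where G = ?G])
    show "(\<lambda>p. ?I +>\<^bsub>?F\<^esub> p) \<in> ring_hom (free_ring ?G) ?S"
      using I.rcos_ring_hom unfolding amalg_def amalg_free_def .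
    show "free_eval ?S f \<in> ring_hom (free_ring ?G) ?S" by (rule free_eval_hom[OF rS f])
    show "?I +>\<^bsub>?F\<^esub> word_elem [g] = free_eval ?S f (word_elem [g])" if "g \<in> ?G" for g
    proof -
      have fg: "f g \<in> carrier ?S" using f that by blast
      have "?I +>\<^bsub>?F\<^esub> word_elem [g] = f g" using that by (auto simp: f_def amalg_inl_def amalg_inr_def)
      thus ?thesis using that free_eval_word[OF rS f, of "[g]"] fg by simp
    qed
    show "p \<in> carrier (free_ring ?G)" using p(1) by (simp only: amalg_free_def)
  qed
  thus "s \<in> K" using eval p by (simp add: amalg_free_def)
qed

text \<open>The words are indexed by lists of booleans, with \<open>True\<close> for the letter \<open>x\<close> and \<open>False\<close> for the letter
  \<open>y\<close>.  They span by \<open>amalg_generated\<close>.  For their independence, the operators of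
  \<open>word_representation\<close> define homomorphisms on both Ore extensions that agree on \<open>R\<close>, hence one on the
  amalgamated product.\<close>

theorem amalg_ore_free:
  fixes R :: "('a, 'm) ring_scheme" and S1 :: "('b, 'n) ring_scheme" and S2 :: "('c, 'k) ring_scheme"
  assumes R: "ring R" and \<tau>1: "\<tau>1 \<in> ring_hom R R" and \<tau>2: "\<tau>2 \<in> ring_hom R R"
    and \<delta>1: "left_skew_derivation R \<tau>1 \<delta>1" and \<delta>2: "left_skew_derivation R \<tau>2 \<delta>2"
    and S1: "ore_extension R \<tau>1 \<delta>1 S1 \<iota>1 x" and S2: "ore_extension R \<tau>2 \<delta>2 S2 \<iota>2 y"
  shows "free_skew_variables R (amalg R S1 \<iota>1 S2 \<iota>2) (amalg_base R S1 \<iota>1 S2 \<iota>2)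
    (case_bool \<tau>1 \<tau>2) (case_bool \<delta>1 \<delta>2)
    (case_bool (amalg_inl R S1 \<iota>1 S2 \<iota>2 x) (amalg_inr R S1 \<iota>1 S2 \<iota>2 y))"
    (is "free_skew_variables R ?S ?\<phi> ?\<tau> ?\<delta> ?z")
proof -
  let ?inl = "amalg_inl R S1 \<iota>1 S2 \<iota>2" and ?inr = "amalg_inr R S1 \<iota>1 S2 \<iota>2"
  let ?E = "additive_endos (function_ring R) :: ((bool list \<Rightarrow> 'a) \<Rightarrow> (bool list \<Rightarrow> 'a)) ring"
  have S1': "ring S1" "\<iota>1 \<in> ring_hom R S1" "x \<in> carrier S1"
    and xcomm: "\<And>r. r \<in> carrier R \<Longrightarrow>
      x \<otimes>\<^bsub>S1\<^esub> \<iota>1 r = \<iota>1 (\<tau>1 r) \<otimes>\<^bsub>S1\<^esub> x \<oplus>\<^bsub>S1\<^esub> \<iota>1 (\<delta>1 r)"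
    using S1 by (auto simp: ore_extension_def)
  have S2': "ring S2" "\<iota>2 \<in> ring_hom R S2" "y \<in> carrier S2"
    and ycomm: "\<And>r. r \<in> carrier R \<Longrightarrow>
      y \<otimes>\<^bsub>S2\<^esub> \<iota>2 r = \<iota>2 (\<tau>2 r) \<otimes>\<^bsub>S2\<^esub> y \<oplus>\<^bsub>S2\<^esub> \<iota>2 (\<delta>2 r)"
    using S2 by (auto simp: ore_extension_def)
  note ctx = R S1'(1) S2'(1) S1'(2) S2'(2)
  have rS: "ring ?S" by (rule amalg_is_ring[OF ctx])
  interpret l: ring_hom_ring S1 ?S ?inl using S1'(1) rS amalg_inl_hom[OF ctx] by (rule ring_hom_ringI2)
  interpret r: ring_hom_ring S2 ?S ?inr using S2'(1) rS amalg_inr_hom[OF ctx] by (rule ring_hom_ringI2)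
  have \<phi>: "?\<phi> \<in> ring_hom R ?S"
  proof -
    have "?\<phi> = ?inl \<circ> \<iota>1" by (simp add: amalg_base_def fun_eq_iff)
    thus ?thesis using ring_hom_trans[OF S1'(2) amalg_inl_hom[OF ctx]] by (simp only:)
  qed
  interpret \<phi>: ring_hom_ring R ?S ?\<phi> using R rS \<phi> by (rule ring_hom_ringI2)
  have \<phi>1: "?\<phi> c = ?inl (\<iota>1 c)" for c by (simp add: amalg_base_def)
  have \<phi>2: "?\<phi> c = ?inr (\<iota>2 c)" if "c \<in> carrier R" for c
    using amalg_inl_inr[OF ctx that] by (simp add: \<phi>1)
  have \<tau>: "?\<tau> i \<in> ring_hom R R" and \<delta>: "left_skew_derivation R (?\<tau> i) (?\<delta> i)" for i
    using \<tau>1 \<tau>2 \<delta>1 \<delta>2 by (auto split: bool.splits)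
  have comm: "?z i \<otimes>\<^bsub>?S\<^esub> ?\<phi> r = ?\<phi> (?\<tau> i r) \<otimes>\<^bsub>?S\<^esub> ?z i \<oplus>\<^bsub>?S\<^esub> ?\<phi> (?\<delta> i r)"
    if r: "r \<in> carrier R" for r i
  proof -
    note cl = ring_hom_closed[OF \<tau>1 r] delta_closed[OF R \<tau>1 \<delta>1 r]
      ring_hom_closed[OF \<tau>2 r] delta_closed[OF R \<tau>2 \<delta>2 r]
    have \<iota>: "\<iota>1 c \<in> carrier S1" "\<iota>2 c \<in> carrier S2" if "c \<in> carrier R" for c
      using ring_hom_closed[OF S1'(2) that] ring_hom_closed[OF S2'(2) that] .
    show ?thesis
    proof (cases i)
      case True
      have "?inl x \<otimes>\<^bsub>?S\<^esub> ?inl (\<iota>1 r) = ?inl (x \<otimes>\<^bsub>S1\<^esub> \<iota>1 r)" using S1'(3) \<iota> r by simp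
      also have "\<dots> = ?inl (\<iota>1 (\<tau>1 r)) \<otimes>\<^bsub>?S\<^esub> ?inl x \<oplus>\<^bsub>?S\<^esub> ?inl (\<iota>1 (\<delta>1 r))"
        unfolding xcomm[OF r] using S1'(3) \<iota> cl by simp
      finally show ?thesis using True by (simp add: \<phi>1)
    next
      case False
      have "?inr y \<otimes>\<^bsub>?S\<^esub> ?inr (\<iota>2 r) = ?inr (y \<otimes>\<^bsub>S2\<^esub> \<iota>2 r)" using S2'(3) \<iota> r by simp
      also have "\<dots> = ?inr (\<iota>2 (\<tau>2 r)) \<otimes>\<^bsub>?S\<^esub> ?inr y \<oplus>\<^bsub>?S\<^esub> ?inr (\<iota>2 (\<delta>2 r))"
        unfolding ycomm[OF r] using S2'(3) \<iota> cl by simp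
      finally show ?thesis using False cl r by (simp add: \<phi>2)
    qed
  qed
  interpret skew_variables R ?S ?\<phi> ?\<tau> ?\<delta> ?z
    by unfold_locales (use \<tau> \<delta> comm S1'(3) S2'(3) in \<open>auto split: bool.splits\<close>)
  have span: "carrier ?S \<subseteq> span UNIV"
  proof (rule amalg_generated[OF ctx])
    show "additive_subgroup (span UNIV) ?S" by (rule span_additive_subgroup)
    show "\<one>\<^bsub>?S\<^esub> \<in> span UNIV" using span_single[OF \<phi>.R.one_closed, of "[]" UNIV] by (simp add: word_Nil)
    have z: "?z i \<otimes>\<^bsub>?S\<^esub> s \<in> span UNIV" if "s \<in> span UNIV" for s i by (rule z_span[OF that]) auto
    show "?inl a \<otimes>\<^bsub>?S\<^esub> s \<in> span UNIV" if "a \<in> carrier S1" "s \<in> span UNIV" for a s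
      by (rule ore_extension_stable[OF R S1 rS l.homh _ span_zero span_add _ _ that])
        (use span_closed span_scal z[of _ True] in \<open>auto simp: \<phi>1[symmetric]\<close>)
    show "?inr b \<otimes>\<^bsub>?S\<^esub> s \<in> span UNIV" if "b \<in> carrier S2" "s \<in> span UNIV" for b s
      by (rule ore_extension_stable[OF R S2 rS r.homh _ span_zero span_add _ _ that])
        (use span_closed span_scal z[of _ False] in \<open>auto simp: \<phi>2[symmetric]\<close>)
  qed
  let ?Z = "\<lambda>i. restrict (letter_action R ?\<tau> ?\<delta> i) (carrier (function_ring R))"
  interpret E: skew_variables R ?E "scalar_action R" ?\<tau> ?\<delta> ?Z
    by (rule word_representation[OF R \<tau> \<delta>])
  obtain f1 where f1: "f1 \<in> ring_hom S1 ?E"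
    "\<And>c. c \<in> carrier R \<Longrightarrow> f1 (\<iota>1 c) = scalar_action R c" "f1 x = ?Z True"
    by (rule ore_extension_universal[OF R \<tau>1 \<delta>1 S1 E.S.ring_axioms E.homh E.z_closed[of True]])
      (use E.z_comm[of _ True] in auto)
  obtain f2 where f2: "f2 \<in> ring_hom S2 ?E"
    "\<And>c. c \<in> carrier R \<Longrightarrow> f2 (\<iota>2 c) = scalar_action R c" "f2 y = ?Z False"
    by (rule ore_extension_universal[OF R \<tau>2 \<delta>2 S2 E.S.ring_axioms E.homh E.z_closed[of False]])
      (use E.z_comm[of _ False] in auto)
  obtain h where h: "h \<in> ring_hom ?S ?E" "\<And>a. a \<in> carrier S1 \<Longrightarrow> h (?inl a) = f1 a"
    "\<And>b. b \<in> carrier S2 \<Longrightarrow> h (?inr b) = f2 b"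
    using amalg_universal[OF ctx E.S.ring_axioms f1(1) f2(1)] f1(2) f2(2) by auto
  show ?thesis
  proof (rule free_criterion[OF span h(1)])
    show "h (?\<phi> r) = scalar_action R r" if "r \<in> carrier R" for r
      using that h(2) f1(2) ring_hom_closed[OF S1'(2) that] by (simp add: \<phi>1)
    show "h (?z i) = ?Z i" for i
      using h(2)[OF S1'(3)] h(3)[OF S2'(3)] f1(3) f2(3) by (cases i) auto
  qed
qed

section \<open>Reduction modulo an invariant ideal\<close>

text \<open>In terms of coordinates, \<open>h\<close> applies \<open>\<pi>\<close> to each coefficient, so an element of its kernel is a
  sum of terms \<open>a w\<close> with \<open>a \<in> I\<close>.  Such a term lies in \<open>I A\<close> by definition.  It lies in \<open>A I\<close> by
  induction on the word: since \<open>a = \<tau>\<^sub>i(a')\<close> with \<open>a' \<in> I\<close>, one has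
  \<open>a z\<^sub>i w = z\<^sub>i (a' w) - \<delta>\<^sub>i(a') w\<close>.\<close>

theorem free_skew_reduction:
  fixes R :: "('a, 'm) ring_scheme" and A :: "('b, 'n) ring_scheme"
    and R' :: "('c, 'k) ring_scheme" and A' :: "('d, 'l) ring_scheme"
    and z :: "'i \<Rightarrow> 'b" and z' :: "'i \<Rightarrow> 'd"
  assumes P: "free_skew_variables R A \<phi> \<tau> \<delta> z" and Q: "free_skew_variables R' A' \<phi>' \<tau>' \<delta>' z'"
    and \<pi>: "\<pi> \<in> ring_hom R R'" and \<pi>_surj: "\<pi> ` carrier R = carrier R'"
    and h: "h \<in> ring_hom A A'" and h\<phi>: "\<And>r. r \<in> carrier R \<Longrightarrow> h (\<phi> r) = \<phi>' (\<pi> r)"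
    and hz: "\<And>i. h (z i) = z' i"
    and I: "I = a_kernel R R' \<pi>" and \<tau>I: "\<And>i. I \<subseteq> \<tau> i ` I" and \<delta>I: "\<And>i. \<delta> i ` I \<subseteq> I"
  shows "h ` carrier A = carrier A'"
    and "(\<phi> ` I) \<cdot>\<^bsub>A\<^esub> carrier A = a_kernel A A' h"
    and "carrier A \<cdot>\<^bsub>A\<^esub> (\<phi> ` I) = a_kernel A A' h"
proof -
  interpret P: free_skew_variables R A \<phi> \<tau> \<delta> z by (rule P)
  interpret Q: free_skew_variables R' A' \<phi>' \<tau>' \<delta>' z' by (rule Q)
  interpret \<pi>: ring_hom_ring R R' \<pi> using P.R.ring_axioms Q.R.ring_axioms \<pi> by (rule ring_hom_ringI2)
  interpret h: ring_hom_ring A A' h using P.S.ring_axioms Q.S.ring_axioms h by (rule ring_hom_ringI2)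
  interpret I: ideal I R unfolding I by (rule \<pi>.kernel_is_ideal)
  interpret K: ideal "a_kernel A A' h" A by (rule h.kernel_is_ideal)
  have h_word: "h (P.word w) = Q.word w" for w
    by (induction w) (simp_all add: P.word_Nil Q.word_Nil P.word_Cons Q.word_Cons P.z_closed P.word_closed hz)
  have h_mono: "h (\<phi> a \<otimes>\<^bsub>A\<^esub> P.word w) = \<phi>' (\<pi> a) \<otimes>\<^bsub>A'\<^esub> Q.word w" if "a \<in> carrier R" for a w
    using that P.word_closed by (simp add: h\<phi> h_word)
  show "h ` carrier A = carrier A'"
  proof
    have "t \<in> h ` carrier A" if "t \<in> carrier A'" for t
      using that unfolding Q.span_UNIV[symmetric]
    proof (induction rule: Q.span_induct)
      case zero
      show ?case by (rule image_eqI[where x = "\<zero>\<^bsub>A\<^esub>"]) simp_all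
    next
      case (add s t)
      then obtain s0 t0 where "s0 \<in> carrier A" "s = h s0" "t0 \<in> carrier A" "t = h t0" by blast
      thus ?case by (intro image_eqI[where x = "s0 \<oplus>\<^bsub>A\<^esub> t0"]) simp_all
    next
      case (monomial a w)
      then obtain a0 where a0: "a0 \<in> carrier R" "a = \<pi> a0" using \<pi>_surj by blast
      thus ?case
        by (intro image_eqI[where x = "\<phi> a0 \<otimes>\<^bsub>A\<^esub> P.word w"]) (simp_all add: h_mono P.term_closed)
    qed
    thus "carrier A' \<subseteq> h ` carrier A" by blast
  qed auto
  have coord_h: "Q.coord (h s) w = \<pi> (P.coord s w)" if "s \<in> carrier A" for s w
    using that unfolding P.span_UNIV[symmetric]
    by (induction rule: P.span_induct)
      (simp_all add: Q.coord_zero P.coord_zero Q.coord_add P.coord_add P.coord_closed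
        h_mono Q.coord_monomial P.coord_monomial del: h.hom_mult)
  have coord_I: "P.coord s w \<in> I" if "s \<in> a_kernel A A' h" for s w
  proof -
    have "s \<in> carrier A" "h s = \<zero>\<^bsub>A'\<^esub>" using that unfolding a_kernel_def' by auto
    hence "\<pi> (P.coord s w) = \<zero>\<^bsub>R'\<^esub>" "P.coord s w \<in> carrier R"
      using coord_h[of s w] P.coord_closed[of s w] Q.coord_zero by auto
    thus ?thesis unfolding I a_kernel_def' by blast
  qed
  have \<phi>I: "\<phi> a \<in> a_kernel A A' h" if "a \<in> I" for a
    using that h\<phi> unfolding I a_kernel_def' by auto
  have closed_I: "a \<in> carrier R" if "a \<in> I" for a using that I.Icarr by blast
  show "(\<phi> ` I) \<cdot>\<^bsub>A\<^esub> carrier A = a_kernel A A' h"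
  proof
    show "(\<phi> ` I) \<cdot>\<^bsub>A\<^esub> carrier A \<subseteq> a_kernel A A' h"
    proof
      fix s assume "s \<in> (\<phi> ` I) \<cdot>\<^bsub>A\<^esub> carrier A"
      thus "s \<in> a_kernel A A' h"
        by induction (auto intro: K.I_r_closed K.a_closed \<phi>I)
    qed
    show "a_kernel A A' h \<subseteq> (\<phi> ` I) \<cdot>\<^bsub>A\<^esub> carrier A"
    proof
      fix s assume s: "s \<in> a_kernel A A' h"
      have mono: "\<phi> a \<otimes>\<^bsub>A\<^esub> t \<in> (\<phi> ` I) \<cdot>\<^bsub>A\<^esub> carrier A" if "a \<in> I" "t \<in> carrier A" for a t
        using that by (intro ideal_prod.prod) auto
      have "P.comb (P.coord s) \<in> (\<phi> ` I) \<cdot>\<^bsub>A\<^esub> carrier A"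
        by (rule P.comb_mem[OF P.coord_fin_supp[OF K.Icarr[OF s]]])
          (use mono[OF I.zero_closed P.S.zero_closed] mono[OF coord_I[OF s] P.word_closed] in
            \<open>auto intro: ideal_prod.sum\<close>)
      thus "s \<in> (\<phi> ` I) \<cdot>\<^bsub>A\<^esub> carrier A" using P.comb_coord K.Icarr[OF s] by simp
    qed
  qed
  show "carrier A \<cdot>\<^bsub>A\<^esub> (\<phi> ` I) = a_kernel A A' h"
  proof
    show "carrier A \<cdot>\<^bsub>A\<^esub> (\<phi> ` I) \<subseteq> a_kernel A A' h"
    proof
      fix s assume "s \<in> carrier A \<cdot>\<^bsub>A\<^esub> (\<phi> ` I)"
      thus "s \<in> a_kernel A A' h"
        by induction (auto intro: K.I_l_closed K.a_closed \<phi>I)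
    qed
    have left: "t \<otimes>\<^bsub>A\<^esub> s \<in> carrier A \<cdot>\<^bsub>A\<^esub> (\<phi> ` I)" if s: "s \<in> carrier A \<cdot>\<^bsub>A\<^esub> (\<phi> ` I)" and t: "t \<in> carrier A" for s t
    proof -
      have "s \<in> carrier A \<and> t \<otimes>\<^bsub>A\<^esub> s \<in> carrier A \<cdot>\<^bsub>A\<^esub> (\<phi> ` I)"
        using s
      proof induction
        case (prod i j)
        hence "j \<in> carrier A" using closed_I by auto
        thus ?case using prod t
          by (auto simp: P.S.m_assoc[symmetric] intro: ideal_prod.prod)
      next
        case (sum s1 s2)
        thus ?case using t by (auto simp: P.S.r_distr intro: ideal_prod.sum)
      qed
      thus ?thesis by simp
    qed
    have mono: "\<phi> a \<otimes>\<^bsub>A\<^esub> P.word w \<in> carrier A \<cdot>\<^bsub>A\<^esub> (\<phi> ` I)" if "a \<in> I" for a w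
      using that
    proof (induction w arbitrary: a)
      case Nil
      have "\<one>\<^bsub>A\<^esub> \<otimes>\<^bsub>A\<^esub> \<phi> a \<in> carrier A \<cdot>\<^bsub>A\<^esub> (\<phi> ` I)" using Nil by (intro ideal_prod.prod) auto
      thus ?case using Nil closed_I by (simp add: P.word_Nil)
    next
      case (Cons i w)
      then obtain a' where a': "a' \<in> I" "a = \<tau> i a'" using \<tau>I by blast
      have d: "\<delta> i a' \<in> I" using a' \<delta>I by blast
      note cl = closed_I[OF a'(1)] closed_I[OF d] P.z_closed[of i] P.word_closed[of w]
      have "z i \<otimes>\<^bsub>A\<^esub> (\<phi> a' \<otimes>\<^bsub>A\<^esub> P.word w)
          = \<phi> a \<otimes>\<^bsub>A\<^esub> P.word (i # w) \<oplus>\<^bsub>A\<^esub> \<phi> (\<delta> i a') \<otimes>\<^bsub>A\<^esub> P.word w"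
        using P.z_monomial[OF cl(1)] a'(2) by simp
      hence "\<phi> a \<otimes>\<^bsub>A\<^esub> P.word (i # w)
          = z i \<otimes>\<^bsub>A\<^esub> (\<phi> a' \<otimes>\<^bsub>A\<^esub> P.word w) \<oplus>\<^bsub>A\<^esub> \<phi> (\<ominus>\<^bsub>R\<^esub> \<delta> i a') \<otimes>\<^bsub>A\<^esub> P.word w"
        using cl closed_I[OF Cons.prems] P.word_closed[of "i # w"]
        by (simp add: P.S.l_minus P.S.a_assoc P.S.r_neg)
      moreover have "z i \<otimes>\<^bsub>A\<^esub> (\<phi> a' \<otimes>\<^bsub>A\<^esub> P.word w) \<in> carrier A \<cdot>\<^bsub>A\<^esub> (\<phi> ` I)"
        by (rule left[OF Cons.IH[OF a'(1)] cl(3)])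
      moreover have "\<phi> (\<ominus>\<^bsub>R\<^esub> \<delta> i a') \<otimes>\<^bsub>A\<^esub> P.word w \<in> carrier A \<cdot>\<^bsub>A\<^esub> (\<phi> ` I)"
        by (rule Cons.IH[OF I.a_inv_closed[OF d]])
      ultimately show ?case by (simp only: ideal_prod.sum)
    qed
    show "a_kernel A A' h \<subseteq> carrier A \<cdot>\<^bsub>A\<^esub> (\<phi> ` I)"
    proof
      fix s assume s: "s \<in> a_kernel A A' h"
      have "\<zero>\<^bsub>A\<^esub> \<in> carrier A \<cdot>\<^bsub>A\<^esub> (\<phi> ` I)" using mono[OF I.zero_closed, of "[]"] by (simp add: P.word_Nil)
      hence "P.comb (P.coord s) \<in> carrier A \<cdot>\<^bsub>A\<^esub> (\<phi> ` I)"
        by (rule P.comb_mem[OF P.coord_fin_supp[OF K.Icarr[OF s]]])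
          (use mono[OF coord_I[OF s]] in \<open>auto intro: ideal_prod.sum\<close>)
      thus "s \<in> carrier A \<cdot>\<^bsub>A\<^esub> (\<phi> ` I)" using P.comb_coord K.Icarr[OF s] by simp
    qed
  qed
qed

section \<open>Primeness in terms of elements\<close>

text \<open>If \<open>a R b \<subseteq> P\<close>, then the elements \<open>c\<close> with \<open>a R c \<subseteq> P\<close> form an ideal \<open>X\<close> containing \<open>b\<close>, and the
  elements \<open>d\<close> with \<open>d R X \<subseteq> P\<close> form an ideal \<open>Y\<close> containing \<open>a\<close>.  As \<open>Y X \<subseteq> P\<close>, one of them
  lies in \<open>P\<close>.\<close>

lemma prime_ideal_elementwise:
  assumes P: "prime_ideal P R" and R: "ring R"
    and ab: "a \<in> carrier R" "b \<in> carrier R" "a \<notin> P" "b \<notin> P"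
  shows "\<exists>r\<in>carrier R. a \<otimes>\<^bsub>R\<^esub> (r \<otimes>\<^bsub>R\<^esub> b) \<notin> P"
proof (rule ccontr)
  assume neg: "\<not> ?thesis"
  interpret ring R by (rule R)
  interpret P: ideal P R using P by (simp add: prime_ideal_def)
  let ?X = "{c \<in> carrier R. \<forall>r\<in>carrier R. a \<otimes>\<^bsub>R\<^esub> (r \<otimes>\<^bsub>R\<^esub> c) \<in> P}"
  let ?Y = "{d \<in> carrier R. \<forall>r\<in>carrier R. \<forall>c\<in>?X. d \<otimes>\<^bsub>R\<^esub> (r \<otimes>\<^bsub>R\<^esub> c) \<in> P}"
  have X: "ideal ?X R"
  proof (rule idealI[OF R])
    show "subgroup ?X (add_monoid R)"
    proof (rule add.subgroupI)
      show "?X \<noteq> {}" using ab neg by blast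
    qed (use ab in \<open>auto simp: r_minus r_distr P.a_closed P.a_inv_closed\<close>)
    show "s \<otimes>\<^bsub>R\<^esub> c \<in> ?X" if "c \<in> ?X" "s \<in> carrier R" for s c
      using that by (auto simp: m_assoc[symmetric])
    show "c \<otimes>\<^bsub>R\<^esub> s \<in> ?X" if "c \<in> ?X" "s \<in> carrier R" for s c
    proof -
      have "a \<otimes>\<^bsub>R\<^esub> (r \<otimes>\<^bsub>R\<^esub> (c \<otimes>\<^bsub>R\<^esub> s)) \<in> P" if "r \<in> carrier R" for r
        using \<open>c \<in> ?X\<close> \<open>s \<in> carrier R\<close> that ab(1) P.I_r_closed[of "a \<otimes>\<^bsub>R\<^esub> (r \<otimes>\<^bsub>R\<^esub> c)" s]
        by (simp add: m_assoc)
      thus ?thesis using that by simp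
    qed
  qed
  have Y: "ideal ?Y R"
  proof (rule idealI[OF R])
    show "subgroup ?Y (add_monoid R)"
    proof (rule add.subgroupI)
      show "?Y \<noteq> {}" using ab by blast
    qed (auto simp: l_minus l_distr P.a_closed P.a_inv_closed)
    show "s \<otimes>\<^bsub>R\<^esub> d \<in> ?Y" if "d \<in> ?Y" "s \<in> carrier R" for s d
      using that P.I_l_closed by (auto simp: m_assoc)
    show "d \<otimes>\<^bsub>R\<^esub> s \<in> ?Y" if "d \<in> ?Y" "s \<in> carrier R" for s d
      using that by (auto simp: m_assoc) (metis (no_types, lifting) m_assoc m_closed)
  qed
  have "?Y \<cdot>\<^bsub>R\<^esub> ?X \<subseteq> P"
  proof
    fix s assume "s \<in> ?Y \<cdot>\<^bsub>R\<^esub> ?X"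
    thus "s \<in> P"
    proof induction
      case (prod d c)
      hence "d \<otimes>\<^bsub>R\<^esub> (\<one>\<^bsub>R\<^esub> \<otimes>\<^bsub>R\<^esub> c) \<in> P" using one_closed by blast
      thus ?case using prod by auto
    qed (simp add: P.a_closed)
  qed
  hence "?Y \<subseteq> P \<or> ?X \<subseteq> P" using P X Y unfolding prime_ideal_def by blast
  thus False using ab neg by blast
qed

text \<open>Elements of two ideals outside the kernel have nonzero images, between which some element gives
  a nonzero product; lifting it produces an element of the product of the ideals outside the kernel.\<close>

lemma prime_ideal_kernel:
  assumes h: "ring_hom_ring S A h" and surj: "h ` carrier S = carrier A" and "\<one>\<^bsub>A\<^esub> \<noteq> \<zero>\<^bsub>A\<^esub>"
    and prime: "\<And>f g. f \<in> carrier A \<Longrightarrow> g \<in> carrier A \<Longrightarrow> f \<noteq> \<zero>\<^bsub>A\<^esub> \<Longrightarrow> g \<noteq> \<zero>\<^bsub>A\<^esub> \<Longrightarrow>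
      \<exists>t\<in>carrier A. f \<otimes>\<^bsub>A\<^esub> (t \<otimes>\<^bsub>A\<^esub> g) \<noteq> \<zero>\<^bsub>A\<^esub>"
  shows "prime_ideal (a_kernel S A h) S"
  unfolding prime_ideal_def
proof (intro conjI allI impI)
  interpret h: ring_hom_ring S A h by (rule h)
  show "ideal (a_kernel S A h) S" by (rule h.kernel_is_ideal)
  have "\<one>\<^bsub>S\<^esub> \<notin> a_kernel S A h" using assms(3) h.hom_one unfolding a_kernel_def' by auto
  thus "a_kernel S A h \<noteq> carrier S" by auto
  fix B C assume BC: "ideal B S \<and> ideal C S \<and> B \<cdot>\<^bsub>S\<^esub> C \<subseteq> a_kernel S A h"
  interpret B: ideal B S using BC by blast
  interpret C: ideal C S using BC by blast
  show "B \<subseteq> a_kernel S A h \<or> C \<subseteq> a_kernel S A h"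
  proof (rule ccontr)
    assume "\<not> ?thesis"
    then obtain b c where bc: "b \<in> B" "b \<notin> a_kernel S A h" "c \<in> C" "c \<notin> a_kernel S A h" by blast
    note cl = B.Icarr[OF bc(1)] C.Icarr[OF bc(3)]
    have ne: "h b \<noteq> \<zero>\<^bsub>A\<^esub>" "h c \<noteq> \<zero>\<^bsub>A\<^esub>" using bc cl unfolding a_kernel_def' by blast+
    then obtain t where t: "t \<in> carrier A" "h b \<otimes>\<^bsub>A\<^esub> (t \<otimes>\<^bsub>A\<^esub> h c) \<noteq> \<zero>\<^bsub>A\<^esub>"
      using prime[OF h.hom_closed[OF cl(1)] h.hom_closed[OF cl(2)] ne] by blast
    then obtain s where s: "s \<in> carrier S" "t = h s" using surj by blast
    have "b \<otimes>\<^bsub>S\<^esub> (s \<otimes>\<^bsub>S\<^esub> c) \<in> B \<cdot>\<^bsub>S\<^esub> C"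
      by (rule ideal_prod.prod[OF bc(1) C.I_l_closed[OF bc(3) s(1)]])
    hence "h (b \<otimes>\<^bsub>S\<^esub> (s \<otimes>\<^bsub>S\<^esub> c)) = \<zero>\<^bsub>A\<^esub>" using BC unfolding a_kernel_def' by blast
    thus False using t s cl by simp
  qed
qed

section \<open>Invariant ideals of noetherian rings and induced maps\<close>

text \<open>The preimages of \<open>I\<close> under the powers of \<open>\<tau>\<close> form an ascending chain of ideals.  Where it is
  stationary, \<open>\<tau>\<^sup>N b \<in> I\<close> is equivalent to \<open>\<tau> (\<tau>\<^sup>N b) \<in> I\<close> for all \<open>b\<close>.  As every element has the form
  \<open>\<tau>\<^sup>N b\<close>, this says that \<open>\<tau> a \<in> I\<close> implies \<open>a \<in> I\<close>, and \<open>\<tau>\<close> is onto.\<close>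

lemma noetherian_invariant_ideal_image:
  assumes noeth: "noetherian R" and \<tau>: "\<tau> \<in> ring_iso R R" and I: "ideal I R" and \<tau>I: "\<tau> ` I \<subseteq> I"
  shows "\<tau> ` I = I"
proof (rule equalityI[OF \<tau>I], rule subsetI)
  fix a' assume a': "a' \<in> I"
  interpret I: ideal I R by (rule I)
  have \<tau>_hom: "\<tau> \<in> ring_hom R R" and surj: "\<tau> ` carrier R = carrier R"
    using \<tau> by (auto simp: ring_iso_def bij_betw_def)
  define C where "C n = {r \<in> carrier R. (\<tau> ^^ n) r \<in> I}" for n :: nat
  have pow_hom: "\<tau> ^^ n \<in> ring_hom R R" for n :: nat
  proof (induction n)
    case 0
    show ?case by (simp add: ring_hom_def)
  next
    case (Suc n)
    show ?case unfolding funpow.simps(2) by (rule ring_hom_trans[OF Suc \<tau>_hom])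
  qed
  have "left_ideal (C n) R" for n
  proof -
    interpret h: ring_hom_ring R R "\<tau> ^^ n"
      by (rule ring_hom_ringI2[OF I.ring_axioms I.ring_axioms pow_hom])
    interpret Cn: ideal "C n" R unfolding C_def by (rule h.ideal_vimage[OF I])
    show ?thesis unfolding left_ideal_def using Cn.additive_subgroup_axioms Cn.I_l_closed by blast
  qed
  moreover have "C n \<subseteq> C (Suc n)" for n using \<tau>I by (auto simp: C_def)
  ultimately obtain N where N: "\<And>n. n \<ge> N \<Longrightarrow> C n = C N"
    using noeth unfolding noetherian_def by meson
  have pow_surj: "(\<tau> ^^ n) ` carrier R = carrier R" for n :: nat
  proof (induction n)
    case (Suc n)
    show ?case using image_comp[of \<tau> "\<tau> ^^ n" "carrier R"] Suc surj by simp
  qed simp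
  have "a' \<in> \<tau> ` carrier R" unfolding surj using I.Icarr[OF a'] .
  then obtain a where a: "a \<in> carrier R" "a' = \<tau> a" by blast
  obtain b where b: "b \<in> carrier R" "a = (\<tau> ^^ N) b" using pow_surj[of N] a(1) by blast
  hence "b \<in> C (Suc N)" using a a' by (simp add: C_def)
  hence "a \<in> I" using N[of "Suc N"] b by (auto simp: C_def)
  thus "a' \<in> \<tau> ` I" using a by blast
qed

context ideal
begin

lemma Quot_carrier: "carrier (R Quot I) = (+>) I ` carrier R"
  by (auto simp: FactRing_def A_RCOSETS_def' image_def)

lemma Quot_eq_zero: "r \<in> carrier R \<Longrightarrow> I +> r = \<zero>\<^bsub>R Quot I\<^esub> \<longleftrightarrow> r \<in> I"
  using a_rcos_self[of r] a_rcos_const[of r] by (auto simp: FactRing_def)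

lemma quot_map_ring_hom:
  assumes \<tau>: "\<tau> \<in> ring_hom R R" and \<tau>I: "\<tau> ` I \<subseteq> I"
  shows "quot_map R I \<tau> \<in> ring_hom (R Quot I) (R Quot I)"
    and "r \<in> carrier R \<Longrightarrow> quot_map R I \<tau> (I +> r) = I +> \<tau> r"
proof -
  have m: "quot_map R I \<tau> (I +> r) = I +> \<tau> r" if "r \<in> carrier R" for r
    by (rule quot_map_coset[OF is_ideal _ \<tau>I _ that])
      (use ring_hom_closed[OF \<tau>] ring_hom_add[OF \<tau>] in auto)
  note \<pi> = rcos_ring_hom
  note cl = ring_hom_closed[OF \<tau>] ring_hom_closed[OF \<pi>]
  show "quot_map R I \<tau> \<in> ring_hom (R Quot I) (R Quot I)"
    by (rule ring_hom_memI)
      (auto simp: Quot_carrier m cl ring_hom_mult[OF \<pi>, symmetric] ring_hom_add[OF \<pi>, symmetric]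
        ring_hom_mult[OF \<tau>] ring_hom_add[OF \<tau>] ring_hom_one[OF \<tau>] ring_hom_one[OF \<pi>, symmetric])
  show "r \<in> carrier R \<Longrightarrow> quot_map R I \<tau> (I +> r) = I +> \<tau> r" by (rule m)
qed

lemma quot_map_skew_derivation:
  assumes \<tau>: "\<tau> \<in> ring_hom R R" and \<tau>I: "\<tau> ` I \<subseteq> I"
    and \<delta>: "left_skew_derivation R \<tau> \<delta>" and \<delta>I: "\<delta> ` I \<subseteq> I"
  shows "left_skew_derivation (R Quot I) (quot_map R I \<tau>) (quot_map R I \<delta>)"
    and "r \<in> carrier R \<Longrightarrow> quot_map R I \<delta> (I +> r) = I +> \<delta> r"
proof -
  note d = delta_closed[OF ring_axioms \<tau> \<delta>] delta_add[OF ring_axioms \<tau> \<delta>] delta_mult[OF ring_axioms \<tau> \<delta>]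
  have m: "quot_map R I \<delta> (I +> r) = I +> \<delta> r" if "r \<in> carrier R" for r
    by (rule quot_map_coset[OF is_ideal _ \<delta>I _ that]) (use d in auto)
  note \<pi> = rcos_ring_hom
  note cl = ring_hom_closed[OF \<tau>] ring_hom_closed[OF \<pi>] d(1)
  show "left_skew_derivation (R Quot I) (quot_map R I \<tau>) (quot_map R I \<delta>)"
    unfolding left_skew_derivation_def
    by (auto simp: Quot_carrier m quot_map_ring_hom(2)[OF \<tau> \<tau>I] cl d
        ring_hom_mult[OF \<pi>, symmetric] ring_hom_add[OF \<pi>, symmetric])
  show "r \<in> carrier R \<Longrightarrow> quot_map R I \<delta> (I +> r) = I +> \<delta> r" by (rule m)
qed

text \<open>Injectivity on \<open>R/I\<close> means that \<open>\<tau> a \<in> I\<close> implies \<open>a \<in> I\<close>; for this \<open>\<tau>\<close> has to map \<open>I\<close> onto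
  itself, not merely into itself.\<close>

lemma quot_map_bij:
  assumes \<tau>: "\<tau> \<in> ring_iso R R" and \<tau>I: "\<tau> ` I = I"
  shows "quot_map R I \<tau> ` carrier (R Quot I) = carrier (R Quot I)"
    and "inj_on (quot_map R I \<tau>) (carrier (R Quot I))"
proof -
  have \<tau>_hom: "\<tau> \<in> ring_hom R R" and surj: "\<tau> ` carrier R = carrier R" and inj: "inj_on \<tau> (carrier R)"
    using \<tau> by (auto simp: ring_iso_def bij_betw_def)
  have sub: "\<tau> ` I \<subseteq> I" using \<tau>I by simp
  have pre: "a \<in> I" if "a \<in> carrier R" "\<tau> a \<in> I" for a
  proof -
    obtain b where "b \<in> I" "\<tau> a = \<tau> b" using \<tau>I \<open>\<tau> a \<in> I\<close> by blast
    thus ?thesis using inj_onD[OF inj _ that(1) Icarr] by simp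
  qed
  note m = quot_map_ring_hom(2)[OF \<tau>_hom sub]
  interpret Q: ring "R Quot I" by (rule quotient_is_ring)
  interpret h: ring_hom_ring "R Quot I" "R Quot I" "quot_map R I \<tau>"
    by (rule ring_hom_ringI2[OF quotient_is_ring quotient_is_ring quot_map_ring_hom(1)[OF \<tau>_hom sub]])
  have "quot_map R I \<tau> ` carrier (R Quot I) = (+>) I ` (\<tau> ` carrier R)"
    unfolding Quot_carrier image_image by (rule image_cong) (simp_all add: m)
  thus "quot_map R I \<tau> ` carrier (R Quot I) = carrier (R Quot I)"
    by (simp only: surj Quot_carrier)
  show "inj_on (quot_map R I \<tau>) (carrier (R Quot I))"
  proof (rule h.trivial_ker_imp_inj, rule)
    show "a_kernel (R Quot I) (R Quot I) (quot_map R I \<tau>) \<subseteq> {\<zero>\<^bsub>R Quot I\<^esub>}"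
    proof
      fix q assume "q \<in> a_kernel (R Quot I) (R Quot I) (quot_map R I \<tau>)"
      hence q: "q \<in> carrier (R Quot I)" "quot_map R I \<tau> q = \<zero>\<^bsub>R Quot I\<^esub>"
        unfolding a_kernel_def' by blast+
      then obtain r where r: "r \<in> carrier R" "q = I +> r" by (auto simp: Quot_carrier)
      hence "r \<in> I" using q(2) pre ring_hom_closed[OF \<tau>_hom r(1)] by (simp add: m Quot_eq_zero)
      thus "q \<in> {\<zero>\<^bsub>R Quot I\<^esub>}" using r Quot_eq_zero by simp
    qed
    show "{\<zero>\<^bsub>R Quot I\<^esub>} \<subseteq> a_kernel (R Quot I) (R Quot I) (quot_map R I \<tau>)"
      unfolding a_kernel_def' by (simp add: h.hom_zero)
  qed
qed

end

section \<open>Prime invariant ideals\<close>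

text \<open>The homomorphism that reduces coefficients modulo \<open>I\<close> exists by the universal properties:
  on each Ore extension it is the reduction on scalars and sends the variable to the variable.\<close>

lemma amalg_reduction:
  fixes R :: "('a, 'm) ring_scheme" and S1 :: "('b, 'n) ring_scheme" and S2 :: "('c, 'k) ring_scheme"
    and T1 :: "('d, 'p) ring_scheme" and T2 :: "('e, 'q) ring_scheme"
  assumes I: "ideal I R"
    and \<tau>1: "\<tau>1 \<in> ring_hom R R" and \<tau>2: "\<tau>2 \<in> ring_hom R R"
    and \<delta>1: "left_skew_derivation R \<tau>1 \<delta>1" and \<delta>2: "left_skew_derivation R \<tau>2 \<delta>2"
    and S1: "ore_extension R \<tau>1 \<delta>1 S1 \<iota>1 x" and S2: "ore_extension R \<tau>2 \<delta>2 S2 \<iota>2 y"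
    and \<tau>I: "\<tau>1 ` I = I" "\<tau>2 ` I = I" and \<delta>I: "\<delta>1 ` I \<subseteq> I" "\<delta>2 ` I \<subseteq> I"
    and T1: "ore_extension (R Quot I) (quot_map R I \<tau>1) (quot_map R I \<delta>1) T1 \<kappa>1 x'"
    and T2: "ore_extension (R Quot I) (quot_map R I \<tau>2) (quot_map R I \<delta>2) T2 \<kappa>2 y'"
  obtains h where "h \<in> ring_hom (amalg R S1 \<iota>1 S2 \<iota>2) (amalg (R Quot I) T1 \<kappa>1 T2 \<kappa>2)"
    "h ` carrier (amalg R S1 \<iota>1 S2 \<iota>2) = carrier (amalg (R Quot I) T1 \<kappa>1 T2 \<kappa>2)"
    "(amalg_base R S1 \<iota>1 S2 \<iota>2 ` I) \<cdot>\<^bsub>amalg R S1 \<iota>1 S2 \<iota>2\<^esub> carrier (amalg R S1 \<iota>1 S2 \<iota>2)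
      = a_kernel (amalg R S1 \<iota>1 S2 \<iota>2) (amalg (R Quot I) T1 \<kappa>1 T2 \<kappa>2) h"
    "carrier (amalg R S1 \<iota>1 S2 \<iota>2) \<cdot>\<^bsub>amalg R S1 \<iota>1 S2 \<iota>2\<^esub> (amalg_base R S1 \<iota>1 S2 \<iota>2 ` I)
      = a_kernel (amalg R S1 \<iota>1 S2 \<iota>2) (amalg (R Quot I) T1 \<kappa>1 T2 \<kappa>2) h"
proof -
  interpret I: ideal I R by (rule I)
  note R = I.ring_axioms
  let ?Q = "R Quot I" and ?\<pi> = "\<lambda>r. I +>\<^bsub>R\<^esub> r"
  let ?S = "amalg R S1 \<iota>1 S2 \<iota>2" and ?A = "amalg ?Q T1 \<kappa>1 T2 \<kappa>2"
  let ?base = "amalg_base ?Q T1 \<kappa>1 T2 \<kappa>2"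
  let ?z = "case_bool (amalg_inl R S1 \<iota>1 S2 \<iota>2 x) (amalg_inr R S1 \<iota>1 S2 \<iota>2 y)"
  let ?z' = "case_bool (amalg_inl ?Q T1 \<kappa>1 T2 \<kappa>2 x') (amalg_inr ?Q T1 \<kappa>1 T2 \<kappa>2 y')"
  have sub: "\<tau>1 ` I \<subseteq> I" "\<tau>2 ` I \<subseteq> I" using \<tau>I by simp_all
  note q1 = I.quot_map_ring_hom[OF \<tau>1 sub(1)] and q2 = I.quot_map_ring_hom[OF \<tau>2 sub(2)]
  note d1 = I.quot_map_skew_derivation[OF \<tau>1 sub(1) \<delta>1 \<delta>I(1)]
    and d2 = I.quot_map_skew_derivation[OF \<tau>2 sub(2) \<delta>2 \<delta>I(2)]
  have P: "free_skew_variables R ?S (amalg_base R S1 \<iota>1 S2 \<iota>2) (case_bool \<tau>1 \<tau>2) (case_bool \<delta>1 \<delta>2) ?z"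
    by (rule amalg_ore_free[OF R \<tau>1 \<tau>2 \<delta>1 \<delta>2 S1 S2])
  have Q: "free_skew_variables ?Q ?A ?base (case_bool (quot_map R I \<tau>1) (quot_map R I \<tau>2))
      (case_bool (quot_map R I \<delta>1) (quot_map R I \<delta>2)) ?z'"
    by (rule amalg_ore_free[OF I.quotient_is_ring q1(1) q2(1) d1(1) d2(1) T1 T2])
  interpret Q: free_skew_variables ?Q ?A ?base "case_bool (quot_map R I \<tau>1) (quot_map R I \<tau>2)"
    "case_bool (quot_map R I \<delta>1) (quot_map R I \<delta>2)" ?z' by (rule Q)
  have S1': "ring S1" "\<iota>1 \<in> ring_hom R S1" "x \<in> carrier S1" using S1 by (auto simp: ore_extension_def)
  have S2': "ring S2" "\<iota>2 \<in> ring_hom R S2" "y \<in> carrier S2" using S2 by (auto simp: ore_extension_def)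
  have \<phi>: "?base \<circ> ?\<pi> \<in> ring_hom R ?A" by (rule ring_hom_trans[OF I.rcos_ring_hom Q.homh])
  have \<pi>c: "?\<pi> r \<in> carrier ?Q" if "r \<in> carrier R" for r by (rule ring_hom_closed[OF I.rcos_ring_hom that])
  obtain f1 where f1: "f1 \<in> ring_hom S1 ?A" "\<And>r. r \<in> carrier R \<Longrightarrow> f1 (\<iota>1 r) = ?base (?\<pi> r)"
    "f1 x = ?z' True"
    by (rule ore_extension_universal[OF R \<tau>1 \<delta>1 S1 Q.S.ring_axioms \<phi> Q.z_closed[of True]])
      (use Q.z_comm[OF \<pi>c, of _ True] q1(2) d1(2) in auto)
  obtain f2 where f2: "f2 \<in> ring_hom S2 ?A" "\<And>r. r \<in> carrier R \<Longrightarrow> f2 (\<iota>2 r) = ?base (?\<pi> r)"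
    "f2 y = ?z' False"
    by (rule ore_extension_universal[OF R \<tau>2 \<delta>2 S2 Q.S.ring_axioms \<phi> Q.z_closed[of False]])
      (use Q.z_comm[OF \<pi>c, of _ False] q2(2) d2(2) in auto)
  obtain h where h: "h \<in> ring_hom ?S ?A"
    "\<And>a. a \<in> carrier S1 \<Longrightarrow> h (amalg_inl R S1 \<iota>1 S2 \<iota>2 a) = f1 a"
    "\<And>b. b \<in> carrier S2 \<Longrightarrow> h (amalg_inr R S1 \<iota>1 S2 \<iota>2 b) = f2 b"
    using amalg_universal[OF R S1'(1) S2'(1) S1'(2) S2'(2) Q.S.ring_axioms f1(1) f2(1)] f1(2) f2(2)
    by auto
  have h_base: "h (amalg_base R S1 \<iota>1 S2 \<iota>2 r) = ?base (?\<pi> r)" if "r \<in> carrier R" for r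
    unfolding amalg_base_def[of R] using h(2) f1(2)[OF that] ring_hom_closed[OF S1'(2) that] by simp
  have h_z: "h (?z i) = ?z' i" for i
    using h(2)[OF S1'(3)] h(3)[OF S2'(3)] f1(3) f2(3) by (cases i) auto
  have ker: "I = a_kernel R ?Q ?\<pi>"
    unfolding a_kernel_def' using I.Quot_eq_zero I.Icarr by blast
  have inv: "I \<subseteq> (case i of True \<Rightarrow> \<tau>1 | False \<Rightarrow> \<tau>2) ` I" "(case i of True \<Rightarrow> \<delta>1 | False \<Rightarrow> \<delta>2) ` I \<subseteq> I" for i
    using \<tau>I \<delta>I by (auto split: bool.splits)
  note red = free_skew_reduction[OF P Q I.rcos_ring_hom I.Quot_carrier[symmetric] h(1) h_base h_z ker inv]
  show thesis by (rule that[OF h(1) red])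
qed

theorem corollary2p7:
  fixes R :: "('a, 'm) ring_scheme"
    and \<tau>1 \<tau>2 \<delta>1 \<delta>2 :: "'a \<Rightarrow> 'a"
    and S1 :: "('b, 'n) ring_scheme" and \<iota>1 :: "'a \<Rightarrow> 'b" and x :: 'b
    and S2 :: "('c, 'k) ring_scheme" and \<iota>2 :: "'a \<Rightarrow> 'c" and y :: 'c
    and I :: "'a set"
  assumes "noetherian R"
    and "\<tau>1 \<in> ring_iso R R" and "\<tau>2 \<in> ring_iso R R"
    and "left_skew_derivation R \<tau>1 \<delta>1" and "left_skew_derivation R \<tau>2 \<delta>2"
    and "ore_extension R \<tau>1 \<delta>1 S1 \<iota>1 x" and "ore_extension R \<tau>2 \<delta>2 S2 \<iota>2 y"
    and "prime_ideal I R"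
    and "\<forall>f\<in>{\<tau>1, \<tau>2, \<delta>1, \<delta>2}. f ` I \<subseteq> I"
  defines "S \<equiv> amalg R S1 \<iota>1 S2 \<iota>2"
    and "J \<equiv> amalg_base R S1 \<iota>1 S2 \<iota>2 ` I"
  shows "J \<cdot>\<^bsub>S\<^esub> carrier S = carrier S \<cdot>\<^bsub>S\<^esub> J \<and>
    prime_ideal (J \<cdot>\<^bsub>S\<^esub> carrier S) S \<and>
    (\<forall>(T1 :: ('d, 'p) ring_scheme) \<kappa>1 x' (T2 :: ('e, 'q) ring_scheme) \<kappa>2 y'.
       ore_extension (R Quot I) (quot_map R I \<tau>1) (quot_map R I \<delta>1) T1 \<kappa>1 x' \<and>
       ore_extension (R Quot I) (quot_map R I \<tau>2) (quot_map R I \<delta>2) T2 \<kappa>2 y' \<longrightarrow>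
       S Quot (J \<cdot>\<^bsub>S\<^esub> carrier S) \<simeq> amalg (R Quot I) T1 \<kappa>1 T2 \<kappa>2)"
proof -
  let ?Q = "R Quot I"
  interpret I: ideal I R using assms(8) by (simp add: prime_ideal_def)
  note R = I.ring_axioms and I = I.ideal_axioms
  have \<tau>: "\<tau>1 \<in> ring_hom R R" "\<tau>2 \<in> ring_hom R R" using assms(2,3) by (auto simp: ring_iso_def)
  have sub: "\<tau>1 ` I \<subseteq> I" "\<tau>2 ` I \<subseteq> I" and \<delta>I: "\<delta>1 ` I \<subseteq> I" "\<delta>2 ` I \<subseteq> I" using assms(9) by auto
  note \<tau>I = noetherian_invariant_ideal_image[OF assms(1,2) I sub(1)]
    noetherian_invariant_ideal_image[OF assms(1,3) I sub(2)]
  note q1 = I.quot_map_ring_hom(1)[OF \<tau>(1) sub(1)] and q2 = I.quot_map_ring_hom(1)[OF \<tau>(2) sub(2)]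
  note d1 = I.quot_map_skew_derivation(1)[OF \<tau>(1) sub(1) assms(4) \<delta>I(1)]
    and d2 = I.quot_map_skew_derivation(1)[OF \<tau>(2) sub(2) assms(5) \<delta>I(2)]
  note b1 = I.quot_map_bij[OF assms(2) \<tau>I(1)] and b2 = I.quot_map_bij[OF assms(3) \<tau>I(2)]
  note red = amalg_reduction[OF I \<tau> assms(4-7) \<tau>I \<delta>I, folded S_def, folded J_def]
  have rS: "ring S"
    unfolding S_def using assms(6,7) by (intro amalg_is_ring R) (auto simp: ore_extension_def)

  have iso: "S Quot (J \<cdot>\<^bsub>S\<^esub> carrier S) \<simeq> amalg ?Q T1 \<kappa>1 T2 \<kappa>2"
    if T: "ore_extension ?Q (quot_map R I \<tau>1) (quot_map R I \<delta>1) T1 \<kappa>1 x'"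
      "ore_extension ?Q (quot_map R I \<tau>2) (quot_map R I \<delta>2) T2 \<kappa>2 y'"
    for T1 :: "('d, 'p) ring_scheme" and \<kappa>1 x' and T2 :: "('e, 'q) ring_scheme" and \<kappa>2 y'
  proof -
    obtain h where h: "h \<in> ring_hom S (amalg ?Q T1 \<kappa>1 T2 \<kappa>2)"
      "h ` carrier S = carrier (amalg ?Q T1 \<kappa>1 T2 \<kappa>2)"
      "J \<cdot>\<^bsub>S\<^esub> carrier S = a_kernel S (amalg ?Q T1 \<kappa>1 T2 \<kappa>2) h"
      "carrier S \<cdot>\<^bsub>S\<^esub> J = a_kernel S (amalg ?Q T1 \<kappa>1 T2 \<kappa>2) h"
      by (rule red[OF T])
    have "ring (amalg ?Q T1 \<kappa>1 T2 \<kappa>2)"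
      using T by (intro amalg_is_ring I.quotient_is_ring) (auto simp: ore_extension_def)
    then interpret h: ring_hom_ring S "amalg ?Q T1 \<kappa>1 T2 \<kappa>2" h
      using rS h(1) by (intro ring_hom_ringI2)
    show ?thesis unfolding h(3) by (rule h.FactRing_iso[OF h(2)])
  qed

  \<comment> \<open>Primeness is a statement about \<open>S\<close> alone; it is tested on one choice of Ore extensions of \<open>R/I\<close>.\<close>
  define M1 where "M1 = ore_model ?Q (quot_map R I \<tau>1) (quot_map R I \<delta>1)"
  define M2 where "M2 = ore_model ?Q (quot_map R I \<tau>2) (quot_map R I \<delta>2)"
  obtain \<kappa>1 x' where M1: "ore_extension ?Q (quot_map R I \<tau>1) (quot_map R I \<delta>1) M1 \<kappa>1 x'"
    using ore_extension_exists[OF I.quotient_is_ring q1 d1] unfolding M1_def by blast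
  obtain \<kappa>2 y' where M2: "ore_extension ?Q (quot_map R I \<tau>2) (quot_map R I \<delta>2) M2 \<kappa>2 y'"
    using ore_extension_exists[OF I.quotient_is_ring q2 d2] unfolding M2_def by blast
  let ?A = "amalg ?Q M1 \<kappa>1 M2 \<kappa>2"
  obtain h where h: "h \<in> ring_hom S ?A" "h ` carrier S = carrier ?A"
    "J \<cdot>\<^bsub>S\<^esub> carrier S = a_kernel S ?A h" "carrier S \<cdot>\<^bsub>S\<^esub> J = a_kernel S ?A h"
    by (rule red[OF M1 M2])
  interpret A: free_skew_variables ?Q ?A "amalg_base ?Q M1 \<kappa>1 M2 \<kappa>2"
    "case_bool (quot_map R I \<tau>1) (quot_map R I \<tau>2)" "case_bool (quot_map R I \<delta>1) (quot_map R I \<delta>2)"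
    "case_bool (amalg_inl ?Q M1 \<kappa>1 M2 \<kappa>2 x') (amalg_inr ?Q M1 \<kappa>1 M2 \<kappa>2 y')"
    by (rule amalg_ore_free[OF I.quotient_is_ring q1 q2 d1 d2 M1 M2])
  have "\<one>\<^bsub>R\<^esub> \<notin> I" using I.one_imp_carrier assms(8) by (auto simp: prime_ideal_def)
  hence Q1: "\<one>\<^bsub>?Q\<^esub> \<noteq> \<zero>\<^bsub>?Q\<^esub>"
    using I.Quot_eq_zero[OF I.one_closed] ring_hom_one[OF I.rcos_ring_hom] by simp
  have A1: "\<one>\<^bsub>?A\<^esub> \<noteq> \<zero>\<^bsub>?A\<^esub>"
  proof
    assume "\<one>\<^bsub>?A\<^esub> = \<zero>\<^bsub>?A\<^esub>"
    hence "A.coord \<one>\<^bsub>?A\<^esub> [] = \<zero>\<^bsub>?Q\<^esub>" by (simp add: A.coord_zero)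
    thus False using A.coord_monomial[OF A.R.one_closed, of "[]"] Q1 by (simp add: A.word_Nil)
  qed
  have Q_prime: "\<exists>r\<in>carrier ?Q. a \<otimes>\<^bsub>?Q\<^esub> (r \<otimes>\<^bsub>?Q\<^esub> c) \<noteq> \<zero>\<^bsub>?Q\<^esub>"
    if ac: "a \<in> carrier ?Q" "c \<in> carrier ?Q" "a \<noteq> \<zero>\<^bsub>?Q\<^esub>" "c \<noteq> \<zero>\<^bsub>?Q\<^esub>" for a c
  proof -
    obtain a0 c0 where a0: "a0 \<in> carrier R" "a = I +>\<^bsub>R\<^esub> a0" and c0: "c0 \<in> carrier R" "c = I +>\<^bsub>R\<^esub> c0"
      using ac(1,2) unfolding I.Quot_carrier by blast
    hence "a0 \<notin> I" "c0 \<notin> I" using ac(3,4) I.Quot_eq_zero by simp_all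
    then obtain r where r: "r \<in> carrier R" "a0 \<otimes>\<^bsub>R\<^esub> (r \<otimes>\<^bsub>R\<^esub> c0) \<notin> I"
      using prime_ideal_elementwise[OF assms(8) R a0(1) c0(1)] by blast
    have "a \<otimes>\<^bsub>?Q\<^esub> ((I +>\<^bsub>R\<^esub> r) \<otimes>\<^bsub>?Q\<^esub> c) = I +>\<^bsub>R\<^esub> (a0 \<otimes>\<^bsub>R\<^esub> (r \<otimes>\<^bsub>R\<^esub> c0))"
      using a0 c0 r(1) by (simp add: ring_hom_mult[OF I.rcos_ring_hom])
    also have "\<dots> \<noteq> \<zero>\<^bsub>?Q\<^esub>" using r a0 c0 I.Quot_eq_zero by simp
    finally show ?thesis using ring_hom_closed[OF I.rcos_ring_hom r(1)] by blast
  qed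
  have A_prime: "\<exists>t\<in>carrier ?A. f \<otimes>\<^bsub>?A\<^esub> (t \<otimes>\<^bsub>?A\<^esub> g) \<noteq> \<zero>\<^bsub>?A\<^esub>"
    if "f \<in> carrier ?A" "g \<in> carrier ?A" "f \<noteq> \<zero>\<^bsub>?A\<^esub>" "g \<noteq> \<zero>\<^bsub>?A\<^esub>" for f g
  proof -
    have "\<exists>r\<in>carrier ?Q. f \<otimes>\<^bsub>?A\<^esub> (amalg_base ?Q M1 \<kappa>1 M2 \<kappa>2 r \<otimes>\<^bsub>?A\<^esub> g) \<noteq> \<zero>\<^bsub>?A\<^esub>"
      by (rule A.prime_skew_extension[OF _ _ Q_prime that(1,3,2,4)])
        (use b1 b2 in \<open>auto split: bool.splits\<close>)
    thus ?thesis using A.hom_closed by blast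
  qed
  have prime: "prime_ideal (J \<cdot>\<^bsub>S\<^esub> carrier S) S"
    unfolding h(3)
    by (rule prime_ideal_kernel[OF ring_hom_ringI2[OF rS A.S.ring_axioms h(1)] h(2) A1 A_prime])
  show ?thesis
  proof (intro conjI allI impI prime)
    show "J \<cdot>\<^bsub>S\<^esub> carrier S = carrier S \<cdot>\<^bsub>S\<^esub> J" using h(3,4) by simp
  qed (elim conjE, rule iso)
qed

end
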